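(* Let $\mathcal D=(D_1,\dots,D_n)$ be regular decomposition data. The Lie algebra $\mathfrak a$ lifts to $\hat{\mathfrak g}_{\mathcal D}$ (along the covering $\mu:\hat{\mathfrak g}_{\mathcal D}\to X_{\mathcal D}$), and integrates to a free algebraic action of $Z_{\mathcal D}$ on $\hat{\mathfrak g}_{\mathcal D}$.
   Context: A variety is a complex quasi-projective algebraic set. Let $\mathfrak g=\mathfrak{gl}(n,\mathbb C)$. For $x\in\mathfrak g$ and $1\le i\le n$, $x_i$ is the upper left $i\times i$ corner of $x$; $\mathfrak g_i=\{x_i:x\in\mathfrak g\}\cong\mathfrak{gl}(i,\mathbb C)$ is embedded in $\mathfrak g$ as the upper left corner, and $G_i\cong GL(i,\mathbb C)$ is the corresponding subgroup of $GL(n,\mathbb C)$, acting on $\mathfrak g_i$ by conjugation. Put $f_{i,j}(x)=\mathrm{Tr}((x_i)^j)$ for $1\le j\le i\le n$. An element $x\in\mathfrak g$ is strongly regular if $\{df_{i,j}(x):1\le j\le i\le n\}$ is linearly independent in $T_x^*\mathfrak g$; $\mathfrak g_{sreg}$ is the set of strongly regular elements. The Lie algebra $\mathfrak a=\mathrm{span}\{\xi_{f_{i,j}}:1\le j\le i\le n\}$ is the span of the Hamiltonian vector fields of the $f_{i,j}$ for the Lie–Poisson structure on $\mathfrak g\cong\mathfrak g^*$ (identification by the trace form); it is an abelian Lie algebra of dimension $\binom n2$. For each $i=1,\dots,n$ let $\mathfrak l_i$ be a standard (block diagonal) Levi subalgebra of $\mathfrak g_i$ with some block sizes $n_1,\dots,n_k$,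 let $\mathfrak z_i$ be the center of $\mathfrak l_i$, $\mathfrak z_{i,gen}$ the set of elements of $\mathfrak z_i$ whose centralizer in $\mathfrak g_i$ is $\mathfrak l_i$, and $e^i$ the unique principal nilpotent element of $\mathfrak l_i$ in Jordan canonical form. The regular decomposition class is $D_i=G_i\cdot(\mathfrak z_{i,gen}+e^i)$. A sequence $\mathcal D=(D_1,\dots,D_n)$ of such classes $D_i\subset\mathfrak g_i$ is called regular decomposition data. Put $$X_{\mathcal D}=\{x\in\mathfrak g: x_i\in D_i,\ i=1,\dots,n\}\cap\mathfrak g_{sreg},$$ $$\hat{\mathfrak g}_{\mathcal D}=\{(x,z_1,\dots,z_n)\in X_{\mathcal D}\times\prod_{i=1}^n\mathfrak z_{i,gen}: x_i\in G_i\cdot(z_i+e^i),\ i=1,\dots,n\},$$ and let $\mu:\hat{\mathfrak g}_{\mathcal D}\to X_{\mathcal D}$ be the projection $\mu(x,z_1,\dots,z_n)=x$, which is an étale covering of smooth varieties. The vector fields in $\mathfrak a$ are tangent to $X_{\mathcal D}$. Let $Z_{\mathcal D}=\prod_{i=1}^{n-1}Z_{G_i}(\mathfrak z_i+e^i)$, where $Z_{G_i}(\mathfrak z_i+e^i)$ is the subgroup of elements of $G_i$ centralizing every element of $\mathfrak z_i+e^i$; $Z_{\mathcal D}$ is a connected, abelian algebraic group.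
   Formalization: "Integrates" is read fibrewise: for each fixed (z_1,…,z_n) the infinitesimal action of Lie(Z_D) is the lift of 𝔞 via a linear isomorphism Lie(Z_D)≅𝔞 that may depend on (z_1,…,z_n); a single isomorphism for all of ĝ_D is impossible, e.g. for n=3 with x_2 regular semisimple. *)

theory Defs
  imports
    "HOL-Analysis.Derivative"
    "HOL-Algebra.Group_Action"
    "HOL-Library.FuncSet"
    "Jordan_Normal_Form.Jordan_Normal_Form"
begin

section \<open>Varieties of tuples of matrices\<close>

text \<open>
  Every variety below is a quasi-projective (in fact quasi-affine) subset of an affine space
  \<open>gl(d\<^sub>1) \<times> \<dots> \<times> gl(d\<^sub>r)\<close>. A point is a list of square complex matrices and
  \<open>ds = [d\<^sub>1, \<dots>, d\<^sub>r]\<close> is its shape; tangent vectors are lists of the same shape, and a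
  product of two varieties is realised by appending the lists.
\<close>

type_synonym point = "complex mat list"

definition aff :: "nat list \<Rightarrow> point set" where
  "aff ds = {p. list_all2 (\<lambda>M d. M \<in> carrier_mat d d) p ds}"

definition pt_add :: "point \<Rightarrow> point \<Rightarrow> point" where
  "pt_add p q = map2 (+) p q"

definition pt_scale :: "complex \<Rightarrow> point \<Rightarrow> point" where
  "pt_scale t p = map (\<lambda>M. t \<cdot>\<^sub>m M) p"

definition pt_diff :: "point \<Rightarrow> point \<Rightarrow> point" where
  "pt_diff p q = map2 (-) p q"

inductive_set poly_fun :: "nat list \<Rightarrow> (point \<Rightarrow> complex) set" for ds :: "nat list" where
  const: "(\<lambda>p. c) \<in> poly_fun ds"
| coord: "k < length ds \<Longrightarrow> a < ds ! k \<Longrightarrow> b < ds ! k \<Longrightarrow> (\<lambda>p. (p ! k) $$ (a, b)) \<in> poly_fun ds"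
| add: "F \<in> poly_fun ds \<Longrightarrow> H \<in> poly_fun ds \<Longrightarrow> (\<lambda>p. F p + H p) \<in> poly_fun ds"
| mult: "F \<in> poly_fun ds \<Longrightarrow> H \<in> poly_fun ds \<Longrightarrow> (\<lambda>p. F p * H p) \<in> poly_fun ds"

text \<open>The differential \<open>dF\<^sub>p(v)\<close> of a function on the whole affine space.\<close>

definition diff :: "(point \<Rightarrow> complex) \<Rightarrow> point \<Rightarrow> point \<Rightarrow> complex" where
  "diff F p v = deriv (\<lambda>t. F (pt_add p (pt_scale t v))) 0"

text \<open>
  The Zariski tangent space. The varieties are locally closed, so near a point they coincide with
  their closure, which is cut out by the polynomials used here.
\<close>

definition tangent :: "nat list \<Rightarrow> point set \<Rightarrow> point \<Rightarrow> point set" where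
  "tangent ds V p =
     {v \<in> aff ds. \<forall>F\<in>poly_fun ds. (\<forall>q\<in>V. F q = 0) \<longrightarrow> diff F p v = 0}"

definition local_fraction ::
  "nat list \<Rightarrow> point set \<Rightarrow> (point \<Rightarrow> complex) \<Rightarrow> point \<Rightarrow>
   (point \<Rightarrow> complex) \<Rightarrow> (point \<Rightarrow> complex) \<Rightarrow> bool" where
  "local_fraction ds V f p P Q \<longleftrightarrow> P \<in> poly_fun ds \<and> Q \<in> poly_fun ds \<and> Q p \<noteq> 0 \<and>
     (\<forall>q\<in>V. Q q \<noteq> 0 \<longrightarrow> f q = P q / Q q)"

definition regular_fun :: "nat list \<Rightarrow> point set \<Rightarrow> (point \<Rightarrow> complex) \<Rightarrow> bool" where
  "regular_fun ds V f \<longleftrightarrow> (\<forall>p\<in>V. \<exists>P Q. local_fraction ds V f p P Q)"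

definition morphism ::
  "nat list \<Rightarrow> nat list \<Rightarrow> point set \<Rightarrow> point set \<Rightarrow> (point \<Rightarrow> point) \<Rightarrow> bool" where
  "morphism ds es V W f \<longleftrightarrow> f \<in> V \<rightarrow> W \<and>
     (\<forall>k<length es. \<forall>a<es ! k. \<forall>b<es ! k. regular_fun ds V (\<lambda>q. (f q ! k) $$ (a, b)))"

text \<open>
  The differential of a regular function \<open>f\<close> on \<open>V\<close> along a tangent vector \<open>v\<close> to \<open>V\<close> at \<open>p\<close>,
  computed by the quotient rule. It does not depend on the fraction chosen, because \<open>v\<close> is
  annihilated by the differentials of the polynomials that vanish on \<open>V\<close>.
\<close>

definition diff_on ::
  "nat list \<Rightarrow> point set \<Rightarrow> (point \<Rightarrow> complex) \<Rightarrow> point \<Rightarrow> point \<Rightarrow> complex" where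
  "diff_on ds V f p v = (THE c. \<exists>P Q. local_fraction ds V f p P Q \<and>
     c = (diff P p v * Q p - P p * diff Q p v) / (Q p)\<^sup>2)"

definition tangent_map ::
  "nat list \<Rightarrow> nat list \<Rightarrow> point set \<Rightarrow> (point \<Rightarrow> point) \<Rightarrow> point \<Rightarrow> point \<Rightarrow> point" where
  "tangent_map ds es V f p v =
     map (\<lambda>k. mat (es ! k) (es ! k) (\<lambda>(a, b). diff_on ds V (\<lambda>q. (f q ! k) $$ (a, b)) p v))
       [0..<length es]"

text \<open>Vector fields are made extensional, so that equality of fields is equality on \<open>V\<close>.\<close>

definition vector_fields :: "nat list \<Rightarrow> point set \<Rightarrow> (point \<Rightarrow> point) set" where
  "vector_fields ds V = {\<eta> \<in> extensional V. morphism ds ds V (aff ds) \<eta> \<and>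
     (\<forall>p\<in>V. \<eta> p \<in> tangent ds V p)}"

definition vf_add :: "point set \<Rightarrow> (point \<Rightarrow> point) \<Rightarrow> (point \<Rightarrow> point) \<Rightarrow> point \<Rightarrow> point" where
  "vf_add V \<eta> \<zeta> = (\<lambda>p\<in>V. pt_add (\<eta> p) (\<zeta> p))"

definition vf_scale :: "point set \<Rightarrow> complex \<Rightarrow> (point \<Rightarrow> point) \<Rightarrow> point \<Rightarrow> point" where
  "vf_scale V c \<eta> = (\<lambda>p\<in>V. pt_scale c (\<eta> p))"

text \<open>In coordinates \<open>u\<^sub>m\<close>, \<open>[\<eta>, \<zeta>](u\<^sub>m) = \<eta>(\<zeta>(u\<^sub>m)) - \<zeta>(\<eta>(u\<^sub>m))\<close>.\<close>

definition vf_bracket ::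
  "nat list \<Rightarrow> point set \<Rightarrow> (point \<Rightarrow> point) \<Rightarrow> (point \<Rightarrow> point) \<Rightarrow> point \<Rightarrow> point" where
  "vf_bracket ds V \<eta> \<zeta> =
     (\<lambda>p\<in>V. pt_diff (tangent_map ds ds V \<zeta> p (\<eta> p)) (tangent_map ds ds V \<eta> p (\<zeta> p)))"


section \<open>Gelfand-Zeitlin functions and vector fields\<close>

text \<open>The space \<open>gl(n)\<close> is \<open>aff [n]\<close>: its points are the singleton lists \<open>[x]\<close>.\<close>

definition corner :: "nat \<Rightarrow> complex mat \<Rightarrow> complex mat" where
  "corner i x = mat i i (\<lambda>(a, b). x $$ (a, b))"

definition tr :: "complex mat \<Rightarrow> complex" where
  "tr A = (\<Sum>a<dim_row A. A $$ (a, a))"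

definition gz :: "nat \<Rightarrow> nat \<Rightarrow> point \<Rightarrow> complex" where
  "gz i j p = tr (corner i (p ! 0) ^\<^sub>m j)"

definition strongly_regular :: "nat \<Rightarrow> complex mat \<Rightarrow> bool" where
  "strongly_regular n x \<longleftrightarrow> x \<in> carrier_mat n n \<and>
     (\<forall>c :: nat \<Rightarrow> nat \<Rightarrow> complex.
        (\<forall>v\<in>aff [n]. (\<Sum>i=1..n. \<Sum>j=1..i. c i j * diff (gz i j) [x] v) = 0) \<longrightarrow>
        (\<forall>i\<in>{1..n}. \<forall>j\<in>{1..i}. c i j = 0))"

text \<open>\<open>df\<^sub>p\<close> seen as an element of \<open>gl(n)\<close> by means of the trace form.\<close>

definition gradient :: "nat \<Rightarrow> (point \<Rightarrow> complex) \<Rightarrow> point \<Rightarrow> complex mat" where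
  "gradient n f p =
     (THE y. y \<in> carrier_mat n n \<and> (\<forall>v\<in>carrier_mat n n. tr (y * v) = diff f p [v]))"

definition lie_poisson ::
  "nat \<Rightarrow> (point \<Rightarrow> complex) \<Rightarrow> (point \<Rightarrow> complex) \<Rightarrow> point \<Rightarrow> complex" where
  "lie_poisson n f h p =
     tr (p ! 0 * (gradient n f p * gradient n h p - gradient n h p * gradient n f p))"

definition hamiltonian_field :: "nat \<Rightarrow> (point \<Rightarrow> complex) \<Rightarrow> point \<Rightarrow> point" where
  "hamiltonian_field n f = (\<lambda>p\<in>aff [n].
     THE w. w \<in> aff [n] \<and> (\<forall>h\<in>poly_fun [n]. diff h p w = lie_poisson n f h p))"

text \<open>The Lie algebra \<open>\<aa>\<close>: linear combinations with constant coefficients of the Hamiltonian fields.\<close>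

definition gz_algebra :: "nat \<Rightarrow> (point \<Rightarrow> point) set" where
  "gz_algebra n = {\<xi>. \<exists>c :: nat \<Rightarrow> nat \<Rightarrow> complex. \<xi> = (\<lambda>p\<in>aff [n].
     [mat n n (\<lambda>(a, b).
        \<Sum>i=1..n. \<Sum>j=1..i. c i j * (hamiltonian_field n (gz i j) p ! 0) $$ (a, b))])}"


section \<open>Regular decomposition classes\<close>

text \<open>A standard Levi subalgebra is given by the list \<open>ns\<close> of its block sizes.\<close>

definition block_sizes :: "nat \<Rightarrow> nat list \<Rightarrow> bool" where
  "block_sizes i ns \<longleftrightarrow> (\<forall>m\<in>set ns. 0 < m) \<and> sum_list ns = i"

definition levi :: "nat list \<Rightarrow> complex mat set" where
  "levi ns = {diag_block_mat As | As. As \<in> aff ns}"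

definition levi_center :: "nat list \<Rightarrow> complex mat set" where
  "levi_center ns = {z \<in> levi ns. \<forall>y\<in>levi ns. z * y = y * z}"

definition levi_center_gen :: "nat list \<Rightarrow> complex mat set" where
  "levi_center_gen ns = {z \<in> levi_center ns.
     {y \<in> carrier_mat (sum_list ns) (sum_list ns). z * y = y * z} = levi ns}"

definition principal_nilpotent :: "nat list \<Rightarrow> complex mat" where
  "principal_nilpotent ns = jordan_matrix (map (\<lambda>m. (m, 0)) ns)"

text \<open>\<open>GL(i)\<close>-orbits under conjugation are the classes of \<open>similar_mat\<close>.\<close>

definition decomposition_class :: "nat list \<Rightarrow> complex mat set" where
  "decomposition_class ns = {y. \<exists>z\<in>levi_center_gen ns. similar_mat y (z + principal_nilpotent ns)}"

text \<open>\<open>D i\<close> is the list of block sizes of the Levi subalgebra defining the \<open>i\<close>-th class.\<close>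

definition regular_decomposition_data :: "nat \<Rightarrow> (nat \<Rightarrow> nat list) \<Rightarrow> bool" where
  "regular_decomposition_data n D \<longleftrightarrow> (\<forall>i\<in>{1..n}. block_sizes i (D i))"

definition X_set :: "nat \<Rightarrow> (nat \<Rightarrow> nat list) \<Rightarrow> complex mat set" where
  "X_set n D = {x \<in> carrier_mat n n. (\<forall>i\<in>{1..n}. corner i x \<in> decomposition_class (D i)) \<and>
     strongly_regular n x}"

text \<open>A point \<open>(x, z\<^sub>1, \<dots>, z\<^sub>n)\<close> of the covering is the list \<open>x # [z\<^sub>1, \<dots>, z\<^sub>n]\<close>.\<close>

definition center_tuples :: "nat \<Rightarrow> (nat \<Rightarrow> nat list) \<Rightarrow> point set" where
  "center_tuples n D = {zs. list_all2 (\<lambda>i z. z \<in> levi_center_gen (D i)) [1..<Suc n] zs}"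

definition cover :: "nat \<Rightarrow> (nat \<Rightarrow> nat list) \<Rightarrow> point set" where
  "cover n D = {x # zs | x zs. x \<in> X_set n D \<and> zs \<in> center_tuples n D \<and>
     list_all2 (\<lambda>i z. similar_mat (corner i x) (z + principal_nilpotent (D i))) [1..<Suc n] zs}"

definition cover_shape :: "nat \<Rightarrow> nat list" where
  "cover_shape n = n # [1..<Suc n]"

definition cover_proj :: "point \<Rightarrow> point" where
  "cover_proj p = [p ! 0]"


section \<open>The group\<close>

definition levi_centralizer :: "nat list \<Rightarrow> complex mat set" where
  "levi_centralizer ns = {g \<in> carrier_mat (sum_list ns) (sum_list ns). invertible_mat g \<and>
     (\<forall>z\<in>levi_center ns. g * (z + principal_nilpotent ns) = (z + principal_nilpotent ns) * g)}"

definition Z_group :: "nat \<Rightarrow> (nat \<Rightarrow> nat list) \<Rightarrow> point monoid" where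
  "Z_group n D = \<lparr>carrier = {ks. list_all2 (\<lambda>i k. k \<in> levi_centralizer (D i)) [1..<n] ks},
     mult = map2 (*), one = map 1\<^sub>m [1..<n]\<rparr>"

definition Z_shape :: "nat \<Rightarrow> nat list" where
  "Z_shape n = [1..<n]"

definition Z_lie :: "nat \<Rightarrow> (nat \<Rightarrow> nat list) \<Rightarrow> point set" where
  "Z_lie n D = tangent (Z_shape n) (carrier (Z_group n D)) \<one>\<^bsub>Z_group n D\<^esub>"


section \<open>Lifting and integration\<close>

definition is_lift ::
  "nat \<Rightarrow> (nat \<Rightarrow> nat list) \<Rightarrow> (point \<Rightarrow> point) \<Rightarrow> (point \<Rightarrow> point) \<Rightarrow> bool" where
  "is_lift n D \<xi> \<eta> \<longleftrightarrow> \<eta> \<in> vector_fields (cover_shape n) (cover n D) \<and>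
     (\<forall>p\<in>cover n D.
        tangent_map (cover_shape n) [n] (cover n D) cover_proj p (\<eta> p) = \<xi> (cover_proj p))"

definition gz_algebra_lifts :: "nat \<Rightarrow> (nat \<Rightarrow> nat list) \<Rightarrow> bool" where
  "gz_algebra_lifts n D \<longleftrightarrow>
     (\<forall>\<xi>\<in>gz_algebra n. \<exists>!\<eta>. is_lift n D \<xi> \<eta>) \<and>
     (\<forall>\<xi>\<in>gz_algebra n. \<forall>\<xi>'\<in>gz_algebra n. \<forall>\<eta> \<eta>' c. is_lift n D \<xi> \<eta> \<longrightarrow> is_lift n D \<xi>' \<eta>' \<longrightarrow>
        is_lift n D (vf_add (aff [n]) \<xi> \<xi>') (vf_add (cover n D) \<eta> \<eta>') \<and>
        is_lift n D (vf_scale (aff [n]) c \<xi>) (vf_scale (cover n D) c \<eta>) \<and>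
        is_lift n D (vf_bracket [n] (aff [n]) \<xi> \<xi>')
          (vf_bracket (cover_shape n) (cover n D) \<eta> \<eta>'))"

definition lift :: "nat \<Rightarrow> (nat \<Rightarrow> nat list) \<Rightarrow> (point \<Rightarrow> point) \<Rightarrow> point \<Rightarrow> point" where
  "lift n D \<xi> = (THE \<eta>. is_lift n D \<xi> \<eta>)"

definition algebraic_action ::
  "nat \<Rightarrow> (nat \<Rightarrow> nat list) \<Rightarrow> (point \<Rightarrow> point \<Rightarrow> point) \<Rightarrow> bool" where
  "algebraic_action n D \<alpha> \<longleftrightarrow> group_action (Z_group n D) (cover n D) \<alpha> \<and>
     morphism (Z_shape n @ cover_shape n) (cover_shape n)
       {k @ p | k p. k \<in> carrier (Z_group n D) \<and> p \<in> cover n D} (cover n D)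
       (\<lambda>m. \<alpha> (take (n - 1) m) (drop (n - 1) m))"

definition free_action ::
  "nat \<Rightarrow> (nat \<Rightarrow> nat list) \<Rightarrow> (point \<Rightarrow> point \<Rightarrow> point) \<Rightarrow> bool" where
  "free_action n D \<alpha> \<longleftrightarrow>
     (\<forall>p\<in>cover n D. stabilizer (Z_group n D) \<alpha> p = {\<one>\<^bsub>Z_group n D\<^esub>})"

text \<open>The fundamental vector field of \<open>Y\<close>: the differential at \<open>1\<close> of the orbit map \<open>k \<mapsto> k\<cdot>p\<close>.\<close>

definition fundamental_field ::
  "nat \<Rightarrow> (nat \<Rightarrow> nat list) \<Rightarrow> (point \<Rightarrow> point \<Rightarrow> point) \<Rightarrow> point \<Rightarrow> point \<Rightarrow> point" where
  "fundamental_field n D \<alpha> Y p =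
     tangent_map (Z_shape n) (cover_shape n) (carrier (Z_group n D)) (\<lambda>k. \<alpha> k p)
       \<one>\<^bsub>Z_group n D\<^esub> Y"

text \<open>
  The lifted fields preserve every fibre of \<open>(x, z\<^sub>1, \<dots>, z\<^sub>n) \<mapsto> (z\<^sub>1, \<dots>, z\<^sub>n)\<close>, so their flows
  live on these fibres. The action integrates the lift of \<open>\<aa>\<close> if on each fibre the infinitesimal
  action of \<open>Lie Z\<^sub>D\<close> is the lift of \<open>\<aa>\<close>, through a linear isomorphism \<open>Lie Z\<^sub>D \<cong> \<aa>\<close>
  (both Lie algebras are abelian).

  The isomorphism has to depend on the fibre. For \<open>n = 3\<close> and \<open>D 2 = [1, 1]\<close>, the element
  \<open>diag(1, 0)\<close> of \<open>Lie Z\<^sub>D\<close> acts where \<open>z\<^sub>2 = diag(a, b)\<close>, up to sign, by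
  \<open>[(x\<^sub>2 - b) / (a - b), x]\<close>, a combination of \<open>\<xi>\<close>'s whose coefficients depend on \<open>a, b\<close>; the
  flow \<open>Ad(exp(t x\<^sub>2))\<close> has periods depending on \<open>a, b\<close> and so no constant combination containing
  it comes from a one-parameter subgroup of an algebraic torus.
\<close>

definition integrates_lift ::
  "nat \<Rightarrow> (nat \<Rightarrow> nat list) \<Rightarrow> (point \<Rightarrow> point \<Rightarrow> point) \<Rightarrow> bool" where
  "integrates_lift n D \<alpha> \<longleftrightarrow> (\<forall>zs\<in>center_tuples n D. \<exists>\<phi>.
     bij_betw \<phi> (Z_lie n D) (gz_algebra n) \<and>
     (\<forall>Y\<in>Z_lie n D. \<forall>Y'\<in>Z_lie n D. \<phi> (pt_add Y Y') = vf_add (aff [n]) (\<phi> Y) (\<phi> Y')) \<and>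
     (\<forall>Y\<in>Z_lie n D. \<forall>c. \<phi> (pt_scale c Y) = vf_scale (aff [n]) c (\<phi> Y)) \<and>
     (\<forall>Y\<in>Z_lie n D. \<forall>x. x # zs \<in> cover n D \<longrightarrow>
        fundamental_field n D \<alpha> Y (x # zs) = lift n D (\<phi> Y) (x # zs)))"

end

theory Submission
  imports Defs
begin

text \<open>
  The Hamiltonian field of \<open>f\<^sub>i\<^sub>j\<close> at \<open>x\<close> is a multiple of \<open>[x, x\<^sub>i\<^sup>j\<^sup>-\<^sup>1]\<close>, the power being placed in the
  upper left corner. So \<open>\<aa>\<close> consists of the fields \<open>[x, y\<^sub>1 + \<dots> + y\<^sub>n\<^sub>-\<^sub>1]\<close> where \<open>y\<^sub>i\<close> is a polynomial
  in \<open>x\<^sub>i\<close>, and its flows conjugate \<open>x\<close> by elements of the centralizers of the corners \<open>x\<^sub>i\<close>. These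
  centralizers vary with \<open>x\<close>. The point of the covering is that a choice of \<open>z\<^sub>i\<close> identifies the
  centralizer of \<open>x\<^sub>i\<close> in \<open>GL(i)\<close> with the fixed group \<open>Z\<^sub>i\<close> of elements that centralize \<open>\<zz>\<^sub>i + e\<^sup>i\<close>: the matrix
  \<open>A = z\<^sub>i + e\<^sup>i\<close> is cyclic, so every matrix that commutes with \<open>A\<close> is a unique polynomial in \<open>A\<close> of
  degree less than \<open>i\<close> (\<open>commuting_eq_mat_poly\<close>), and evaluating this polynomial at \<open>x\<^sub>i\<close> transports
  it to the centralizer of \<open>x\<^sub>i\<close>. The vector of ones is cyclic for \<open>z\<^sub>i + e\<^sup>i\<close> whatever \<open>z\<^sub>i\<close> is
  (\<open>cyclic_jordan_shape\<close>), so by Cramer's rule the coefficients are regular functions.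

  An element \<open>k\<close> of the group acts on \<open>x\<close> by conjugation with \<open>\<gamma>\<^sub>1 \<dots> \<gamma>\<^sub>n\<^sub>-\<^sub>1\<close>, where \<open>\<gamma>\<^sub>i\<close> is \<open>k\<^sub>i\<close>
  transported to the centralizer of \<open>x\<^sub>i\<close>, and it leaves all \<open>z\<^sub>i\<close> fixed. The larger factors are
  applied first and fix the smaller corners. Hence \<open>x\<^sub>i\<close> is conjugated by \<open>\<gamma>\<^sub>1 \<dots> \<gamma>\<^sub>i\<^sub>-\<^sub>1\<close> only
  (\<open>corner_conjugate_commuting\<close>), and as transport commutes with conjugation the conjugating
  elements of two successive actions multiply to that of the product (\<open>gprod_twisted_mult\<close>).
  When the coefficients of the polynomials are held constant, the action becomes a map that preserves all
  \<open>f\<^sub>i\<^sub>j\<close> near \<open>x\<close>, and therefore it preserves strong regularity (\<open>strongly_regular_conjugate\<close>). If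
  \<open>k\<close> fixes \<open>x\<close>, then inductively \<open>\<gamma>\<^sub>i\<close> commutes with \<open>x\<^sub>i\<^sub>+\<^sub>1\<close> too; writing \<open>\<gamma>\<^sub>i - 1\<close> as a polynomial in
  \<open>x\<^sub>i\<close> and as a polynomial in \<open>x\<^sub>i\<^sub>+\<^sub>1\<close> gives a linear relation between differentials of the
  \<open>f\<^sub>i\<^sub>j\<close>, and so \<open>\<gamma>\<^sub>i = 1\<close> (\<open>conjugate_gprod_free\<close>).

  Differentiating \<open>t \<mapsto> (1 + t Y) \<cdot> p\<close> at \<open>0\<close> yields the tangent vectors \<open>(\<xi>(x), 0)\<close> of the covering
  for all \<open>\<xi>\<close> in \<open>\<aa>\<close> (\<open>moved_deriv\<close>, \<open>lifted_tangent\<close>). This is the only lift: a tangent vector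
  \<open>(0, w)\<close> satisfies \<open>tr ((z\<^sub>i + e\<^sup>i)\<^sup>j w\<^sub>i) = 0\<close> for all \<open>j\<close>, because the traces of the powers of \<open>x\<^sub>i\<close> and
  \<open>z\<^sub>i + e\<^sup>i\<close> agree on the covering. So \<open>tr (b w\<^sub>i) = 0\<close> for every \<open>b\<close> that commutes with \<open>z\<^sub>i + e\<^sup>i\<close>, and
  the projections \<open>b\<close> to single blocks show \<open>w\<^sub>i = 0\<close> (\<open>levi_center_trace_form\<close>). On the fibre over
  \<open>(z\<^sub>1, \<dots>, z\<^sub>n)\<close> the isomorphism from the Lie algebra of the group to \<open>\<aa>\<close> reads off the coefficients
  of the polynomials; it is injective because the fields \<open>[x, x\<^sub>i\<^sup>j]\<close> with \<open>j < i < n\<close> are linearly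
  independent, which can be checked at a nilpotent Jordan block (\<open>gz_field_inj\<close>).
\<close>

section \<open>Matrix polynomials, corners and extensions\<close>

lemma assoc_sq:
  "A \<in> carrier_mat n n \<Longrightarrow> B \<in> carrier_mat n n \<Longrightarrow> C \<in> carrier_mat n n \<Longrightarrow>
    (A * B) * C = A * (B * (C::complex mat))"
  by (rule assoc_mult_mat)

lemma mult_carrier_sq [simp]:
  "A \<in> carrier_mat n n \<Longrightarrow> B \<in> carrier_mat n n \<Longrightarrow> A * B \<in> carrier_mat n n"
  by (rule mult_carrier_mat)

declare minus_carrier_mat [simp]

lemma entry_mult:
  "A \<in> carrier_mat r m \<Longrightarrow> B \<in> carrier_mat m c \<Longrightarrow> a < r \<Longrightarrow> b < c \<Longrightarrow>
    (A * B) $$ (a, b) = (\<Sum>k<m. A $$ (a, k) * B $$ (k, b) :: complex)"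
  by (auto simp: scalar_prod_def atLeast0LessThan intro!: sum.cong)

lemma sum_swap_scaled:
  "(\<Sum>k\<in>K. g k * (\<Sum>j\<in>J. c j * P j k)) = (\<Sum>j\<in>J. c j * (\<Sum>k\<in>K. g k * P j k :: complex))"
proof -
  have "(\<Sum>k\<in>K. g k * (\<Sum>j\<in>J. c j * P j k)) = (\<Sum>k\<in>K. \<Sum>j\<in>J. c j * (g k * P j k))"
    unfolding sum_distrib_left by (simp add: mult.left_commute)
  also have "\<dots> = (\<Sum>j\<in>J. \<Sum>k\<in>K. c j * (g k * P j k))" by (rule sum.swap)
  finally show ?thesis by (simp add: sum_distrib_left)
qed

definition mat_poly :: "nat \<Rightarrow> (nat \<Rightarrow> complex) \<Rightarrow> complex mat \<Rightarrow> complex mat" where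
  "mat_poly m c A = mat (dim_row A) (dim_row A) (\<lambda>(a, b). \<Sum>j<m. c j * (A ^\<^sub>m j) $$ (a, b))"

lemma mat_poly_carrier [simp, intro]: "A \<in> carrier_mat n n \<Longrightarrow> mat_poly m c A \<in> carrier_mat n n"
  by (auto simp: mat_poly_def)

lemma mat_poly_entry:
  "A \<in> carrier_mat n n \<Longrightarrow> a < n \<Longrightarrow> b < n \<Longrightarrow>
    mat_poly m c A $$ (a, b) = (\<Sum>j<m. c j * (A ^\<^sub>m j) $$ (a, b))"
  by (auto simp: mat_poly_def)

text \<open>
  Relations \<open>G A = X G\<close> express conjugacy without inverses; with \<open>X = A\<close> they express commutation.
\<close>

lemma pow_intertwine:
  assumes "A \<in> carrier_mat n n" "X \<in> carrier_mat n n" "G \<in> carrier_mat n n" "G * A = X * (G::complex mat)"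
  shows "G * A ^\<^sub>m j = X ^\<^sub>m j * G"
proof (induction j)
  case 0 then show ?case using assms by auto
next
  case (Suc j)
  have "G * A ^\<^sub>m Suc j = (G * A ^\<^sub>m j) * A" using assms by (simp add: assoc_sq[of _ n])
  also have "\<dots> = X ^\<^sub>m j * (G * A)" using assms Suc by (simp add: assoc_sq[of _ n])
  also have "\<dots> = X ^\<^sub>m Suc j * G" using assms by (simp add: assoc_sq[of _ n])
  finally show ?case .
qed

lemma mat_poly_intertwine:
  assumes "A \<in> carrier_mat n n" "X \<in> carrier_mat n n" "G \<in> carrier_mat n n" "G * A = X * G"
  shows "G * mat_poly m c A = mat_poly m c X * G"
proof (rule eq_matI)
  fix a b assume "a < dim_row (mat_poly m c X * G)" "b < dim_col (mat_poly m c X * G)"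
  then have ab: "a < n" "b < n" using assms by (auto simp: mat_poly_def)
  have "(G * mat_poly m c A) $$ (a, b) = (\<Sum>k<n. G $$ (a, k) * (\<Sum>j<m. c j * (A ^\<^sub>m j) $$ (k, b)))"
    using assms ab by (subst entry_mult[of _ n n _ n]) (auto simp: mat_poly_entry[of _ n])
  also have "\<dots> = (\<Sum>j<m. c j * (\<Sum>k<n. G $$ (a, k) * (A ^\<^sub>m j) $$ (k, b)))"
    by (rule sum_swap_scaled)
  also have "\<dots> = (\<Sum>j<m. c j * (\<Sum>k<n. (X ^\<^sub>m j) $$ (a, k) * G $$ (k, b)))"
  proof (rule sum.cong[OF refl], rule arg_cong[of _ _ "(*) (c _)"])
    fix j
    have "(G * A ^\<^sub>m j) $$ (a, b) = (X ^\<^sub>m j * G) $$ (a, b)" by (simp add: pow_intertwine[OF assms])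
    then show "(\<Sum>k<n. G $$ (a, k) * (A ^\<^sub>m j) $$ (k, b)) = (\<Sum>k<n. (X ^\<^sub>m j) $$ (a, k) * G $$ (k, b))"
      using assms ab by (simp add: entry_mult[of _ n n _ n] del: index_mult_mat)
  qed
  also have "\<dots> = (\<Sum>k<n. (\<Sum>j<m. c j * (X ^\<^sub>m j) $$ (a, k)) * G $$ (k, b))"
    using sum_swap_scaled[of "\<lambda>k. G $$ (k, b)" c "\<lambda>j k. (X ^\<^sub>m j) $$ (a, k)" "{..<m}" "{..<n}", symmetric]
    by (simp add: mult.commute)
  also have "\<dots> = (mat_poly m c X * G) $$ (a, b)"
    using assms ab by (subst entry_mult[of _ n n _ n]) (auto simp: mat_poly_entry[of _ n])
  finally show "(G * mat_poly m c A) $$ (a, b) = (mat_poly m c X * G) $$ (a, b)" .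
qed (use assms in \<open>auto simp: mat_poly_def\<close>)

lemma corner_carrier [simp, intro]: "corner i x \<in> carrier_mat i i"
  and corner_dim [simp]: "dim_row (corner i x) = i" "dim_col (corner i x) = i"
  by (auto simp: corner_def)

lemma corner_entry [simp]: "a < i \<Longrightarrow> b < i \<Longrightarrow> corner i x $$ (a, b) = x $$ (a, b)"
  by (auto simp: corner_def)

lemma corner_corner [simp]: "i \<le> k \<Longrightarrow> corner i (corner k x) = corner i x"
  by (rule eq_matI) auto

lemma corner_id [simp]: "x \<in> carrier_mat n n \<Longrightarrow> corner n x = x"
  by (rule eq_matI) auto

text \<open>
  The embedding of \<open>GL(i)\<close> in \<open>GL(n)\<close>; the embedding \<open>pad\<close> of \<open>gl(i)\<close> in \<open>gl(n)\<close> is its differential.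
\<close>

definition extend_by_one :: "nat \<Rightarrow> complex mat \<Rightarrow> complex mat" where
  "extend_by_one n A = mat n n (\<lambda>(a, b). if a < dim_row A \<and> b < dim_row A then A $$ (a, b) else of_bool (a = b))"

definition pad :: "nat \<Rightarrow> complex mat \<Rightarrow> complex mat" where
  "pad n A = mat n n (\<lambda>(a, b). if a < dim_row A \<and> b < dim_row A then A $$ (a, b) else 0)"

lemma extend_carrier [simp, intro]: "extend_by_one n A \<in> carrier_mat n n" "pad n A \<in> carrier_mat n n"
  and extend_dim [simp]: "dim_row (extend_by_one n A) = n" "dim_col (extend_by_one n A) = n"
    "dim_row (pad n A) = n" "dim_col (pad n A) = n"
  by (auto simp: extend_by_one_def pad_def)

lemma corner_mult_left:
  assumes "A \<in> carrier_mat n n" "B \<in> carrier_mat n n" "k \<le> n"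
    and "(\<forall>a<k. \<forall>b\<in>{k..<n}. A $$ (a, b) = 0) \<or> (\<forall>a\<in>{k..<n}. \<forall>b<k. B $$ (a, b) = 0)"
  shows "corner k (A * B) = corner k A * corner k B"
proof (rule eq_matI)
  fix a b assume "a < dim_row (corner k A * corner k B)" "b < dim_col (corner k A * corner k B)"
  then have ab: "a < k" "b < k" by auto
  have "(A * B) $$ (a, b) = (\<Sum>l<n. A $$ (a, l) * B $$ (l, b))"
    using assms ab by (intro entry_mult[of _ n n _ n]) auto
  also have "\<dots> = (\<Sum>l<k. A $$ (a, l) * B $$ (l, b))"
    using assms ab by (intro sum.mono_neutral_right) (auto simp: not_less)
  finally show "corner k (A * B) $$ (a, b) = (corner k A * corner k B) $$ (a, b)"
    using ab by (subst entry_mult[of _ k k _ k]) auto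
qed auto

lemma corner_extend_mult:
  assumes "A \<in> carrier_mat i i" "B \<in> carrier_mat n n" "i \<le> k" "k \<le> n"
  shows "corner k (extend_by_one n A * B) = extend_by_one k A * corner k B"
    and "corner k (B * extend_by_one n A) = corner k B * extend_by_one k A"
proof -
  have e: "corner k (extend_by_one n A) = extend_by_one k A"
    using assms by (intro eq_matI) (auto simp: extend_by_one_def)
  show "corner k (extend_by_one n A * B) = extend_by_one k A * corner k B"
    unfolding e[symmetric] using assms by (intro corner_mult_left[of _ n]) (auto simp: extend_by_one_def)
  show "corner k (B * extend_by_one n A) = corner k B * extend_by_one k A"
    unfolding e[symmetric] using assms by (intro corner_mult_left[of _ n]) (auto simp: extend_by_one_def)
qed

lemma extend_extend: "A \<in> carrier_mat i i \<Longrightarrow> i \<le> k \<Longrightarrow> k \<le> n \<Longrightarrow> extend_by_one n (extend_by_one k A) = extend_by_one n A"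
  by (intro eq_matI) (auto simp: extend_by_one_def)

lemma pad_pad: "A \<in> carrier_mat i i \<Longrightarrow> i \<le> k \<Longrightarrow> k \<le> n \<Longrightarrow> pad n (pad k A) = pad n A"
  by (intro eq_matI) (auto simp: pad_def)

lemma extend_id [simp]: "A \<in> carrier_mat n n \<Longrightarrow> extend_by_one n A = A"
  and pad_id [simp]: "A \<in> carrier_mat n n \<Longrightarrow> pad n A = A"
  by (auto simp: extend_by_one_def pad_def)

lemma extend_one [simp]: "i \<le> n \<Longrightarrow> extend_by_one n (1\<^sub>m i) = 1\<^sub>m n"
  by (intro eq_matI) (auto simp: extend_by_one_def)

lemma pad_zero [simp]: "pad n (0\<^sub>m i i) = 0\<^sub>m n n"
  by (intro eq_matI) (auto simp: pad_def)

lemma pad_extend: "A \<in> carrier_mat i i \<Longrightarrow> i \<le> n \<Longrightarrow> pad n (A - 1\<^sub>m i) = extend_by_one n A - 1\<^sub>m n"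
  by (intro eq_matI) (auto simp: extend_by_one_def pad_def)

lemma corner_pad_mult:
  assumes "A \<in> carrier_mat i i" "B \<in> carrier_mat n n" "i \<le> k" "k \<le> n"
  shows "corner k (pad n A * B) = pad k A * corner k B"
    and "corner k (B * pad n A) = corner k B * pad k A"
proof -
  have e: "corner k (pad n A) = pad k A"
    using assms by (intro eq_matI) (auto simp: pad_def)
  show "corner k (pad n A * B) = pad k A * corner k B"
    unfolding e[symmetric] using assms by (intro corner_mult_left[of _ n]) (auto simp: pad_def)
  show "corner k (B * pad n A) = corner k B * pad k A"
    unfolding e[symmetric] using assms by (intro corner_mult_left[of _ n]) (auto simp: pad_def)
qed

lemma extend_mult:
  assumes "A \<in> carrier_mat i i" "B \<in> carrier_mat i i" "i \<le> n"
  shows "extend_by_one n (A * B) = extend_by_one n A * extend_by_one n B"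
proof (rule eq_matI)
  fix a b assume "a < dim_row (extend_by_one n A * extend_by_one n B)" "b < dim_col (extend_by_one n A * extend_by_one n B)"
  then have ab: "a < n" "b < n" by auto
  have "(extend_by_one n A * extend_by_one n B) $$ (a, b) = (\<Sum>l<n. extend_by_one n A $$ (a, l) * extend_by_one n B $$ (l, b))"
    using assms ab by (intro entry_mult) auto
  also have "\<dots> = extend_by_one n (A * B) $$ (a, b)"
  proof (cases "a < i")
    case True
    have "(\<Sum>l<n. extend_by_one n A $$ (a, l) * extend_by_one n B $$ (l, b)) = (\<Sum>l<i. extend_by_one n A $$ (a, l) * extend_by_one n B $$ (l, b))"
      using assms ab True by (intro sum.mono_neutral_right) (auto simp: extend_by_one_def)
    also have "\<dots> = extend_by_one n (A * B) $$ (a, b)"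
    proof (cases "b < i")
      case b: True
      then show ?thesis using assms ab True
        by (simp add: extend_by_one_def scalar_prod_def atLeast0LessThan)
    next
      case b: False
      then show ?thesis using assms ab True
        by (auto simp add: extend_by_one_def intro!: sum.neutral)
    qed
    finally show ?thesis .
  next
    case False
    have "(\<Sum>l<n. extend_by_one n A $$ (a, l) * extend_by_one n B $$ (l, b)) = (\<Sum>l\<in>{a}. extend_by_one n A $$ (a, l) * extend_by_one n B $$ (l, b))"
      using assms ab False by (intro sum.mono_neutral_right) (auto simp: extend_by_one_def)
    then show ?thesis using assms ab False by (auto simp: extend_by_one_def)
  qed
  finally show "extend_by_one n (A * B) $$ (a, b) = (extend_by_one n A * extend_by_one n B) $$ (a, b)" by simp
qed auto

lemma pad_mult:
  assumes "A \<in> carrier_mat i i" "B \<in> carrier_mat i i" "i \<le> n"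
  shows "pad n (A * B) = pad n A * pad n B"
proof (rule eq_matI)
  fix a b assume "a < dim_row (pad n A * pad n B)" "b < dim_col (pad n A * pad n B)"
  then have ab: "a < n" "b < n" by auto
  have "(pad n A * pad n B) $$ (a, b) = (\<Sum>l<n. pad n A $$ (a, l) * pad n B $$ (l, b))"
    using assms ab by (intro entry_mult) auto
  also have "\<dots> = (\<Sum>l<i. pad n A $$ (a, l) * pad n B $$ (l, b))"
    using assms ab by (intro sum.mono_neutral_right) (auto simp: pad_def)
  also have "\<dots> = pad n (A * B) $$ (a, b)"
    using assms ab by (auto simp add: pad_def scalar_prod_def atLeast0LessThan)
  finally show "pad n (A * B) $$ (a, b) = (pad n A * pad n B) $$ (a, b)" by simp
qed auto

lemma tr_mult:
  "A \<in> carrier_mat n m \<Longrightarrow> B \<in> carrier_mat m n \<Longrightarrow> tr (A * B) = (\<Sum>a<n. \<Sum>k<m. A $$ (a, k) * B $$ (k, a))"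
  by (auto simp: tr_def entry_mult[of _ n m _ n] simp del: index_mult_mat(1) intro!: sum.cong)

lemma tr_comm: "A \<in> carrier_mat n m \<Longrightarrow> B \<in> carrier_mat m n \<Longrightarrow> tr (A * B) = tr (B * A)"
  by (simp add: tr_mult[of A n m B] tr_mult[of B m n A] mult.commute) (rule sum.swap)

lemma tr_add: "A \<in> carrier_mat n n \<Longrightarrow> B \<in> carrier_mat n n \<Longrightarrow> tr (A + B) = tr A + tr B"
  and tr_diff: "A \<in> carrier_mat n n \<Longrightarrow> B \<in> carrier_mat n n \<Longrightarrow> tr (A - B) = tr A - tr B"
  and tr_smult: "A \<in> carrier_mat n n \<Longrightarrow> tr (c \<cdot>\<^sub>m A) = c * tr A"
  by (auto simp: tr_def sum.distrib sum_subtractf sum_distrib_left)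

lemma tr_pad_mult:
  assumes "A \<in> carrier_mat i i" "v \<in> carrier_mat n n" "i \<le> n"
  shows "tr (pad n A * v) = tr (A * corner i v)"
proof -
  have "tr (pad n A * v) = (\<Sum>a<n. \<Sum>l<n. pad n A $$ (a, l) * v $$ (l, a))"
    using assms by (intro tr_mult) auto
  also have "\<dots> = (\<Sum>a<i. \<Sum>l<n. pad n A $$ (a, l) * v $$ (l, a))"
    using assms by (intro sum.mono_neutral_right) (auto simp: pad_def intro!: sum.neutral)
  also have "\<dots> = (\<Sum>a<i. \<Sum>l<i. A $$ (a, l) * v $$ (l, a))"
    using assms by (intro sum.cong refl sum.mono_neutral_cong_right) (auto simp: pad_def)
  also have "\<dots> = tr (A * corner i v)"
    using assms by (subst tr_mult[of _ i i]) auto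
  finally show ?thesis .
qed

lemma tr_nondegenerate:
  assumes "y \<in> carrier_mat n n" and "\<And>v. v \<in> carrier_mat n n \<Longrightarrow> tr (y * v) = 0"
  shows "y = 0\<^sub>m n n"
proof (rule eq_matI)
  fix a b assume "a < dim_row (0\<^sub>m n n :: complex mat)" "b < dim_col (0\<^sub>m n n :: complex mat)"
  then have ab: "a < n" "b < n" by auto
  let ?v = "mat n n (\<lambda>(r, s). of_bool (r = b \<and> s = a) :: complex)"
  have "tr (y * ?v) = (\<Sum>r<n. \<Sum>l<n. y $$ (r, l) * ?v $$ (l, r))"
    using assms by (intro tr_mult) auto
  also have "\<dots> = (\<Sum>r<n. if r = a then y $$ (r, b) else 0)"
    using ab by (intro sum.cong refl) (auto simp: of_bool_def if_distrib[of "(*) _"] cong: if_cong)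
  also have "\<dots> = y $$ (a, b)" using ab by simp
  finally show "y $$ (a, b) = 0\<^sub>m n n $$ (a, b)" using assms(2)[of ?v] ab by simp
qed (use assms in auto)

text \<open>
  Cramer's rule: a formula for the inverse whose entries are visibly regular where the determinant
  does not vanish.
\<close>

definition mat_inv :: "complex mat \<Rightarrow> complex mat" where
  "mat_inv A = inverse (det A) \<cdot>\<^sub>m adj_mat A"

lemma mat_inv_carrier [simp, intro]: "A \<in> carrier_mat n n \<Longrightarrow> mat_inv A \<in> carrier_mat n n"
  by (simp add: mat_inv_def adj_mat)

lemma mat_inv:
  assumes "A \<in> carrier_mat n n" "det A \<noteq> 0"
  shows "A * mat_inv A = 1\<^sub>m n" "mat_inv A * A = 1\<^sub>m n"
proof -
  have "A * mat_inv A = inverse (det A) \<cdot>\<^sub>m (A * adj_mat A)"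
    using adj_mat(1)[OF assms(1)] assms unfolding mat_inv_def by (subst mult_smult_distrib[of _ n n]) auto
  then show "A * mat_inv A = 1\<^sub>m n" using assms by (auto simp: adj_mat smult_smult_assoc)
  have "mat_inv A * A = inverse (det A) \<cdot>\<^sub>m (adj_mat A * A)"
    using adj_mat(1)[OF assms(1)] assms unfolding mat_inv_def by (subst mult_smult_assoc_mat[of _ n n]) auto
  then show "mat_inv A * A = 1\<^sub>m n" using assms by (auto simp: adj_mat smult_smult_assoc)
qed

lemma mat_inv_unique:
  assumes "A \<in> carrier_mat n n" "B \<in> carrier_mat n n" "A * B = 1\<^sub>m n"
  shows "det A \<noteq> 0" "mat_inv A = B"
proof -
  have "det A * det B = 1" using assms det_mult[of A n B] by simp
  then show d: "det A \<noteq> 0" by auto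
  have "mat_inv A = mat_inv A * (A * B)"
    using assms right_mult_one_mat[OF mat_inv_carrier[OF assms(1)]] by simp
  also have "\<dots> = (mat_inv A * A) * B" using assms by (simp add: assoc_sq[of _ n])
  finally show "mat_inv A = B" using assms mat_inv[OF assms(1) d] by simp
qed

lemma mat_cancel_left:
  assumes "A \<in> carrier_mat n n" "det A \<noteq> 0" "B \<in> carrier_mat n n" 
  shows "mat_inv A * (A * B) = B" "A * (mat_inv A * B) = B"
  using assms mat_inv[OF assms(1,2)] by (simp_all add: assoc_sq[of _ n, symmetric])

lemma det_extend: 
  assumes "A \<in> carrier_mat i i" "det A \<noteq> 0" "i \<le> n"
  shows "det (extend_by_one n A) \<noteq> 0" "mat_inv (extend_by_one n A) = extend_by_one n (mat_inv A)"
  using mat_inv_unique[of "extend_by_one n A" n "extend_by_one n (mat_inv A)"] assms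
  by (simp_all add: extend_mult[symmetric, of _ i] mat_inv)

definition conj_by :: "complex mat \<Rightarrow> complex mat \<Rightarrow> complex mat" where
  "conj_by M x = M * x * mat_inv M"

lemma conjugate_carrier [simp, intro]:
  "M \<in> carrier_mat n n \<Longrightarrow> x \<in> carrier_mat n n \<Longrightarrow> conj_by M x \<in> carrier_mat n n"
  by (auto simp: conj_by_def)

lemma conjugate_iff:
  assumes "M \<in> carrier_mat n n" "det M \<noteq> 0" "x \<in> carrier_mat n n" "y \<in> carrier_mat n n"
  shows "conj_by M x = y \<longleftrightarrow> M * x = y * M"
proof
  assume "conj_by M x = y"
  then have "y * M = M * (x * (mat_inv M * M))"
    using assms by (auto simp: conj_by_def assoc_sq[of _ n] simp del: mat_inv)
  then show "M * x = y * M" using assms mat_inv[OF assms(1,2)] by simp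
next
  assume "M * x = y * M"
  then have "conj_by M x = y * (M * mat_inv M)"
    using assms by (simp add: conj_by_def assoc_sq[of _ n])
  then show "conj_by M x = y" using assms mat_inv[OF assms(1,2)] by simp
qed

lemma conjugate_mult:
  assumes "M \<in> carrier_mat n n" "det M \<noteq> 0" "N \<in> carrier_mat n n" "det N \<noteq> 0" "x \<in> carrier_mat n n"
  shows "conj_by (M * N) x = conj_by M (conj_by N x)"
proof -
  have d: "det (M * N) \<noteq> 0" using assms by (simp add: det_mult[of _ n])
  have N: "N * x = conj_by N x * N" using conjugate_iff[of N n x "conj_by N x"] assms by auto
  have M: "M * conj_by N x = conj_by M (conj_by N x) * M"
    using conjugate_iff[of M n "conj_by N x" "conj_by M (conj_by N x)"] assms by auto
  have "M * N * x = M * (conj_by N x * N)" using assms N by (simp add: assoc_sq[of _ n])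
  also have "\<dots> = (M * conj_by N x) * N" using assms by (simp add: assoc_sq[of _ n])
  also have "\<dots> = conj_by M (conj_by N x) * (M * N)" 
    unfolding M using assms by (simp add: assoc_sq[of _ n])
  finally show ?thesis using conjugate_iff[of "M * N" n x] d assms by auto
qed

section \<open>Matrices with entries in an algebra of functions\<close>

text \<open>
  Polynomial functions, regular functions on a variety and functions of one variable that are
  differentiable at \<open>0\<close> are needed for the same matrix expressions. The filter tells where the
  values of a function matter: everywhere, on the variety, or near \<open>0\<close>.
\<close>

locale function_algebra =
  fixes S :: "('a \<Rightarrow> complex) set" and Fl :: "'a filter"
  assumes const: "(\<lambda>q. c) \<in> S"
    and add: "f \<in> S \<Longrightarrow> g \<in> S \<Longrightarrow> (\<lambda>q. f q + g q) \<in> S"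
    and mult: "f \<in> S \<Longrightarrow> g \<in> S \<Longrightarrow> (\<lambda>q. f q * g q) \<in> S"
    and cong: "f \<in> S \<Longrightarrow> eventually (\<lambda>q. g q = f q) Fl \<Longrightarrow> g \<in> S"
begin

lemma sum: "(\<And>i. i \<in> I \<Longrightarrow> f i \<in> S) \<Longrightarrow> (\<lambda>q. \<Sum>i\<in>I. f i q) \<in> S"
  by (induction I rule: infinite_finite_induct) (auto intro: const add)

lemma prod: "(\<And>i. i \<in> I \<Longrightarrow> f i \<in> S) \<Longrightarrow> (\<lambda>q. \<Prod>i\<in>I. f i q) \<in> S"
  by (induction I rule: infinite_finite_induct) (auto intro: const mult)

definition mat_in :: "nat \<Rightarrow> nat \<Rightarrow> ('a \<Rightarrow> complex mat) \<Rightarrow> bool" where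
  "mat_in r c F \<longleftrightarrow> eventually (\<lambda>q. F q \<in> carrier_mat r c) Fl \<and>
     (\<forall>a<r. \<forall>b<c. (\<lambda>q. F q $$ (a, b)) \<in> S)"

lemma mat_inI:
  "eventually (\<lambda>q. F q \<in> carrier_mat r c) Fl \<Longrightarrow> (\<And>a b. a < r \<Longrightarrow> b < c \<Longrightarrow> (\<lambda>q. F q $$ (a, b)) \<in> S)
    \<Longrightarrow> mat_in r c F"
  by (auto simp: mat_in_def)

lemma mat_inD:
  assumes "mat_in r c F"
  shows "eventually (\<lambda>q. F q \<in> carrier_mat r c) Fl" "a < r \<Longrightarrow> b < c \<Longrightarrow> (\<lambda>q. F q $$ (a, b)) \<in> S"
  using assms by (auto simp: mat_in_def)

lemma mat_in_const: "M \<in> carrier_mat r c \<Longrightarrow> mat_in r c (\<lambda>q. M)"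
  by (auto intro!: mat_inI const)

lemma mat_in_mult:
  assumes "mat_in r m F" "mat_in m c G"
  shows "mat_in r c (\<lambda>q. F q * G q)"
proof (rule mat_inI)
  show "eventually (\<lambda>q. F q * G q \<in> carrier_mat r c) Fl"
    using mat_inD(1)[OF assms(1)] mat_inD(1)[OF assms(2)] by eventually_elim auto
  fix a b assume ab: "a < r" "b < c"
  show "(\<lambda>q. (F q * G q) $$ (a, b)) \<in> S"
  proof (rule cong)
    show "(\<lambda>q. \<Sum>k<m. F q $$ (a, k) * G q $$ (k, b)) \<in> S"
      using mat_inD(2)[OF assms(1)] mat_inD(2)[OF assms(2)] ab by (auto intro!: sum mult)
    show "eventually (\<lambda>q. (F q * G q) $$ (a, b) = (\<Sum>k<m. F q $$ (a, k) * G q $$ (k, b))) Fl"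
      using mat_inD(1)[OF assms(1)] mat_inD(1)[OF assms(2)]
      by eventually_elim (use ab entry_mult in blast)
  qed
qed

lemma mat_in_add:
  assumes "mat_in r c F" "mat_in r c G"
  shows "mat_in r c (\<lambda>q. F q + G q)"
proof (rule mat_inI)
  show "eventually (\<lambda>q. F q + G q \<in> carrier_mat r c) Fl"
    using mat_inD(1)[OF assms(1)] mat_inD(1)[OF assms(2)] by eventually_elim auto
  fix a b assume ab: "a < r" "b < c"
  show "(\<lambda>q. (F q + G q) $$ (a, b)) \<in> S"
  proof (rule cong)
    show "(\<lambda>q. F q $$ (a, b) + G q $$ (a, b)) \<in> S"
      using mat_inD(2)[OF assms(1)] mat_inD(2)[OF assms(2)] ab by (auto intro!: add)
    show "eventually (\<lambda>q. (F q + G q) $$ (a, b) = F q $$ (a, b) + G q $$ (a, b)) Fl"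
      using mat_inD(1)[OF assms(1)] mat_inD(1)[OF assms(2)]
      by eventually_elim (use ab in auto)
  qed
qed

lemma mat_in_smult:
  assumes "f \<in> S" "mat_in r c G"
  shows "mat_in r c (\<lambda>q. f q \<cdot>\<^sub>m G q)"
proof (rule mat_inI)
  show "eventually (\<lambda>q. f q \<cdot>\<^sub>m G q \<in> carrier_mat r c) Fl"
    using mat_inD(1)[OF assms(2)] by eventually_elim auto
  fix a b assume ab: "a < r" "b < c"
  show "(\<lambda>q. (f q \<cdot>\<^sub>m G q) $$ (a, b)) \<in> S"
  proof (rule cong)
    show "(\<lambda>q. f q * G q $$ (a, b)) \<in> S"
      using mat_inD(2)[OF assms(2)] assms ab by (auto intro!: mult)
    show "eventually (\<lambda>q. (f q \<cdot>\<^sub>m G q) $$ (a, b) = f q * G q $$ (a, b)) Fl"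
      using mat_inD(1)[OF assms(2)] by eventually_elim (use ab in auto)
  qed
qed

lemma mat_in_cong:
  assumes "mat_in r c F" "eventually (\<lambda>q. G q = F q) Fl"
  shows "mat_in r c G"
proof (rule mat_inI)
  show "eventually (\<lambda>q. G q \<in> carrier_mat r c) Fl"
    using mat_inD(1)[OF assms(1)] assms(2) by eventually_elim auto
  fix a b assume ab: "a < r" "b < c"
  show "(\<lambda>q. G q $$ (a, b)) \<in> S"
    by (rule cong[OF mat_inD(2)[OF assms(1) ab]])
      (use assms(2) in \<open>eventually_elim, auto\<close>)
qed

lemma mat_in_diff:
  assumes F: "mat_in r c F" and G: "mat_in r c G"
  shows "mat_in r c (\<lambda>q. F q - G q)"
proof (rule mat_in_cong)
  show "mat_in r c (\<lambda>q. F q + (- 1) \<cdot>\<^sub>m G q)"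
    by (intro mat_in_add mat_in_smult F G const)
  show "eventually (\<lambda>q. F q - G q = F q + (- 1) \<cdot>\<^sub>m G q) Fl"
    using mat_inD(1)[OF F] mat_inD(1)[OF G] by eventually_elim auto
qed

lemma mat_in_pow:
  assumes F: "mat_in n n F"
  shows "mat_in n n (\<lambda>q. F q ^\<^sub>m j)"
proof (induction j)
  case 0
  show ?case by (rule mat_in_cong[OF mat_in_const[of "1\<^sub>m n"]])
     (use mat_inD(1)[OF F] in \<open>auto elim: eventually_mono\<close>)
next
  case (Suc j)
  show ?case using mat_in_mult[OF Suc F] by simp
qed

lemma mat_in_mat:
  assumes "\<And>a b. a < r \<Longrightarrow> b < c \<Longrightarrow> (\<lambda>q. f q a b) \<in> S"
  shows "mat_in r c (\<lambda>q. mat r c (\<lambda>(a, b). f q a b))"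
  using assms by (intro mat_inI) auto

lemma mat_in_corner:
  assumes "mat_in n n F" "i \<le> n"
  shows "mat_in i i (\<lambda>q. corner i (F q))"
  using assms by (auto intro!: mat_inI mat_inD(2)[OF assms(1)])

lemma mat_in_extend:
  assumes "mat_in i i F"
  shows "mat_in n n (\<lambda>q. extend_by_one n (F q))" "mat_in n n (\<lambda>q. pad n (F q))"
proof -
  show "mat_in n n (\<lambda>q. extend_by_one n (F q))"
  proof (rule mat_in_cong)
    show "mat_in n n (\<lambda>q. mat n n (\<lambda>(a, b). if a < i \<and> b < i then F q $$ (a, b) else of_bool (a = b)))"
    proof (rule mat_in_mat)
      fix a b assume "a < n" "b < n"
      show "(\<lambda>q. if a < i \<and> b < i then F q $$ (a, b) else of_bool (a = b)) \<in> S"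
        using mat_inD(2)[OF assms] const by (cases "a < i \<and> b < i") auto
    qed
    show "eventually (\<lambda>q. extend_by_one n (F q) = mat n n (\<lambda>(a, b). if a < i \<and> b < i then F q $$ (a, b) else of_bool (a = b))) Fl"
      using mat_inD(1)[OF assms] by eventually_elim (auto simp: extend_by_one_def)
  qed
  show "mat_in n n (\<lambda>q. pad n (F q))"
  proof (rule mat_in_cong)
    show "mat_in n n (\<lambda>q. mat n n (\<lambda>(a, b). if a < i \<and> b < i then F q $$ (a, b) else 0))"
    proof (rule mat_in_mat)
      fix a b assume "a < n" "b < n"
      show "(\<lambda>q. if a < i \<and> b < i then F q $$ (a, b) else 0) \<in> S"
        using mat_inD(2)[OF assms] const by (cases "a < i \<and> b < i") auto
    qed
    show "eventually (\<lambda>q. pad n (F q) = mat n n (\<lambda>(a, b). if a < i \<and> b < i then F q $$ (a, b) else 0)) Fl"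
      using mat_inD(1)[OF assms] by eventually_elim (auto simp: pad_def)
  qed
qed

lemma mat_in_mat_poly:
  assumes "mat_in n n F" "\<And>j. j < m \<Longrightarrow> (\<lambda>q. c q j) \<in> S"
  shows "mat_in n n (\<lambda>q. mat_poly m (c q) (F q))"
proof (rule mat_in_cong)
  show "mat_in n n (\<lambda>q. mat n n (\<lambda>(a, b). \<Sum>j<m. c q j * (F q ^\<^sub>m j) $$ (a, b)))"
    using assms(2) by (intro mat_in_mat sum mult mat_inD(2)[OF mat_in_pow[OF assms(1)]]) auto
  show "eventually (\<lambda>q. mat_poly m (c q) (F q) = mat n n (\<lambda>(a, b). \<Sum>j<m. c q j * (F q ^\<^sub>m j) $$ (a, b))) Fl"
    using mat_inD(1)[OF assms(1)] by eventually_elim (auto simp: mat_poly_def)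
qed

lemma in_tr:
  assumes "mat_in n n F"
  shows "(\<lambda>q. tr (F q)) \<in> S"
proof (rule cong)
  show "(\<lambda>q. \<Sum>a<n. F q $$ (a, a)) \<in> S" using assms by (auto intro!: sum dest: mat_inD)
  show "eventually (\<lambda>q. tr (F q) = (\<Sum>a<n. F q $$ (a, a))) Fl"
    using mat_inD(1)[OF assms] by eventually_elim (auto simp: tr_def)
qed

lemma in_det:
  assumes "mat_in n n F"
  shows "(\<lambda>q. det (F q)) \<in> S"
proof (rule cong)
  show "(\<lambda>q. \<Sum>p\<in>{p. p permutes {0..<n}}. signof p * (\<Prod>i = 0..<n. F q $$ (i, p i))) \<in> S"
    using assms by (auto intro!: sum mult const prod mat_inD(2)[OF assms] dest: permutes_in_image)
  show "eventually (\<lambda>q. det (F q) = (\<Sum>p\<in>{p. p permutes {0..<n}}. signof p * (\<Prod>i = 0..<n. F q $$ (i, p i)))) Fl"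
    using mat_inD(1)[OF assms] by eventually_elim (auto simp: det_def')
qed

lemma mat_in_adj:
  assumes "mat_in n n F"
  shows "mat_in n n (\<lambda>q. adj_mat (F q))"
proof (rule mat_in_cong)
  have "mat_in (n - 1) (n - 1) (\<lambda>q. mat_delete (F q) b a)" if "a < n" "b < n" for a b
  proof (rule mat_in_cong)
    show "mat_in (n - 1) (n - 1) (\<lambda>q. mat (n - 1) (n - 1)
       (\<lambda>(i', j'). F q $$ (if i' < b then i' else Suc i', if j' < a then j' else Suc j')))"
      using that by (intro mat_in_mat mat_inD(2)[OF assms]) auto
    show "eventually (\<lambda>q. mat_delete (F q) b a = mat (n - 1) (n - 1)
       (\<lambda>(i', j'). F q $$ (if i' < b then i' else Suc i', if j' < a then j' else Suc j'))) Fl"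
      using mat_inD(1)[OF assms] by eventually_elim (auto simp: mat_delete_def)
  qed
  then show "mat_in n n (\<lambda>q. mat n n (\<lambda>(a, b). (-1) ^ (b + a) * det (mat_delete (F q) b a)))"
    by (intro mat_in_mat mult const in_det[of "n - 1"])
  show "eventually (\<lambda>q. adj_mat (F q) = mat n n (\<lambda>(a, b). (-1) ^ (b + a) * det (mat_delete (F q) b a))) Fl"
    using mat_inD(1)[OF assms] by eventually_elim (auto simp: adj_mat_def cofactor_def)
qed

end

locale function_algebra_inverse = function_algebra +
  assumes inverse: "f \<in> S \<Longrightarrow> eventually (\<lambda>q. f q \<noteq> 0) Fl \<Longrightarrow> (\<lambda>q. inverse (f q)) \<in> S"
begin

lemma mat_in_mat_inv:
  assumes "mat_in n n F" "eventually (\<lambda>q. det (F q) \<noteq> 0) Fl"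
  shows "mat_in n n (\<lambda>q. mat_inv (F q))"
  unfolding mat_inv_def by (intro mat_in_smult inverse in_det[OF assms(1)] mat_in_adj assms)

end

section \<open>Matrices with a cyclic vector\<close>

text \<open>
  The columns are \<open>A\<^sup>j u\<close> for the vector \<open>u\<close> of ones. This vector does not depend on \<open>A\<close>, so the
  entries of the Krylov matrix are polynomials in \<open>A\<close>.
\<close>

definition krylov :: "complex mat \<Rightarrow> complex mat" where
  "krylov A = mat (dim_row A) (dim_row A) (\<lambda>(a, j). \<Sum>b<dim_row A. (A ^\<^sub>m j) $$ (a, b))"

definition coef :: "complex mat \<Rightarrow> complex mat \<Rightarrow> nat \<Rightarrow> complex" where
  "coef A B j = (\<Sum>a<dim_row A. mat_inv (krylov A) $$ (j, a) * (\<Sum>b<dim_row A. B $$ (a, b)))"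

definition cyclic :: "nat \<Rightarrow> complex mat \<Rightarrow> bool" where
  "cyclic N A \<longleftrightarrow> A \<in> carrier_mat N N \<and> det (krylov A) \<noteq> 0"

lemma cyclic_carrier: "cyclic N A \<Longrightarrow> A \<in> carrier_mat N N"
  by (simp add: cyclic_def)

lemma krylov_carrier: "A \<in> carrier_mat N N \<Longrightarrow> krylov A \<in> carrier_mat N N"
  by (simp add: krylov_def)

lemma row_sum_mat_poly:
  assumes "A \<in> carrier_mat N N" "a < N"
  shows "(\<Sum>b<N. mat_poly N c A $$ (a, b)) = (\<Sum>j<N. krylov A $$ (a, j) * c j)"
proof -
  have "(\<Sum>b<N. mat_poly N c A $$ (a, b)) = (\<Sum>b<N. 1 * (\<Sum>j<N. c j * (A ^\<^sub>m j) $$ (a, b)))"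
    using assms by (simp add: mat_poly_entry[of _ N])
  also have "\<dots> = (\<Sum>j<N. krylov A $$ (a, j) * c j)"
    using assms by (subst sum_swap_scaled) (simp add: krylov_def mult.commute)
  finally show ?thesis .
qed

lemma krylov_coef:
  assumes "cyclic N A" "a < N"
  shows "(\<Sum>j<N. krylov A $$ (a, j) * coef A B j) = (\<Sum>b<N. B $$ (a, b))"
proof -
  let ?K = "krylov A" and ?f = "\<lambda>a. \<Sum>b<N. B $$ (a, b)"
  have A: "A \<in> carrier_mat N N" and K: "?K \<in> carrier_mat N N" "det ?K \<noteq> 0"
    using assms by (auto simp: cyclic_def krylov_carrier)
  have "(\<Sum>j<N. ?K $$ (a, j) * coef A B j) = (\<Sum>j<N. ?K $$ (a, j) * (\<Sum>a'<N. ?f a' * mat_inv ?K $$ (j, a')))"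
    using A by (simp add: coef_def mult.commute)
  also have "\<dots> = (\<Sum>a'<N. ?f a' * (\<Sum>j<N. ?K $$ (a, j) * mat_inv ?K $$ (j, a')))"
    by (rule sum_swap_scaled)
  also have "\<dots> = (\<Sum>a'<N. ?f a' * (1\<^sub>m N) $$ (a, a'))"
    using mat_inv(1)[OF K] K assms(2)
    by (intro sum.cong refl) (simp add: entry_mult[of ?K N N "mat_inv ?K" N, symmetric] del: index_mult_mat)
  also have "\<dots> = (\<Sum>a'<N. if a' = a then ?f a' else 0)"
    using assms(2) by (intro sum.cong refl) auto
  also have "\<dots> = ?f a" using assms(2) by simp
  finally show ?thesis .
qed

lemma coef_mat_poly:
  assumes "cyclic N A" "j < N"
  shows "coef A (mat_poly N c A) j = c j"
proof -
  let ?K = "krylov A"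
  have A: "A \<in> carrier_mat N N" and K: "?K \<in> carrier_mat N N" "det ?K \<noteq> 0"
    using assms by (auto simp: cyclic_def krylov_carrier)
  have "coef A (mat_poly N c A) j = (\<Sum>a<N. mat_inv ?K $$ (j, a) * (\<Sum>l<N. c l * ?K $$ (a, l)))"
    using A by (simp add: coef_def row_sum_mat_poly mult.commute)
  also have "\<dots> = (\<Sum>l<N. c l * (\<Sum>a<N. mat_inv ?K $$ (j, a) * ?K $$ (a, l)))"
    by (rule sum_swap_scaled)
  also have "\<dots> = (\<Sum>l<N. c l * (1\<^sub>m N) $$ (j, l))"
    using mat_inv(2)[OF K] K assms(2)
    by (intro sum.cong refl) (simp add: entry_mult[of "mat_inv ?K" N N ?K N, symmetric] del: index_mult_mat)
  also have "\<dots> = (\<Sum>l<N. if l = j then c l else 0)"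
    using assms(2) by (intro sum.cong refl) auto
  also have "\<dots> = c j" using assms(2) by simp
  finally show ?thesis .
qed

lemma mat_poly_cong: "(\<And>j. j < m \<Longrightarrow> c j = d j) \<Longrightarrow> mat_poly m c A = mat_poly m d A"
  by (simp add: mat_poly_def)

lemma coef_add:
  "A \<in> carrier_mat N N \<Longrightarrow> B \<in> carrier_mat N N \<Longrightarrow> C \<in> carrier_mat N N \<Longrightarrow>
    coef A (B + C) j = coef A B j + coef A C j"
  by (simp add: coef_def sum.distrib distrib_left)

lemma coef_smult:
  "A \<in> carrier_mat N N \<Longrightarrow> B \<in> carrier_mat N N \<Longrightarrow> coef A (s \<cdot>\<^sub>m B) j = s * coef A B j"
  by (simp add: coef_def sum_distrib_left mult_ac)

lemma mat_poly_commute: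
  "A \<in> carrier_mat n n \<Longrightarrow> A * mat_poly m c A = mat_poly m c A * A"
  by (rule mat_poly_intertwine[of _ n]) auto

text \<open>
  Both sides commute with \<open>A\<close> and agree on the cyclic vector \<open>u\<close>, hence on all \<open>A\<^sup>j u\<close>.
\<close>

lemma commuting_eq_mat_poly:
  assumes "cyclic N A" "B \<in> carrier_mat N N" "A * B = B * A"
  shows "mat_poly N (coef A B) A = B"
proof -
  let ?K = "krylov A" and ?P = "mat_poly N (coef A B) A"
  define C where "C = ?P - B"
  have A: "A \<in> carrier_mat N N" and K: "?K \<in> carrier_mat N N" "det ?K \<noteq> 0"
    using assms by (auto simp: cyclic_def krylov_carrier)
  have C: "C \<in> carrier_mat N N" using assms A by (auto simp: C_def)
  have comm: "C * A = A * C"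
    using A assms(2,3) mat_poly_commute[OF A] unfolding C_def
    by (subst minus_mult_distrib_mat[of _ N N], auto) (subst mult_minus_distrib_mat[of _ N N _ N], auto)
  have Cu: "(\<Sum>b<N. C $$ (a, b)) = 0" if "a < N" for a
    using that A assms(2) krylov_coef[OF assms(1) that, of B]
    by (simp add: C_def sum_subtractf row_sum_mat_poly)
  have CK: "C * ?K = 0\<^sub>m N N"
  proof (rule eq_matI)
    fix a j assume "a < dim_row (0\<^sub>m N N :: complex mat)" "j < dim_col (0\<^sub>m N N :: complex mat)"
    then have aj: "a < N" "j < N" by auto
    have "(C * ?K) $$ (a, j) = (\<Sum>k<N. \<Sum>b<N. C $$ (a, k) * (A ^\<^sub>m j) $$ (k, b))"
      using A K C aj by (subst entry_mult[of _ N N _ N]) (auto simp: krylov_def sum_distrib_left)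
    also have "\<dots> = (\<Sum>b<N. (C * A ^\<^sub>m j) $$ (a, b))"
      using A C aj by (subst sum.swap) (auto simp: entry_mult[of C N N _ N] simp del: index_mult_mat intro!: sum.cong)
    also have "\<dots> = (\<Sum>b<N. \<Sum>k<N. (A ^\<^sub>m j) $$ (a, k) * C $$ (k, b))"
      unfolding pow_intertwine[OF A A C comm] 
      using A C aj by (auto simp: entry_mult[of _ N N C N] simp del: index_mult_mat intro!: sum.cong)
    also have "\<dots> = (\<Sum>k<N. (A ^\<^sub>m j) $$ (a, k) * (\<Sum>b<N. C $$ (k, b)))"
      by (subst sum.swap) (simp add: sum_distrib_left)
    also have "\<dots> = 0" using Cu by simp
    finally show "(C * ?K) $$ (a, j) = 0\<^sub>m N N $$ (a, j)" using aj by simp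
  qed (use C K in auto)
  have "C = C * (?K * mat_inv ?K)" using mat_inv[OF K] C by simp
  also have "\<dots> = (C * ?K) * mat_inv ?K" using C K by (simp add: assoc_sq[of _ N])
  also have "\<dots> = 0\<^sub>m N N" using CK mat_inv_carrier[OF K(1)] by simp
  finally have C0: "C = 0\<^sub>m N N" .
  show ?thesis
  proof (rule eq_matI)
    fix a b assume "a < dim_row B" "b < dim_col B"
    moreover from this have "C $$ (a, b) = 0" using C0 assms(2) by simp
    ultimately show "?P $$ (a, b) = B $$ (a, b)" using assms(2) A by (simp add: C_def)
  qed (use A assms in \<open>auto simp: mat_poly_def\<close>)
qed

text \<open>
  Jordan matrices indexed by positions instead of blocks: \<open>s a\<close> says that the positions \<open>a\<close> and
  \<open>a + 1\<close> lie in the same block. This allows induction on the position.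
\<close>

definition jordan_shape :: "nat \<Rightarrow> (nat \<Rightarrow> complex) \<Rightarrow> (nat \<Rightarrow> bool) \<Rightarrow> complex mat" where
  "jordan_shape N lam s = mat N N (\<lambda>(a, b). if a = b then lam a else of_bool (b = Suc a \<and> s a))"

text \<open>
  A row vector \<open>v\<close> supported in the last \<open>m\<close> positions that annihilates \<open>A\<^sup>j u\<close> for \<open>j < m\<close> is replaced
  by \<open>v (A - \<lambda>\<^sub>p)\<close>, where \<open>p\<close> is the first position of the support: one position and one power fewer.
  When this vanishes, \<open>v\<close> is a left eigenvector, so it is concentrated at the last position of the
  block with eigenvalue \<open>\<lambda>\<^sub>p\<close>, and pairing it with \<open>u\<close> shows that it is zero.
\<close>

lemma jordan_shape_annihilator:
  fixes v :: "nat \<Rightarrow> complex"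
  assumes s: "\<And>a. Suc a < N \<Longrightarrow> s a \<Longrightarrow> lam a = lam (Suc a)"
    and dist: "\<And>a b. a < b \<Longrightarrow> b < N \<Longrightarrow> lam a = lam b \<Longrightarrow> s a"
    and "m \<le> N" "\<And>a. a < N - m \<Longrightarrow> v a = 0"
    and "\<And>j. j < m \<Longrightarrow> (\<Sum>a<N. v a * (\<Sum>b<N. (jordan_shape N lam s ^\<^sub>m j) $$ (a, b))) = 0"
  shows "a < N \<Longrightarrow> v a = 0"
  using assms(3-)
proof (induction m arbitrary: v a)
  case (Suc m)
  let ?A = "jordan_shape N lam s"
  define p where "p = N - Suc m"
  have p: "p < N" "N - m = Suc p" using Suc.prems by (auto simp: p_def)
  have A: "?A \<in> carrier_mat N N" by (simp add: jordan_shape_def)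
  \<comment> \<open>the row vector \<open>v (A - \<lambda>\<^sub>p)\<close>\<close>
  define w where "w c = (lam c - lam p) * v c + (if c > 0 \<and> s (c - 1) then v (c - 1) else 0)" for c
  have w_alt: "w c = (\<Sum>a<N. v a * ?A $$ (a, c)) - lam p * v c" if "c < N" for c
  proof -
    have "(\<Sum>a<N. v a * ?A $$ (a, c)) = (\<Sum>a<N. (if a = c then v c * lam c else 0) +
        (if a = c - 1 then (if c > 0 \<and> s (c - 1) then v (c - 1) else 0) else 0))"
      using that by (intro sum.cong refl) (auto simp: jordan_shape_def)
    also have "\<dots> = v c * lam c + (if c > 0 \<and> s (c - 1) then v (c - 1) else 0)"
      using that by (auto simp: sum.distrib)
    finally show ?thesis by (simp add: w_def algebra_simps)
  qed
  define S where "S j v = (\<Sum>a<N. v a * (\<Sum>b<N. (?A ^\<^sub>m j) $$ (a, b)))" for j and v :: "nat \<Rightarrow> complex"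
  have Sw: "S j w = S (Suc j) v - lam p * S j v" for j
  proof -
    have pw: "(?A ^\<^sub>m Suc j) $$ (a, b) = (\<Sum>c<N. ?A $$ (a, c) * (?A ^\<^sub>m j) $$ (c, b))"
      if "a < N" "b < N" for a b
      using pow_intertwine[OF A A A refl, of j] that A
      by (simp add: entry_mult[of ?A N N _ N, symmetric] del: index_mult_mat)
    have "S (Suc j) v = (\<Sum>a<N. v a * (\<Sum>b<N. \<Sum>c<N. ?A $$ (a, c) * (?A ^\<^sub>m j) $$ (c, b)))"
      by (simp add: S_def pw del: pow_mat.simps)
    also have "\<dots> = (\<Sum>a<N. v a * (\<Sum>c<N. (\<Sum>b<N. (?A ^\<^sub>m j) $$ (c, b)) * ?A $$ (a, c)))"
      by (subst sum.swap) (simp add: sum_distrib_left mult.commute)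
    also have "\<dots> = (\<Sum>c<N. (\<Sum>b<N. (?A ^\<^sub>m j) $$ (c, b)) * (\<Sum>a<N. v a * ?A $$ (a, c)))"
      by (rule sum_swap_scaled)
    finally have "S (Suc j) v = \<dots>" .
    then show ?thesis
      by (simp add: S_def w_alt algebra_simps sum_subtractf sum_distrib_left)
  qed
  have S0: "S j v = 0" if "j < Suc m" for j using Suc.prems(4)[OF that] by (simp add: S_def)
  have w0: "w c = 0" if "c < N" for c
  proof (rule Suc.IH[OF that])
    show "m \<le> N" using Suc.prems by simp
    show "w a = 0" if "a < N - m" for a
    proof (cases "a = p")
      case True
      then show ?thesis using Suc.prems(3)[of "p - 1"] by (auto simp: w_def p_def)
    next
      case False
      then show ?thesis using that p Suc.prems(3)[of a] Suc.prems(3)[of "a - 1"] by (auto simp: w_def p_def)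
    qed
    show "(\<Sum>a<N. w a * (\<Sum>b<N. (?A ^\<^sub>m j) $$ (a, b))) = 0" if "j < m" for j
      using Sw[of j] S0[of j] S0[of "Suc j"] that by (simp add: S_def)
  qed
  have v_other: "v c = 0" if "c < N" "lam c \<noteq> lam p" for c
    using that
  proof (induction c)
    case 0
    then show ?case using w0[of 0] by (simp add: w_def)
  next
    case (Suc c)
    then have "v c = 0" if "s c" using s[of c] that by simp
    then show ?case using w0[of "Suc c"] Suc.prems by (auto simp: w_def split: if_splits)
  qed
  have v_inner: "v c = 0" if "Suc c < N" "s c" "lam c = lam p" for c
    using w0[of "Suc c"] that s[of c] by (simp add: w_def)
  have "v c = 0" if c: "c < N" for c
  proof (rule ccontr)
    assume nz: "v c \<noteq> 0"
    have others: "v d = 0" if "d < N" "d \<noteq> c" for d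
    proof (rule ccontr)
      assume "v d \<noteq> 0"
      then have "lam d = lam c" using v_other nz c that by metis
      then show False
        using dist[of c d] dist[of d c] v_inner[of c] v_inner[of d] v_other[of c] v_other[of d] nz \<open>v d \<noteq> 0\<close> that c
        by (metis Suc_lessI linorder_neqE_nat not_less_eq)
    qed
    have "S 0 v = (\<Sum>a<N. v a * (\<Sum>b<N. if b = a then 1 else 0))"
      using A by (auto simp: S_def intro!: sum.cong)
    also have "\<dots> = (\<Sum>a<N. v a)" by simp
    also have "\<dots> = (\<Sum>a\<in>{c}. v a)" using c others by (intro sum.mono_neutral_right) auto
    finally show False using S0[of 0] nz by simp
  qed
  then show ?case using Suc.prems by blast
qed auto

text \<open>
  There is one block for each eigenvalue, and the last entry of \<open>u\<close> in each block is nonzero.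
\<close>

lemma cyclic_jordan_shape:
  assumes s: "\<And>a. Suc a < N \<Longrightarrow> s a \<Longrightarrow> lam a = lam (Suc a)"
    and dist: "\<And>a b. a < b \<Longrightarrow> b < N \<Longrightarrow> lam a = lam b \<Longrightarrow> s a"
  shows "cyclic N (jordan_shape N lam s)"
  unfolding cyclic_def
proof
  let ?A = "jordan_shape N lam s"
  show A: "?A \<in> carrier_mat N N" by (simp add: jordan_shape_def)
  let ?K = "krylov ?A"
  have K: "?K \<in> carrier_mat N N" using A by (rule krylov_carrier)
  show "det ?K \<noteq> 0"
  proof
    assume "det ?K = 0"
    then have "det (transpose_mat ?K) = 0" using K by (simp add: det_transpose)
    then obtain v where v: "v \<in> carrier_vec N" "v \<noteq> 0\<^sub>v N" "transpose_mat ?K *\<^sub>v v = 0\<^sub>v N"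
      using det_0_iff_vec_prod_zero[of "transpose_mat ?K" N] K by auto
    have "v $ a = 0" if "a < N" for a
    proof (rule jordan_shape_annihilator[where m = N and N = N and lam = lam and s = s and v = "\<lambda>a. v $ a"])
      fix j assume j: "j < N"
      have "(\<Sum>a<N. v $ a * (\<Sum>b<N. (?A ^\<^sub>m j) $$ (a, b))) = (transpose_mat ?K *\<^sub>v v) $ j"
        using j v(1) K A by (auto simp: scalar_prod_def krylov_def atLeast0LessThan mult.commute intro!: sum.cong)
      then show "(\<Sum>a<N. v $ a * (\<Sum>b<N. (?A ^\<^sub>m j) $$ (a, b))) = 0" using v(3) j by simp
    qed (use that s dist in auto)
    then show False using v(1,2) by (auto simp: vec_eq_iff)
  qed
qed

lemma (in function_algebra_inverse) in_coef:
  assumes "mat_in N N F" "mat_in N N G" "eventually (\<lambda>q. cyclic N (F q)) Fl" "j < N"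
  shows "(\<lambda>q. coef (F q) (G q) j) \<in> S"
proof (rule cong)
  have "mat_in N N (\<lambda>q. krylov (F q))"
  proof (rule mat_in_cong)
    show "mat_in N N (\<lambda>q. mat N N (\<lambda>(a, j). \<Sum>b<N. (F q ^\<^sub>m j) $$ (a, b)))"
      using mat_inD(2)[OF mat_in_pow[OF assms(1)]] by (intro mat_in_mat sum) auto
    show "eventually (\<lambda>q. krylov (F q) = mat N N (\<lambda>(a, j). \<Sum>b<N. (F q ^\<^sub>m j) $$ (a, b))) Fl"
      using mat_inD(1)[OF assms(1)] by eventually_elim (auto simp: krylov_def)
  qed
  then have "mat_in N N (\<lambda>q. mat_inv (krylov (F q)))"
    by (rule mat_in_mat_inv) (use assms(3) in \<open>auto elim!: eventually_mono simp: cyclic_def\<close>)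
  then show "(\<lambda>q. \<Sum>a<N. mat_inv (krylov (F q)) $$ (j, a) * (\<Sum>b<N. G q $$ (a, b))) \<in> S"
    using assms(4) by (intro sum mult mat_inD(2)[OF assms(2)] mat_inD(2)) auto
  show "eventually (\<lambda>q. coef (F q) (G q) j = (\<Sum>a<N. mat_inv (krylov (F q)) $$ (j, a) * (\<Sum>b<N. G q $$ (a, b)))) Fl"
    using assms(3) by eventually_elim (auto simp: coef_def cyclic_def)
qed

section \<open>Polynomial functions, tangent vectors and differentials\<close>

lemma aff_iff: "p \<in> aff ds \<longleftrightarrow> length p = length ds \<and> (\<forall>k<length ds. p ! k \<in> carrier_mat (ds ! k) (ds ! k))"
  by (auto simp: aff_def list_all2_conv_all_nth)

lemma pt_add_nth: "k < length p \<Longrightarrow> k < length q \<Longrightarrow> pt_add p q ! k = p ! k + q ! k"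
  and pt_diff_nth: "k < length p \<Longrightarrow> k < length q \<Longrightarrow> pt_diff p q ! k = p ! k - q ! k"
  and pt_scale_nth: "k < length p \<Longrightarrow> pt_scale t p ! k = t \<cdot>\<^sub>m p ! k"
  and pt_length [simp]: "length (pt_add p q) = min (length p) (length q)"
    "length (pt_diff p q) = min (length p) (length q)" "length (pt_scale t p) = length p"
  by (auto simp: pt_add_def pt_diff_def pt_scale_def)

lemma aff_add: "p \<in> aff ds \<Longrightarrow> q \<in> aff ds \<Longrightarrow> pt_add p q \<in> aff ds"
  and aff_scale: "p \<in> aff ds \<Longrightarrow> pt_scale t p \<in> aff ds"
  by (auto simp: aff_iff pt_add_nth pt_scale_nth)

lemma pt_diff_eq: "p \<in> aff ds \<Longrightarrow> q \<in> aff ds \<Longrightarrow> pt_diff p q = pt_add p (pt_scale (- 1) q)"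
proof (rule nth_equalityI)
  fix k assume pq: "p \<in> aff ds" "q \<in> aff ds" and k: "k < length (pt_diff p q)"
  then have c: "p ! k \<in> carrier_mat (ds ! k) (ds ! k)" "q ! k \<in> carrier_mat (ds ! k) (ds ! k)"
    by (auto simp: aff_iff)
  show "pt_diff p q ! k = pt_add p (pt_scale (- 1) q) ! k"
    using k c by (auto simp: pt_add_nth pt_diff_nth pt_scale_nth intro!: eq_matI)
qed auto

interpretation poly: function_algebra "poly_fun ds" "top_class.top" for ds
  by unfold_locales (auto intro: poly_fun.intros simp: eventually_top fun_eq_iff[symmetric])

lemma poly_corner:
  "k < length ds \<Longrightarrow> m \<le> ds ! k \<Longrightarrow> poly.mat_in ds m m (\<lambda>p. corner m (p ! k))"
  by (auto intro!: poly.mat_inI poly_fun.coord)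

definition has_tangent :: "nat list \<Rightarrow> (complex \<Rightarrow> point) \<Rightarrow> point \<Rightarrow> bool" where
  "has_tangent ds c v \<longleftrightarrow> (\<forall>k<length ds. \<forall>a<ds ! k. \<forall>b<ds ! k.
     ((\<lambda>t. (c t ! k) $$ (a, b)) has_field_derivative (v ! k) $$ (a, b)) (at 0))"

lemma line_at_0:
  assumes "p \<in> aff ds" "v \<in> aff ds" shows "pt_add p (pt_scale 0 v) = p"
proof (rule nth_equalityI)
  fix k assume k: "k < length (pt_add p (pt_scale 0 v))"
  then have c: "p ! k \<in> carrier_mat (ds ! k) (ds ! k)" "v ! k \<in> carrier_mat (ds ! k) (ds ! k)"
    using assms by (auto simp: aff_iff)
  show "pt_add p (pt_scale 0 v) ! k = p ! k"
    using k carrier_matD[OF c(1)] carrier_matD[OF c(2)]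
    by (auto simp: pt_add_nth pt_scale_nth intro!: eq_matI)
qed (use assms in \<open>auto simp: aff_iff\<close>)

lemma line_entry:
  assumes "p \<in> aff ds" "v \<in> aff ds" "k < length ds" "a < ds ! k" "b < ds ! k"
  shows "(pt_add p (pt_scale t v) ! k) $$ (a, b) = (p ! k) $$ (a, b) + t * (v ! k) $$ (a, b)"
proof -
  have "p ! k \<in> carrier_mat (ds ! k) (ds ! k)" "v ! k \<in> carrier_mat (ds ! k) (ds ! k)"
    using assms by (auto simp: aff_iff)
  then show ?thesis using assms by (auto simp: aff_iff pt_add_nth pt_scale_nth)
qed

lemma line_has_tangent:
  assumes "p \<in> aff ds" "v \<in> aff ds"
  shows "has_tangent ds (\<lambda>t. pt_add p (pt_scale t v)) v"
  unfolding has_tangent_def by (auto simp: line_entry[OF assms] intro!: derivative_eq_intros)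

text \<open>
  The derivative along a curve depends only on its initial point and velocity, so it may be
  computed on a straight line, where it is \<open>diff\<close>.
\<close>

lemma poly_fun_chain_ex:
  assumes "F \<in> poly_fun ds"
  shows "\<exists>d. \<forall>c. c 0 = p \<longrightarrow> has_tangent ds c v \<longrightarrow> ((\<lambda>t. F (c t)) has_field_derivative d) (at 0)"
  using assms
proof induction
  case (const c)
  then show ?case by (auto intro!: exI[of _ 0])
next
  case (coord k a b)
  then show ?case by (auto simp: has_tangent_def intro!: exI[of _ "(v ! k) $$ (a, b)"])
next
  case (add F H)
  then obtain d d' where "\<forall>c. c 0 = p \<longrightarrow> has_tangent ds c v \<longrightarrow> ((\<lambda>t. F (c t)) has_field_derivative d) (at 0)"
    "\<forall>c. c 0 = p \<longrightarrow> has_tangent ds c v \<longrightarrow> ((\<lambda>t. H (c t)) has_field_derivative d') (at 0)" by blast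
  then show ?case by (intro exI[of _ "d + d'"]) (auto intro: DERIV_add)
next
  case (mult F H)
  then obtain d d' where "\<forall>c. c 0 = p \<longrightarrow> has_tangent ds c v \<longrightarrow> ((\<lambda>t. F (c t)) has_field_derivative d) (at 0)"
    "\<forall>c. c 0 = p \<longrightarrow> has_tangent ds c v \<longrightarrow> ((\<lambda>t. H (c t)) has_field_derivative d') (at 0)" by blast
  then show ?case by (intro exI[of _ "d * H p + d' * F p"]) (auto dest: DERIV_mult)
qed

lemma poly_fun_chain:
  assumes "F \<in> poly_fun ds" "c 0 \<in> aff ds" "v \<in> aff ds" "has_tangent ds c v"
  shows "((\<lambda>t. F (c t)) has_field_derivative diff F (c 0) v) (at 0)"
proof -
  obtain d where d: "\<And>c'. c' 0 = c 0 \<Longrightarrow> has_tangent ds c' v \<Longrightarrow> ((\<lambda>t. F (c' t)) has_field_derivative d) (at 0)"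
    using poly_fun_chain_ex[OF assms(1), of "c 0" v] by blast
  have "((\<lambda>t. F (pt_add (c 0) (pt_scale t v))) has_field_derivative d) (at 0)"
    using assms by (intro d line_has_tangent line_at_0)
  then have "diff F (c 0) v = d" unfolding diff_def by (rule DERIV_imp_deriv)
  then show ?thesis using d[of c] assms by simp
qed

lemma poly_fun_line:
  assumes "F \<in> poly_fun ds" "p \<in> aff ds" "v \<in> aff ds"
  shows "((\<lambda>t. F (pt_add p (pt_scale t v))) has_field_derivative diff F p v) (at 0)"
  using poly_fun_chain[of F ds "\<lambda>t. pt_add p (pt_scale t v)" v] assms
    line_has_tangent[of p ds v] line_at_0[of p ds v] by simp

lemma diff_eqI:
  "((\<lambda>t. F (pt_add p (pt_scale t v))) has_field_derivative d) (at 0) \<Longrightarrow> diff F p v = d"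
  unfolding diff_def by (rule DERIV_imp_deriv)

lemma diff_const: "diff (\<lambda>_. c) p v = 0"
  by (rule diff_eqI) simp

lemma diff_coord:
  "p \<in> aff ds \<Longrightarrow> v \<in> aff ds \<Longrightarrow> k < length ds \<Longrightarrow> a < ds ! k \<Longrightarrow> b < ds ! k \<Longrightarrow>
    diff (\<lambda>p. (p ! k) $$ (a, b)) p v = (v ! k) $$ (a, b)"
  by (rule diff_eqI) (use line_has_tangent in \<open>auto simp: has_tangent_def\<close>)

lemma diff_sum_fun:
  assumes "p \<in> aff ds" "v \<in> aff ds" "\<And>i. i \<in> I \<Longrightarrow> F i \<in> poly_fun ds"
  shows "diff (\<lambda>q. \<Sum>i\<in>I. F i q) p v = (\<Sum>i\<in>I. diff (F i) p v)"
  by (rule diff_eqI) (use assms in \<open>auto intro!: DERIV_sum poly_fun_line\<close>)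

lemma diff_add_fun:
  assumes "p \<in> aff ds" "v \<in> aff ds" "F \<in> poly_fun ds" "H \<in> poly_fun ds"
  shows "diff (\<lambda>q. F q + H q) p v = diff F p v + diff H p v"
  by (rule diff_eqI) (use assms in \<open>auto intro!: DERIV_add poly_fun_line\<close>)

lemma diff_mult_fun:
  assumes "p \<in> aff ds" "v \<in> aff ds" "F \<in> poly_fun ds" "H \<in> poly_fun ds"
  shows "diff (\<lambda>q. F q * H q) p v = diff F p v * H p + F p * diff H p v"
proof (rule diff_eqI)
  show "((\<lambda>t. F (pt_add p (pt_scale t v)) * H (pt_add p (pt_scale t v))) has_field_derivative
     diff F p v * H p + F p * diff H p v) (at 0)"
    using DERIV_mult[OF poly_fun_line[OF assms(3,1,2)] poly_fun_line[OF assms(4,1,2)]]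
    by (simp add: line_at_0[OF assms(1,2)] mult_ac add_ac)
qed

lemma diff_minus_fun:
  assumes "p \<in> aff ds" "v \<in> aff ds" "F \<in> poly_fun ds" "H \<in> poly_fun ds"
  shows "diff (\<lambda>q. F q - H q) p v = diff F p v - diff H p v"
  by (rule diff_eqI) (use assms in \<open>auto intro!: DERIV_diff poly_fun_line\<close>)

lemma poly_fun_minus: "F \<in> poly_fun ds \<Longrightarrow> H \<in> poly_fun ds \<Longrightarrow> (\<lambda>q. F q - H q) \<in> poly_fun ds"
  using poly.add[of F ds "\<lambda>q. (-1) * H q"] poly.mult[OF poly.const[of "-1"], of H ds] by simp

lemma diff_add:
  assumes "F \<in> poly_fun ds" "p \<in> aff ds" "v \<in> aff ds" "w \<in> aff ds"
  shows "diff F p (pt_add v w) = diff F p v + diff F p w"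
  using assms(1)
proof induction
  case (coord k a b)
  then have c: "v ! k \<in> carrier_mat (ds ! k) (ds ! k)" "w ! k \<in> carrier_mat (ds ! k) (ds ! k)"
    using assms by (auto simp: aff_iff)
  show ?case using coord assms carrier_matD[OF c(1)] carrier_matD[OF c(2)]
    by (simp add: diff_coord[of _ ds] aff_add pt_add_nth aff_iff[of v] aff_iff[of w])
qed (use assms in \<open>simp_all add: diff_const diff_add_fun[of _ ds] diff_mult_fun[of _ ds] aff_add algebra_simps\<close>)

lemma diff_scale:
  assumes "F \<in> poly_fun ds" "p \<in> aff ds" "v \<in> aff ds"
  shows "diff F p (pt_scale s v) = s * diff F p v"
  using assms(1)
proof induction
  case (coord k a b)
  then have c: "v ! k \<in> carrier_mat (ds ! k) (ds ! k)" using assms by (auto simp: aff_iff)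
  show ?case using coord assms carrier_matD[OF c]
    by (simp add: diff_coord[of _ ds] aff_scale pt_scale_nth aff_iff[of v])
qed (use assms in \<open>simp_all add: diff_const diff_add_fun[of _ ds] diff_mult_fun[of _ ds] aff_scale algebra_simps\<close>)

lemma tangent_aff: "v \<in> tangent ds V p \<Longrightarrow> v \<in> aff ds"
  by (simp add: tangent_def)

lemma tangentD:
  assumes "v \<in> tangent ds V p" "F \<in> poly_fun ds" "\<And>q. q \<in> V \<Longrightarrow> F q = 0"
  shows "diff F p v = 0"
  using assms(1) unfolding tangent_def mem_Collect_eq
  by (elim conjE) (drule bspec[OF _ assms(2)], drule mp, use assms(3) in simp)

lemma tangent_add:
  assumes "p \<in> aff ds" "v \<in> tangent ds V p" "w \<in> tangent ds V p"
  shows "pt_add v w \<in> tangent ds V p"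
  using assms by (auto simp: tangent_def aff_add diff_add[of _ ds])

lemma tangent_scale:
  assumes "p \<in> aff ds" "v \<in> tangent ds V p"
  shows "pt_scale s v \<in> tangent ds V p"
  using assms by (auto simp: tangent_def aff_scale diff_scale[of _ ds])

lemma tangent_diff:
  assumes "p \<in> aff ds" "v \<in> tangent ds V p" "w \<in> tangent ds V p"
  shows "pt_diff v w \<in> tangent ds V p"
  using assms tangent_add[OF assms(1,2) tangent_scale[OF assms(1,3)], of "-1"]
  by (simp add: pt_diff_eq[of v ds w] tangent_aff)

text \<open>
  The source of all tangent vectors below: velocities of curves that stay in \<open>V\<close> for small times.
\<close>

lemma tangent_curve:
  assumes "c 0 \<in> aff ds" "v \<in> aff ds" "has_tangent ds c v" "eventually (\<lambda>t. c t \<in> V) (nhds 0)"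
  shows "v \<in> tangent ds V (c 0)"
proof -
  have "diff F (c 0) v = 0" if F: "F \<in> poly_fun ds" and 0: "\<forall>q\<in>V. F q = 0" for F
  proof (rule DERIV_unique)
    show "((\<lambda>t. F (c t)) has_field_derivative diff F (c 0) v) (at 0)"
      by (rule poly_fun_chain[OF F assms(1-3)])
    have "((\<lambda>t. 0) has_field_derivative 0) (at (0::complex))" by simp
    then show "((\<lambda>t. F (c t)) has_field_derivative 0) (at 0)"
      by (rule iffD1[OF DERIV_cong_ev[OF refl _ refl], rotated])
        (use assms(4) 0 in \<open>auto elim: eventually_mono\<close>)
  qed
  then show ?thesis using assms(2) by (simp add: tangent_def)
qed

lemma tangent_aff_space: "p \<in> aff ds \<Longrightarrow> tangent ds (aff ds) p = aff ds"
proof (intro equalityI subsetI)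
  fix v assume "p \<in> aff ds" "v \<in> aff ds"
  then show "v \<in> tangent ds (aff ds) p"
    using tangent_curve[of "\<lambda>t. pt_add p (pt_scale t v)" ds v "aff ds"]
    by (simp add: line_at_0[of p ds v] line_has_tangent aff_add aff_scale)
qed (rule tangent_aff)

subsection \<open>Regular functions\<close>

text \<open>
  For the inverse of \<open>P / Q\<close> the denominator has to be \<open>P Q\<close> and not \<open>P\<close>, because the fraction has to
  represent the function wherever its denominator does not vanish.
\<close>

interpretation reg: function_algebra_inverse "{f. regular_fun ds V f}" "principal V" for ds V
proof (unfold_locales, unfold mem_Collect_eq eventually_principal)
  show "regular_fun ds V (\<lambda>q. c)" for c
    unfolding regular_fun_def local_fraction_def
    by (rule ballI, rule exI[of _ "\<lambda>_. c"], rule exI[of _ "\<lambda>_. 1"]) (simp add: poly_fun.const)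
  fix f g assume f: "regular_fun ds V f" and g: "regular_fun ds V g"
  have *: "\<exists>P Q P' Q'. P \<in> poly_fun ds \<and> Q \<in> poly_fun ds \<and> P' \<in> poly_fun ds \<and> Q' \<in> poly_fun ds \<and>
     Q p * Q' p \<noteq> 0 \<and> (\<forall>q\<in>V. Q q * Q' q \<noteq> 0 \<longrightarrow> f q = P q / Q q \<and> g q = P' q / Q' q)" if "p \<in> V" for p
  proof -
    obtain P Q P' Q' where "local_fraction ds V f p P Q" "local_fraction ds V g p P' Q'"
      using f g \<open>p \<in> V\<close> unfolding regular_fun_def by blast
    then show ?thesis unfolding local_fraction_def
      by (intro exI[of _ P] exI[of _ Q] exI[of _ P'] exI[of _ Q']) auto
  qed
  show "regular_fun ds V (\<lambda>q. f q + g q)"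
    unfolding regular_fun_def
  proof
    fix p assume "p \<in> V"
    from *[OF this] obtain P Q P' Q' where "P \<in> poly_fun ds" "Q \<in> poly_fun ds" "P' \<in> poly_fun ds" "Q' \<in> poly_fun ds"
      "Q p * Q' p \<noteq> 0" and e: "\<forall>q\<in>V. Q q * Q' q \<noteq> 0 \<longrightarrow> f q = P q / Q q \<and> g q = P' q / Q' q" by blast
    moreover have "\<forall>q\<in>V. Q q * Q' q \<noteq> 0 \<longrightarrow> f q + g q = (P q * Q' q + P' q * Q q) / (Q q * Q' q)"
      using e by (auto simp: field_simps)
    ultimately show "\<exists>P Q. local_fraction ds V (\<lambda>q. f q + g q) p P Q" unfolding local_fraction_def
      by (intro exI[of _ "\<lambda>q. P q * Q' q + P' q * Q q"] exI[of _ "\<lambda>q. Q q * Q' q"]) (auto intro: poly_fun.intros)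
  qed
  show "regular_fun ds V (\<lambda>q. f q * g q)"
    unfolding regular_fun_def
  proof
    fix p assume "p \<in> V"
    from *[OF this] obtain P Q P' Q' where "P \<in> poly_fun ds" "Q \<in> poly_fun ds" "P' \<in> poly_fun ds" "Q' \<in> poly_fun ds"
      "Q p * Q' p \<noteq> 0" and e: "\<forall>q\<in>V. Q q * Q' q \<noteq> 0 \<longrightarrow> f q = P q / Q q \<and> g q = P' q / Q' q" by blast
    moreover have "\<forall>q\<in>V. Q q * Q' q \<noteq> 0 \<longrightarrow> f q * g q = (P q * P' q) / (Q q * Q' q)"
      using e by auto
    ultimately show "\<exists>P Q. local_fraction ds V (\<lambda>q. f q * g q) p P Q" unfolding local_fraction_def
      by (intro exI[of _ "\<lambda>q. P q * P' q"] exI[of _ "\<lambda>q. Q q * Q' q"]) (auto intro: poly_fun.intros)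
  qed
next
  fix f g assume "regular_fun ds V f" "\<forall>q\<in>V. g q = f q"
  then show "regular_fun ds V g" unfolding regular_fun_def local_fraction_def by auto
next
  fix f assume f: "regular_fun ds V f" and nz: "\<forall>q\<in>V. f q \<noteq> 0"
  show "regular_fun ds V (\<lambda>q. inverse (f q))"
    unfolding regular_fun_def
  proof
    fix p assume p: "p \<in> V"
    then obtain P Q where PQ: "P \<in> poly_fun ds" "Q \<in> poly_fun ds" "Q p \<noteq> 0"
      "\<forall>q\<in>V. Q q \<noteq> 0 \<longrightarrow> f q = P q / Q q"
      using f unfolding regular_fun_def local_fraction_def by blast
    moreover from this have "P p \<noteq> 0" using nz p by auto
    moreover have "\<forall>q\<in>V. P q * Q q \<noteq> 0 \<longrightarrow> inverse (f q) = (Q q * Q q) / (P q * Q q)"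
      using PQ(4) by auto
    ultimately show "\<exists>P Q. local_fraction ds V (\<lambda>q. inverse (f q)) p P Q" unfolding local_fraction_def
      by (intro exI[of _ "\<lambda>q. Q q * Q q"] exI[of _ "\<lambda>q. P q * Q q"]) (auto intro: poly_fun.intros)
  qed
qed

lemma regular_poly: "F \<in> poly_fun ds \<Longrightarrow> regular_fun ds V F"
  unfolding regular_fun_def local_fraction_def
  by (rule ballI, rule exI[of _ F], rule exI[of _ "\<lambda>_. 1"]) (simp add: poly_fun.const)

text \<open>
  For two fractions of the same function, the numerator of their difference vanishes on \<open>V\<close> after
  multiplication by both denominators, and tangent vectors annihilate the differential of this product.
\<close>

lemma local_fraction_diff_unique:
  assumes "p \<in> V" "V \<subseteq> aff ds" "v \<in> tangent ds V p"
    and "local_fraction ds V f p P Q" "local_fraction ds V f p P' Q'"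
  shows "(diff P p v * Q p - P p * diff Q p v) / (Q p)\<^sup>2 = (diff P' p v * Q' p - P' p * diff Q' p v) / (Q' p)\<^sup>2"
proof -
  have pf: "P \<in> poly_fun ds" "Q \<in> poly_fun ds" "P' \<in> poly_fun ds" "Q' \<in> poly_fun ds" "Q p \<noteq> 0" "Q' p \<noteq> 0"
    and fe: "\<And>q. q \<in> V \<Longrightarrow> Q q \<noteq> 0 \<Longrightarrow> f q = P q / Q q" "\<And>q. q \<in> V \<Longrightarrow> Q' q \<noteq> 0 \<Longrightarrow> f q = P' q / Q' q"
    using assms by (auto simp: local_fraction_def)
  have p: "p \<in> aff ds" and v: "v \<in> aff ds" using assms tangent_aff by auto
  let ?E = "\<lambda>q. P q * Q' q - P' q * Q q"
  \<comment> \<open>\<open>E\<close> itself need not vanish where a denominator vanishes; multiplying by the denominators repairs this\<close>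
  let ?F = "\<lambda>q. (Q q * Q' q) * ?E q"
  have E: "?E \<in> poly_fun ds" and QQ: "(\<lambda>q. Q q * Q' q) \<in> poly_fun ds"
    using pf by (auto intro: poly_fun_minus poly_fun.intros)
  have "?F q = 0" if "q \<in> V" for q
  proof (cases "Q q = 0 \<or> Q' q = 0")
    case False
    then have "Q q \<noteq> 0" "Q' q \<noteq> 0" by auto
    then have "P q = f q * Q q" "P' q = f q * Q' q" using fe[OF that] by (metis nonzero_divide_eq_eq)+
    then show ?thesis by simp
  qed auto
  moreover have "?F \<in> poly_fun ds" using QQ E by (rule poly_fun.mult)
  ultimately have "diff ?F p v = 0" using assms(3) by (auto simp: tangent_def)
  moreover have Ep: "?E p = 0"
  proof -
    have "P p = f p * Q p" "P' p = f p * Q' p" using fe[OF assms(1)] pf by (metis nonzero_divide_eq_eq)+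
    then show ?thesis by simp
  qed
  ultimately have "diff ?E p v = 0"
    using pf diff_mult_fun[OF p v QQ E] by simp
  then have "diff P p v * Q' p + P p * diff Q' p v - (diff P' p v * Q p + P' p * diff Q p v) = 0"
    using diff_minus_fun[OF p v, of "\<lambda>q. P q * Q' q" "\<lambda>q. P' q * Q q"] pf p v
    by (simp add: diff_mult_fun[of _ ds] poly_fun.mult)
  moreover have P: "P p = f p * Q p" "P' p = f p * Q' p"
    using fe[OF assms(1)] pf by (metis nonzero_divide_eq_eq)+
  ultimately have e: "Q' p * (diff P p v - f p * diff Q p v) = Q p * (diff P' p v - f p * diff Q' p v)"
    by (simp add: algebra_simps)
  have "(diff P p v * Q p - P p * diff Q p v) * (Q' p)\<^sup>2
      = Q p * Q' p * (Q' p * (diff P p v - f p * diff Q p v))"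
    unfolding P by (simp add: algebra_simps power2_eq_square)
  also have "\<dots> = (diff P' p v * Q' p - P' p * diff Q' p v) * (Q p)\<^sup>2"
    unfolding P e by (simp add: algebra_simps power2_eq_square)
  finally show ?thesis using pf(5,6) by (simp add: frac_eq_eq)
qed

lemma diff_on_eq:
  assumes "p \<in> V" "V \<subseteq> aff ds" "v \<in> tangent ds V p" "local_fraction ds V f p P Q"
  shows "diff_on ds V f p v = (diff P p v * Q p - P p * diff Q p v) / (Q p)\<^sup>2"
  unfolding diff_on_def
  by (rule the_equality) (use assms local_fraction_diff_unique[OF assms(1-3)] in blast)+

lemma diff_on_poly:
  assumes "p \<in> V" "V \<subseteq> aff ds" "v \<in> tangent ds V p" "G \<in> poly_fun ds" "\<And>q. q \<in> V \<Longrightarrow> f q = G q"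
  shows "diff_on ds V f p v = diff G p v"
proof -
  have "local_fraction ds V f p G (\<lambda>_. 1)"
    using assms by (auto simp: local_fraction_def poly_fun.const)
  from diff_on_eq[OF assms(1-3) this] show ?thesis by (simp add: diff_const)
qed

text \<open>
  This computes \<open>diff_on\<close> without exhibiting a fraction.
\<close>

lemma diff_on_curve:
  assumes "c 0 \<in> V" "V \<subseteq> aff ds" "v \<in> aff ds" "has_tangent ds c v"
    and "eventually (\<lambda>t. c t \<in> V) (nhds 0)" "regular_fun ds V f"
  shows "((\<lambda>t. f (c t)) has_field_derivative diff_on ds V f (c 0) v) (at 0)"
proof -
  have p: "c 0 \<in> aff ds" using assms by auto
  have tan: "v \<in> tangent ds V (c 0)" using tangent_curve p assms by blast
  obtain P Q where lf: "local_fraction ds V f (c 0) P Q"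
    using assms(1,6) by (auto simp: regular_fun_def)
  then have pf: "P \<in> poly_fun ds" "Q \<in> poly_fun ds" "Q (c 0) \<noteq> 0"
    and fe: "\<And>q. q \<in> V \<Longrightarrow> Q q \<noteq> 0 \<Longrightarrow> f q = P q / Q q" by (auto simp: local_fraction_def)
  note dP = poly_fun_chain[OF pf(1) p assms(3,4)] and dQ = poly_fun_chain[OF pf(2) p assms(3,4)]
  have d: "((\<lambda>t. P (c t) / Q (c t)) has_field_derivative diff_on ds V f (c 0) v) (at 0)"
    using DERIV_divide[OF dP dQ pf(3)] 
    unfolding diff_on_eq[OF assms(1,2) tan lf] by (simp add: power2_eq_square)
  have "eventually (\<lambda>t. Q (c t) \<noteq> 0) (nhds 0)"
  proof -
    have "isCont (\<lambda>t. Q (c t)) 0" using dQ by (rule DERIV_isCont)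
    then have "((\<lambda>t. Q (c t)) \<longlongrightarrow> Q (c 0)) (nhds 0)"
      using tendsto_at_iff_tendsto_nhds[of "\<lambda>t. Q (c t)" 0] by (simp add: isCont_def)
    then show ?thesis using pf(3) by (rule tendsto_imp_eventually_ne)
  qed
  then have "eventually (\<lambda>t. P (c t) / Q (c t) = f (c t)) (nhds 0)"
    using assms(5) by eventually_elim (simp add: fe)
  from DERIV_cong_ev[OF refl this refl] d show ?thesis by simp
qed

subsection \<open>Curves of matrices\<close>

interpretation dif: function_algebra_inverse "{f :: complex \<Rightarrow> complex. f field_differentiable at 0}" "nhds 0"
proof (unfold_locales, unfold mem_Collect_eq)
  fix f g :: "complex \<Rightarrow> complex"
  assume "f field_differentiable at 0" "eventually (\<lambda>q. g q = f q) (nhds 0)"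
  then show "g field_differentiable at 0"
    unfolding field_differentiable_def by (metis DERIV_cong_ev)
next
  fix f :: "complex \<Rightarrow> complex"
  assume "f field_differentiable at 0" "eventually (\<lambda>q. f q \<noteq> 0) (nhds 0)"
  then show "(\<lambda>q. inverse (f q)) field_differentiable at 0"
    by (auto intro!: field_differentiable_inverse dest: eventually_nhds_x_imp_x)
qed (auto intro: field_differentiable_add field_differentiable_mult)

definition has_mat_deriv :: "nat \<Rightarrow> (complex \<Rightarrow> complex mat) \<Rightarrow> complex mat \<Rightarrow> bool" where
  "has_mat_deriv n C C' \<longleftrightarrow> (\<forall>t. C t \<in> carrier_mat n n) \<and> C' \<in> carrier_mat n n \<and>
     (\<forall>a<n. \<forall>b<n. ((\<lambda>t. C t $$ (a, b)) has_field_derivative C' $$ (a, b)) (at 0))"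

lemma has_mat_derivD:
  assumes "has_mat_deriv n C C'"
  shows "C t \<in> carrier_mat n n" "C' \<in> carrier_mat n n"
    "a < n \<Longrightarrow> b < n \<Longrightarrow> ((\<lambda>t. C t $$ (a, b)) has_field_derivative C' $$ (a, b)) (at 0)"
  using assms by (auto simp: has_mat_deriv_def)

lemma has_mat_deriv_const: "A \<in> carrier_mat n n \<Longrightarrow> has_mat_deriv n (\<lambda>t. A) (0\<^sub>m n n)"
  by (auto simp: has_mat_deriv_def)

lemma has_mat_deriv_cong_unique:
  assumes C: "has_mat_deriv n C C'" and B: "has_mat_deriv n B B'" and "eventually (\<lambda>t. C t = B t) (nhds 0)"
  shows "C' = B'"
proof (rule eq_matI)
  note c = has_mat_derivD(2)[OF C] has_mat_derivD(2)[OF B]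
  fix a b assume "a < dim_row B'" "b < dim_col B'"
  then have ab: "a < n" "b < n" using c by auto
  have "eventually (\<lambda>t. C t $$ (a, b) = B t $$ (a, b)) (nhds 0)"
    using assms(3) by eventually_elim simp
  from DERIV_cong_ev[OF refl this refl] have "((\<lambda>t. C t $$ (a, b)) has_field_derivative B' $$ (a, b)) (at 0)"
    using has_mat_derivD(3)[OF B ab] by simp
  then show "C' $$ (a, b) = B' $$ (a, b)"
    using has_mat_derivD(3)[OF C ab] by (rule DERIV_unique[rotated])
qed (use has_mat_derivD(2)[OF C] has_mat_derivD(2)[OF B] in auto)

lemma has_mat_deriv_add:
  assumes C: "has_mat_deriv n C C'" and D: "has_mat_deriv n D D'"
  shows "has_mat_deriv n (\<lambda>t. C t + D t) (C' + D')"
proof -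
  have "(C t + D t) $$ (a, b) = C t $$ (a, b) + D t $$ (a, b)" if "a < n" "b < n" for a b t
    using that has_mat_derivD(1)[OF C, of t] has_mat_derivD(1)[OF D, of t] by simp
  then show ?thesis using has_mat_derivD[OF C] has_mat_derivD[OF D]
    by (auto simp: has_mat_deriv_def intro: DERIV_add)
qed

lemma has_mat_deriv_diff:
  assumes C: "has_mat_deriv n C C'" and D: "has_mat_deriv n D D'"
  shows "has_mat_deriv n (\<lambda>t. C t - D t) (C' - D')"
proof -
  have "(C t - D t) $$ (a, b) = C t $$ (a, b) - D t $$ (a, b)" if "a < n" "b < n" for a b t
    using that has_mat_derivD(1)[OF C, of t] has_mat_derivD(1)[OF D, of t] by simp
  then show ?thesis using has_mat_derivD[OF C] has_mat_derivD[OF D]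
    by (auto simp: has_mat_deriv_def intro: DERIV_diff)
qed

lemma has_mat_deriv_mult:
  assumes C: "has_mat_deriv n C C'" and D: "has_mat_deriv n D D'"
  shows "has_mat_deriv n (\<lambda>t. C t * D t) (C' * D 0 + C 0 * D')"
proof -
  have e: "(C t * D t) $$ (a, b) = (\<Sum>k<n. C t $$ (a, k) * D t $$ (k, b))" if "a < n" "b < n" for a b t
    using that has_mat_derivD(1)[OF C, of t] has_mat_derivD(1)[OF D, of t] by (intro entry_mult[of _ n n _ n]) auto
  have e': "(C' * D 0 + C 0 * D') $$ (a, b) = (\<Sum>k<n. C' $$ (a, k) * D 0 $$ (k, b) + C 0 $$ (a, k) * D' $$ (k, b))"
    if "a < n" "b < n" for a b
    using that has_mat_derivD(1)[OF C, of 0] has_mat_derivD(1)[OF D, of 0]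
      has_mat_derivD(2)[OF C] has_mat_derivD(2)[OF D]
    by (simp add: entry_mult[of _ n n _ n] sum.distrib del: index_mult_mat(1))
  have "((\<lambda>t. (C t * D t) $$ (a, b)) has_field_derivative (C' * D 0 + C 0 * D') $$ (a, b)) (at 0)"
    if ab: "a < n" "b < n" for a b
    unfolding e[OF ab] e'[OF ab]
    using has_mat_derivD(3)[OF C] has_mat_derivD(3)[OF D] ab
    by (auto intro!: DERIV_sum DERIV_mult'[THEN DERIV_cong] simp: algebra_simps)
  then show ?thesis using has_mat_derivD[OF C] has_mat_derivD[OF D]
    by (auto simp: has_mat_deriv_def)
qed

lemma has_mat_deriv_corner: "has_mat_deriv n C C' \<Longrightarrow> i \<le> n \<Longrightarrow> has_mat_deriv i (\<lambda>t. corner i (C t)) (corner i C')"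
  by (auto simp: has_mat_deriv_def)

lemma has_mat_deriv_pad:
  assumes "has_mat_deriv i C C'" "i \<le> n" shows "has_mat_deriv n (\<lambda>t. pad n (C t)) (pad n C')"
proof -
  have "dim_row (C t) = i" "dim_row C' = i" for t using has_mat_derivD[OF assms(1)] by auto
  then have "pad n (C t) $$ (a, b) = (if a < i \<and> b < i then C t $$ (a, b) else 0)"
    "pad n C' $$ (a, b) = (if a < i \<and> b < i then C' $$ (a, b) else 0)" if "a < n" "b < n" for a b t
    using that by (auto simp: pad_def)
  then show ?thesis using has_mat_derivD[OF assms(1)] by (auto simp: has_mat_deriv_def)
qed

lemma has_mat_deriv_extend:
  assumes "has_mat_deriv i C C'" "i \<le> n" shows "has_mat_deriv n (\<lambda>t. extend_by_one n (C t)) (pad n C')"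
proof -
  have "dim_row (C t) = i" "dim_row C' = i" for t using has_mat_derivD[OF assms(1)] by auto
  then have "extend_by_one n (C t) $$ (a, b) = (if a < i \<and> b < i then C t $$ (a, b) else of_bool (a = b))"
    "pad n C' $$ (a, b) = (if a < i \<and> b < i then C' $$ (a, b) else 0)" if "a < n" "b < n" for a b t
    using that by (auto simp: pad_def extend_by_one_def)
  then show ?thesis using has_mat_derivD[OF assms(1)] by (auto simp: has_mat_deriv_def)
qed

lemma has_mat_deriv_line: "x \<in> carrier_mat n n \<Longrightarrow> v \<in> carrier_mat n n \<Longrightarrow> has_mat_deriv n (\<lambda>t. x + t \<cdot>\<^sub>m v) v"
  by (auto simp: has_mat_deriv_def intro!: derivative_eq_intros)

text \<open>
  The commutator with \<open>Y\<close> is a derivation, so the rule passes from \<open>C\<close> to its powers.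
\<close>

lemma has_mat_deriv_pow_commutator:
  assumes "has_mat_deriv n C (C 0 * Y - Y * C 0)" "Y \<in> carrier_mat n n"
  shows "has_mat_deriv n (\<lambda>t. C t ^\<^sub>m j) (C 0 ^\<^sub>m j * Y - Y * C 0 ^\<^sub>m j)"
proof (induction j)
  case 0
  have [simp]: "dim_row (C t) = n" for t using has_mat_derivD[OF assms(1)] by auto
  show ?case using assms(2) has_mat_deriv_const[of "1\<^sub>m n" n] by simp
next
  case (Suc j)
  have [simp]: "C 0 \<in> carrier_mat n n" using has_mat_derivD[OF assms(1)] by auto
  let ?P = "C 0 ^\<^sub>m j"
  have "(?P * Y - Y * ?P) * C 0 + ?P * (C 0 * Y - Y * C 0) = (?P * (Y * C 0) - Y * (?P * C 0)) + (?P * (C 0 * Y) - ?P * (Y * C 0))"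
    using assms(2) by (simp add: minus_mult_distrib_mat[of _ n n _ _ n] mult_minus_distrib_mat[of _ n n _ n] assoc_sq[of _ n])
  also have "\<dots> = ?P * (C 0 * Y) - Y * (?P * C 0)"
    using assms(2) carrier_matD[of "C 0" n n] by (intro eq_matI) (auto simp del: index_mult_mat(1))
  finally show ?case using has_mat_deriv_mult[OF Suc assms(1)] assms(2) by (simp add: assoc_sq[of _ n])
qed

text \<open>
  The derivative of a power is a sum of noncommuting products. Its trace against a matrix \<open>B\<close> that
  commutes with \<open>C 0\<close> is nevertheless given by a single term, by cyclicity of the trace; the
  freedom in \<open>B\<close> makes the induction on the exponent work.
\<close>

lemma has_mat_deriv_pow:
  assumes "has_mat_deriv n C C'"
  shows "\<exists>D. has_mat_deriv n (\<lambda>t. C t ^\<^sub>m j) D \<and> 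
    (\<forall>B\<in>carrier_mat n n. C 0 * B = B * C 0 \<longrightarrow> tr (D * B) = of_nat j * tr (C 0 ^\<^sub>m (j - 1) * C' * B))"
proof (induction j)
  case 0
  have [simp]: "dim_row (C t) = n" for t using has_mat_derivD[OF assms(1)] by auto
  show ?case using has_mat_deriv_const[of "1\<^sub>m n" n] by (intro exI[of _ "0\<^sub>m n n"]) (auto simp: tr_def)
next
  case (Suc j)
  have C[simp]: "C 0 \<in> carrier_mat n n" "C' \<in> carrier_mat n n" using has_mat_derivD[OF assms(1)] by auto
  obtain D where D: "has_mat_deriv n (\<lambda>t. C t ^\<^sub>m j) D"
    and trD: "\<And>B. B \<in> carrier_mat n n \<Longrightarrow> C 0 * B = B * C 0 \<Longrightarrow> tr (D * B) = of_nat j * tr (C 0 ^\<^sub>m (j - 1) * C' * B)"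
    using Suc by blast
  have Dc[simp]: "D \<in> carrier_mat n n" using has_mat_derivD[OF D] by auto
  let ?P = "\<lambda>j. C 0 ^\<^sub>m j"
  have "tr ((D * C 0 + ?P j * C') * B) = of_nat (Suc j) * tr (?P j * C' * B)"
    if B: "B \<in> carrier_mat n n" "C 0 * B = B * C 0" for B
  proof -
    have "tr ((D * C 0 + ?P j * C') * B) = tr (D * (C 0 * B)) + tr (?P j * C' * B)"
      using B by (simp add: add_mult_distrib_mat[of _ n n _ _ n] assoc_sq[of _ n] tr_add[of _ n])
    also have "tr (D * (C 0 * B)) = of_nat j * tr (?P (j - 1) * C' * (C 0 * B))"
      using B by (intro trD) (simp, metis C(1) assoc_sq)
    also have "?P (j - 1) * C' * (C 0 * B) = (?P (j - 1) * (C' * B)) * C 0"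
      using B by (simp add: assoc_sq[of _ n])
    also have "tr \<dots> = tr (C 0 * (?P (j - 1) * (C' * B)))"
      using B by (intro tr_comm[of _ n n]) auto
    also have "of_nat j * \<dots> = of_nat j * tr (?P j * C' * B)"
    proof (cases j)
      case (Suc k)
      have "C 0 * ?P k = ?P k * C 0" by (rule pow_intertwine[of _ n]) auto
      then have "C 0 * (?P k * (C' * B)) = (?P k * C 0) * (C' * B)"
        using B by (simp add: assoc_sq[of _ n, symmetric])
      then show ?thesis using Suc B by (simp add: assoc_sq[of _ n])
    qed simp
    finally show ?thesis by (simp add: algebra_simps)
  qed
  then show ?case using has_mat_deriv_mult[OF D assms] by (intro exI[of _ "D * C 0 + ?P j * C'"]) auto
qed

lemma deriv_tr_pow:
  assumes "has_mat_deriv n C C'"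
  shows "((\<lambda>t. tr (C t ^\<^sub>m j)) has_field_derivative of_nat j * tr (C 0 ^\<^sub>m (j - 1) * C')) (at 0)"
proof -
  have C: "C t \<in> carrier_mat n n" "C' \<in> carrier_mat n n" for t using has_mat_derivD[OF assms(1)] by auto
  obtain D where D: "has_mat_deriv n (\<lambda>t. C t ^\<^sub>m j) D"
    and trD: "tr (D * 1\<^sub>m n) = of_nat j * tr (C 0 ^\<^sub>m (j - 1) * C' * 1\<^sub>m n)"
    using has_mat_deriv_pow[OF assms, of j] C(1)[of 0] C(2) by (metis left_mult_one_mat one_carrier_mat right_mult_one_mat)
  have Dc: "D \<in> carrier_mat n n" using has_mat_derivD[OF D] by auto
  have "dim_row (C t ^\<^sub>m j) = n" for t using C(1)[of t] by simp
  then have e: "tr (C t ^\<^sub>m j) = (\<Sum>a<n. (C t ^\<^sub>m j) $$ (a, a))" for t by (simp add: tr_def)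
  have "((\<lambda>t. tr (C t ^\<^sub>m j)) has_field_derivative tr D) (at 0)"
    unfolding e using has_mat_derivD(3)[OF D] Dc by (auto simp: tr_def intro!: DERIV_sum)
  then show ?thesis using trD Dc C by (simp add: right_mult_one_mat[of _ n])
qed

section \<open>Gelfand-Zeitlin vector fields\<close>

lemma aff_single [simp]: "[x] \<in> aff [n] \<longleftrightarrow> x \<in> carrier_mat n n"
  by (simp add: aff_iff)

lemma aff_singleE:
  assumes "p \<in> aff [n]" obtains x where "p = [x]" "x \<in> carrier_mat n n"
  using assms by (cases p) (auto simp: aff_iff)

lemma line_single: "pt_add [x] (pt_scale t [v]) = [x + t \<cdot>\<^sub>m v]"
  by (simp add: pt_add_def pt_scale_def)

lemma diff_first:
  assumes "p \<noteq> []" "v \<noteq> []"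
  shows "diff (\<lambda>q. H (q ! 0)) p v = diff (\<lambda>q. H (q ! 0)) [p ! 0] [v ! 0]"
proof -
  have "pt_add p (pt_scale t v) ! 0 = p ! 0 + t \<cdot>\<^sub>m v ! 0" for t
    using assms by (simp add: pt_add_nth pt_scale_nth)
  then show ?thesis by (simp add: diff_def line_single)
qed

lemma gz_poly: "i \<le> n \<Longrightarrow> gz i j \<in> poly_fun [n]"
  unfolding gz_def[abs_def] by (intro poly.in_tr[of _ i] poly.mat_in_pow poly_corner) auto

lemma diff_gz:
  assumes "x \<in> carrier_mat n n" "v \<in> carrier_mat n n" "i \<le> n"
  shows "diff (gz i j) [x] [v] = of_nat j * tr (corner i x ^\<^sub>m (j - 1) * corner i v)"
proof (rule diff_eqI)
  have "((\<lambda>t. tr (corner i (x + t \<cdot>\<^sub>m v) ^\<^sub>m j)) has_field_derivative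
      of_nat j * tr (corner i (x + 0 \<cdot>\<^sub>m v) ^\<^sub>m (j - 1) * corner i v)) (at 0)"
    using assms by (intro deriv_tr_pow[of i] has_mat_deriv_corner[of n] has_mat_deriv_line)
  moreover have "x + 0 \<cdot>\<^sub>m v = x" using assms by (intro eq_matI) auto
  ultimately show "((\<lambda>t. gz i j (pt_add [x] (pt_scale t [v]))) has_field_derivative
      of_nat j * tr (corner i x ^\<^sub>m (j - 1) * corner i v)) (at 0)"
    by (simp add: gz_def line_single)
qed

lemma gradient_eqI:
  assumes "y \<in> carrier_mat n n" "\<And>v. v \<in> carrier_mat n n \<Longrightarrow> tr (y * v) = diff f p [v]"
  shows "gradient n f p = y"
  unfolding gradient_def
proof (rule the_equality)
  fix y' assume y': "y' \<in> carrier_mat n n \<and> (\<forall>v\<in>carrier_mat n n. tr (y' * v) = diff f p [v])"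
  have "tr ((y' - y) * v) = 0" if "v \<in> carrier_mat n n" for v
    using that y' assms by (simp add: minus_mult_distrib_mat[of _ n n _ _ n] tr_diff[of _ n])
  then have 0: "y' - y = 0\<^sub>m n n" using y' assms(1) by (intro tr_nondegenerate) auto
  show "y' = y"
  proof (rule eq_matI)
    fix a b assume ab: "a < dim_row y" "b < dim_col y"
    have "(y' - y) $$ (a, b) = 0" using 0 ab assms(1) by auto
    then show "y' $$ (a, b) = y $$ (a, b)" using ab y' assms(1) by auto
  qed (use y' assms(1) in auto)
qed (use assms in auto)

lemma gradient_gz:
  assumes "x \<in> carrier_mat n n" "i \<le> n"
  shows "gradient n (gz i j) [x] = of_nat j \<cdot>\<^sub>m pad n (corner i x ^\<^sub>m (j - 1))"
proof (rule gradient_eqI)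
  fix v :: "complex mat" assume v: "v \<in> carrier_mat n n"
  then show "tr (of_nat j \<cdot>\<^sub>m pad n (corner i x ^\<^sub>m (j - 1)) * v) = diff (gz i j) [x] [v]"
    using assms by (simp add: diff_gz mult_smult_assoc_mat[of _ n n _ n] tr_smult[of _ n] tr_pad_mult[of _ i])
qed auto

text \<open>
  Gradients exist by induction on the polynomial; they turn statements about differentials into
  statements about matrices.
\<close>

lemma poly_gradient:
  assumes "h \<in> poly_fun [n]" "x \<in> carrier_mat n n"
  obtains y where "y \<in> carrier_mat n n" "\<And>v. v \<in> carrier_mat n n \<Longrightarrow> tr (y * v) = diff h [x] [v]"
    "gradient n h [x] = y"
proof -
  have "\<exists>y\<in>carrier_mat n n. \<forall>v\<in>carrier_mat n n. tr (y * v) = diff h [x] [v]"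
    using assms(1)
  proof induction
    case (const c)
    then show ?case by (intro bexI[of _ "0\<^sub>m n n"]) (auto simp: diff_const tr_def)
  next
    case (coord k a b)
    then have ab: "k = 0" "a < n" "b < n" by auto
    let ?y = "mat n n (\<lambda>(r, s). of_bool (r = b \<and> s = a) :: complex)"
    have "tr (?y * v) = v $$ (a, b)" if "v \<in> carrier_mat n n" for v
    proof -
      have "tr (?y * v) = (\<Sum>r<n. \<Sum>l<n. ?y $$ (r, l) * v $$ (l, r))"
        using that by (intro tr_mult) auto
      also have "\<dots> = (\<Sum>r<n. if r = b then v $$ (a, b) else 0)"
      proof (intro sum.cong refl)
        fix r assume r: "r \<in> {..<n}"
        have "(\<Sum>l<n. ?y $$ (r, l) * v $$ (l, r)) = (\<Sum>l<n. if l = a then of_bool (r = b) * v $$ (l, r) else 0)"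
          using r by (intro sum.cong refl) auto
        then show "(\<Sum>l<n. ?y $$ (r, l) * v $$ (l, r)) = (if r = b then v $$ (a, b) else 0)"
          using ab by simp
      qed
      finally show ?thesis using ab by simp
    qed
    moreover have "diff (\<lambda>p. p ! k $$ (a, b)) [x] [v] = v $$ (a, b)" if "v \<in> carrier_mat n n" for v
      using that ab assms(2) diff_coord[of "[x]" "[n]" "[v]" 0 a b] by simp
    ultimately show ?case by (intro bexI[of _ ?y]) auto
  next
    case (add F H)
    then obtain y z where "y \<in> carrier_mat n n" "\<forall>v\<in>carrier_mat n n. tr (y * v) = diff F [x] [v]"
      "z \<in> carrier_mat n n" "\<forall>v\<in>carrier_mat n n. tr (z * v) = diff H [x] [v]" by blast
    then show ?case using add assms(2)
      by (intro bexI[of _ "y + z"])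
        (auto simp: diff_add_fun[of _ "[n]"] add_mult_distrib_mat[of _ n n _ _ n] tr_add[of _ n])
  next
    case (mult F H)
    then obtain y z where "y \<in> carrier_mat n n" "\<forall>v\<in>carrier_mat n n. tr (y * v) = diff F [x] [v]"
      "z \<in> carrier_mat n n" "\<forall>v\<in>carrier_mat n n. tr (z * v) = diff H [x] [v]" by blast
    then show ?case using mult assms(2)
      by (intro bexI[of _ "H [x] \<cdot>\<^sub>m y + F [x] \<cdot>\<^sub>m z"])
        (auto simp: diff_mult_fun[of _ "[n]"] add_mult_distrib_mat[of _ n n _ _ n] tr_add[of _ n]
          mult_smult_assoc_mat[of _ n n _ n] tr_smult[of _ n])
  qed
  then show ?thesis using that gradient_eqI by blast
qed

lemma diff_sum_vec:
  assumes "h \<in> poly_fun [n]" "x \<in> carrier_mat n n" "\<And>i. i \<in> I \<Longrightarrow> V i \<in> carrier_mat n n"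
  shows "diff h [x] [mat n n (\<lambda>(a, b). \<Sum>i\<in>I. c i * V i $$ (a, b))] = (\<Sum>i\<in>I. c i * diff h [x] [V i])"
proof -
  let ?S = "mat n n (\<lambda>(a, b). \<Sum>i\<in>I. c i * V i $$ (a, b))"
  obtain y where y: "y \<in> carrier_mat n n" "\<And>v. v \<in> carrier_mat n n \<Longrightarrow> tr (y * v) = diff h [x] [v]"
    using poly_gradient[OF assms(1,2)] by blast
  have "diff h [x] [?S] = tr (y * ?S)" using y by simp
  also have "\<dots> = (\<Sum>a<n. \<Sum>k<n. y $$ (a, k) * (\<Sum>i\<in>I. c i * V i $$ (k, a)))"
    using y(1) by (subst tr_mult[of _ n n]) auto
  also have "\<dots> = (\<Sum>a<n. \<Sum>i\<in>I. c i * (\<Sum>k<n. y $$ (a, k) * V i $$ (k, a)))"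
    by (subst sum_swap_scaled) simp
  also have "\<dots> = (\<Sum>i\<in>I. c i * (\<Sum>a<n. \<Sum>k<n. y $$ (a, k) * V i $$ (k, a)))"
    by (subst sum.swap) (simp add: sum_distrib_left)
  also have "\<dots> = (\<Sum>i\<in>I. c i * tr (y * V i))"
    using y(1) assms(3) by (intro sum.cong refl) (simp add: tr_mult[of _ n n])
  also have "\<dots> = (\<Sum>i\<in>I. c i * diff h [x] [V i])" using y(2) assms(3) by simp
  finally show ?thesis .
qed

definition commutator :: "complex mat \<Rightarrow> complex mat \<Rightarrow> complex mat" where
  "commutator x y = x * y - y * x"

lemma zero_minus_zero [simp]: "0\<^sub>m n n - 0\<^sub>m n n = (0\<^sub>m n n :: complex mat)"
  by (intro eq_matI) auto

lemma commutator_carrier [simp]: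
  "x \<in> carrier_mat n n \<Longrightarrow> y \<in> carrier_mat n n \<Longrightarrow> commutator x y \<in> carrier_mat n n"
  by (simp add: commutator_def)

lemma commutator_smult:
  "x \<in> carrier_mat n n \<Longrightarrow> y \<in> carrier_mat n n \<Longrightarrow> commutator x (c \<cdot>\<^sub>m y) = c \<cdot>\<^sub>m commutator x y"
  unfolding commutator_def
  by (subst mult_smult_distrib[of _ n n _ n], simp, simp, subst mult_smult_assoc_mat[of _ n n _ n], simp, simp)
    (auto intro!: eq_matI simp: algebra_simps simp del: index_mult_mat(1))

lemma commutator_swap:
  assumes "x \<in> carrier_mat n n" "y \<in> carrier_mat n n" "z \<in> carrier_mat n n"
  shows "commutator (commutator x y) z = commutator (commutator x z) y + commutator x (commutator y z)"
  unfolding commutator_def using assms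
  by (simp add: minus_mult_distrib_mat[of _ n n _ _ n] mult_minus_distrib_mat[of _ n n _ n] assoc_sq[of _ n])
    (intro eq_matI, auto simp del: index_mult_mat(1))

text \<open>
  By invariance of the trace form \<open>{f, h}(x) = tr ([x, \<nabla>f] \<nabla>h)\<close>, which is the differential of \<open>h\<close> in
  the direction \<open>[x, \<nabla>f]\<close>.
\<close>

lemma hamiltonian_gz:
  assumes x: "x \<in> carrier_mat n n" and i: "i \<le> n"
  shows "hamiltonian_field n (gz i j) [x] = [of_nat j \<cdot>\<^sub>m commutator x (pad n (corner i x ^\<^sub>m (j - 1)))]"
proof -
  define g where "g = of_nat j \<cdot>\<^sub>m pad n (corner i x ^\<^sub>m (j - 1))"
  have g: "g \<in> carrier_mat n n" by (simp add: g_def)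
  have gr: "gradient n (gz i j) [x] = g" unfolding g_def by (rule gradient_gz[OF x i])
  have key: "lie_poisson n (gz i j) h [x] = diff h [x] [commutator x g]" if h: "h \<in> poly_fun [n]" for h
  proof -
    obtain y where y: "y \<in> carrier_mat n n" "\<And>v. v \<in> carrier_mat n n \<Longrightarrow> tr (y * v) = diff h [x] [v]"
      "gradient n h [x] = y" using poly_gradient[OF h x] by blast
    have "lie_poisson n (gz i j) h [x] = tr (x * (g * y)) - tr (x * (y * g))"
      using x g y by (simp add: lie_poisson_def gr mult_minus_distrib_mat[of _ n n _ n] tr_diff[of _ n])
    also have "tr (x * (g * y)) = tr ((x * g) * y)" using x g y by (simp add: assoc_sq[of _ n])
    also have "\<dots> = tr (y * (x * g))" using x g y by (intro tr_comm[of _ n n]) auto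
    also have "tr (x * (y * g)) = tr ((y * g) * x)" using x g y by (intro tr_comm[of _ n n]) auto
    also have "\<dots> = tr (y * (g * x))" using x g y by (simp add: assoc_sq[of _ n])
    also have "tr (y * (x * g)) - tr (y * (g * x)) = tr (y * commutator x g)"
      using x g y by (simp add: commutator_def mult_minus_distrib_mat[of _ n n _ n] tr_diff[of _ n])
    also have "\<dots> = diff h [x] [commutator x g]" using y x g by simp
    finally show ?thesis .
  qed
  have "(THE w. w \<in> aff [n] \<and> (\<forall>h\<in>poly_fun [n]. diff h [x] w = lie_poisson n (gz i j) h [x])) = [commutator x g]"
  proof (rule the_equality)
    show "[commutator x g] \<in> aff [n] \<and> (\<forall>h\<in>poly_fun [n]. diff h [x] [commutator x g] = lie_poisson n (gz i j) h [x])"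
      using x g key by simp
  next
    fix w assume w: "w \<in> aff [n] \<and> (\<forall>h\<in>poly_fun [n]. diff h [x] w = lie_poisson n (gz i j) h [x])"
    then obtain u where u: "w = [u]" "u \<in> carrier_mat n n" by (auto elim: aff_singleE)
    have "diff h [x] [commutator x g] = diff h [x] [u]" if "h \<in> poly_fun [n]" for h
      using w u key that by simp
    from this[OF poly_fun.coord[of 0 "[n]"]]
    have e: "diff (\<lambda>p. p ! 0 $$ (a, b)) [x] [commutator x g] = diff (\<lambda>p. p ! 0 $$ (a, b)) [x] [u]"
      if "a < n" "b < n" for a b using that by simp
    have "commutator x g $$ (a, b) = u $$ (a, b)" if "a < n" "b < n" for a b
      using e[OF that] that x u g by (simp add: diff_coord[of "[x]" "[n]" _ 0 a b])
    then show "w = [commutator x g]"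
      unfolding u(1) using u(2) x g carrier_matD[of "commutator x g" n n] by (auto intro!: eq_matI)
  qed
  then show ?thesis using x by (simp add: hamiltonian_field_def g_def commutator_smult[of _ n])
qed

text \<open>
  The pair \<open>(i, j)\<close> stands for the field \<open>[x, x\<^sub>i\<^sup>j]\<close>, a multiple of the Hamiltonian field of
  \<open>f\<^sub>i\<^sub>,\<^sub>j\<^sub>+\<^sub>1\<close>.
\<close>

definition gz_vec :: "nat \<Rightarrow> nat \<times> nat \<Rightarrow> complex mat \<Rightarrow> complex mat" where
  "gz_vec n m x = commutator x (pad n (corner (fst m) x ^\<^sub>m snd m))"

text \<open>
  The size \<open>i = n\<close> is left out, because \<open>x\<^sub>n = x\<close> commutes with its powers.
\<close>

definition gz_index :: "nat \<Rightarrow> (nat \<times> nat) set" where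
  "gz_index n = (SIGMA i:{1..<n}. {..<i})"

definition gz_comb :: "nat \<Rightarrow> (nat \<times> nat \<Rightarrow> complex) \<Rightarrow> complex mat \<Rightarrow> complex mat" where
  "gz_comb n c x = mat n n (\<lambda>(a, b). \<Sum>m\<in>gz_index n. c m * gz_vec n m x $$ (a, b))"

definition gz_field :: "nat \<Rightarrow> (nat \<times> nat \<Rightarrow> complex) \<Rightarrow> point \<Rightarrow> point" where
  "gz_field n c = (\<lambda>p\<in>aff [n]. [gz_comb n c (p ! 0)])"

lemma finite_gz_index [simp]: "finite (gz_index n)"
  by (simp add: gz_index_def)

lemma gz_index_le: "m \<in> gz_index n \<Longrightarrow> fst m < n"
  by (auto simp: gz_index_def)

lemma gz_vec_carrier [simp]: "x \<in> carrier_mat n n \<Longrightarrow> gz_vec n m x \<in> carrier_mat n n"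
  by (simp add: gz_vec_def)

lemma gz_comb_carrier [simp]: "gz_comb n c x \<in> carrier_mat n n"
  by (simp add: gz_comb_def)

lemma gz_field_apply [simp]: "x \<in> carrier_mat n n \<Longrightarrow> gz_field n c [x] = [gz_comb n c x]"
  by (simp add: gz_field_def)

lemma (in function_algebra) mat_in_gz_vec:
  assumes "mat_in n n F" "fst m \<le> n"
  shows "mat_in n n (\<lambda>q. gz_vec n m (F q))"
  unfolding gz_vec_def commutator_def using assms
  by (intro mat_in_diff mat_in_mult[of n n] mat_in_extend[of "fst m"] mat_in_pow mat_in_corner[of n])

lemma (in function_algebra) mat_in_gz_comb:
  assumes "mat_in n n F"
  shows "mat_in n n (\<lambda>q. gz_comb n c (F q))"
  unfolding gz_comb_def
  by (intro mat_in_mat sum mult const mat_inD(2)[OF mat_in_gz_vec[OF assms]] less_imp_le gz_index_le)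

lemma gz_comb_add: "gz_comb n (\<lambda>m. c m + d m) x = gz_comb n c x + gz_comb n d x"
  and gz_comb_scale: "gz_comb n (\<lambda>m. s * c m) x = s \<cdot>\<^sub>m gz_comb n c x"
  and gz_comb_zero: "gz_comb n (\<lambda>m. 0) x = 0\<^sub>m n n"
  by (auto simp: gz_comb_def sum.distrib distrib_right sum_distrib_left mult.assoc intro!: eq_matI)

lemma gz_comb_cong: "(\<And>m. m \<in> gz_index n \<Longrightarrow> c m = d m) \<Longrightarrow> gz_comb n c = gz_comb n d"
  by (simp add: gz_comb_def fun_eq_iff)

lemma gz_field_cong: "(\<And>m. m \<in> gz_index n \<Longrightarrow> c m = d m) \<Longrightarrow> gz_field n c = gz_field n d"
  unfolding gz_field_def by (simp add: gz_comb_cong[of n c d])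

lemma gz_field_add: "vf_add (aff [n]) (gz_field n c) (gz_field n d) = gz_field n (\<lambda>m. c m + d m)"
  unfolding vf_add_def gz_field_def
  by (rule restrict_ext) (auto elim!: aff_singleE simp: gz_comb_add pt_add_def)

lemma gz_field_scale: "vf_scale (aff [n]) s (gz_field n c) = gz_field n (\<lambda>m. s * c m)"
  unfolding vf_scale_def gz_field_def
  by (rule restrict_ext) (auto elim!: aff_singleE simp: gz_comb_scale pt_scale_def)

text \<open>
  The scalar factors \<open>j\<close> of the Hamiltonian fields are absorbed into the coefficients.
\<close>

lemma gz_algebra_eq: "gz_algebra n = range (gz_field n)"
proof -
  have ham: "hamiltonian_field n (gz i j) [x] ! 0 $$ (a, b) = of_nat j * gz_vec n (i, j - 1) x $$ (a, b)"
    if "x \<in> carrier_mat n n" "i \<le> n" "a < n" "b < n" for i j x a b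
    using that carrier_matD[of "commutator x (pad n (corner i x ^\<^sub>m (j - 1)))" n n]
    by (simp add: hamiltonian_gz gz_vec_def)
  have top: "gz_vec n (n, j) x = 0\<^sub>m n n" if "x \<in> carrier_mat n n" for j x
    using that pow_intertwine[of x n x x j] by (simp add: gz_vec_def commutator_def)
  have sums: "(\<Sum>i=1..n. \<Sum>j=1..i. d i j * hamiltonian_field n (gz i j) [x] ! 0 $$ (a, b))
      = (\<Sum>m\<in>gz_index n. (d (fst m) (Suc (snd m)) * of_nat (Suc (snd m))) * gz_vec n m x $$ (a, b))"
    if x: "x \<in> carrier_mat n n" and ab: "a < n" "b < n" for d x a b
  proof -
    have "(\<Sum>i=1..n. \<Sum>j=1..i. d i j * hamiltonian_field n (gz i j) [x] ! 0 $$ (a, b))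
      = (\<Sum>i=1..n. \<Sum>j=1..i. d i j * of_nat j * gz_vec n (i, j - 1) x $$ (a, b))"
      using x ab by (intro sum.cong refl) (auto simp: ham)
    also have "\<dots> = (\<Sum>i=1..n. \<Sum>j<i. d i (Suc j) * of_nat (Suc j) * gz_vec n (i, j) x $$ (a, b))"
      by (intro sum.cong refl sum.reindex_bij_witness[of _ Suc "\<lambda>j. j - 1"]) auto
    also have "\<dots> = (\<Sum>i\<in>{1..<n}. \<Sum>j<i. d i (Suc j) * of_nat (Suc j) * gz_vec n (i, j) x $$ (a, b))"
      using x ab by (intro sum.mono_neutral_right) (auto simp: top)
    also have "\<dots> = (\<Sum>m\<in>gz_index n. (d (fst m) (Suc (snd m)) * of_nat (Suc (snd m))) * gz_vec n m x $$ (a, b))"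
      unfolding gz_index_def by (subst sum.Sigma) (auto intro!: sum.cong)
    finally show ?thesis .
  qed
  have field: "(\<lambda>p\<in>aff [n]. [mat n n (\<lambda>(a, b).
        \<Sum>i=1..n. \<Sum>j=1..i. d i j * (hamiltonian_field n (gz i j) p ! 0) $$ (a, b))])
     = gz_field n (\<lambda>m. d (fst m) (Suc (snd m)) * of_nat (Suc (snd m)))" for d
    unfolding gz_field_def
  proof (rule restrict_ext)
    fix p assume "p \<in> aff [n]"
    then obtain x where x: "p = [x]" "x \<in> carrier_mat n n" by (rule aff_singleE)
    show "[mat n n (\<lambda>(a, b). \<Sum>i=1..n. \<Sum>j=1..i. d i j * (hamiltonian_field n (gz i j) p ! 0) $$ (a, b))]
      = [gz_comb n (\<lambda>m. d (fst m) (Suc (snd m)) * of_nat (Suc (snd m))) (p ! 0)]"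
      unfolding x(1) list.inject gz_comb_def nth_Cons_0
      by (intro conjI refl cong_mat) (simp only: prod.case sums[OF x(2)])
  qed
  show ?thesis
  proof (intro equalityI subsetI)
    fix \<xi> assume "\<xi> \<in> gz_algebra n"
    then show "\<xi> \<in> range (gz_field n)" unfolding gz_algebra_def field by auto
  next
    fix \<xi> assume "\<xi> \<in> range (gz_field n)"
    then obtain c where c: "\<xi> = gz_field n c" by auto
    have "\<xi> = gz_field n (\<lambda>m. (\<lambda>i j. c (i, j - 1) / of_nat j) (fst m) (Suc (snd m)) * of_nat (Suc (snd m)))"
      unfolding c by (simp del: of_nat_Suc)
    then show "\<xi> \<in> gz_algebra n" unfolding gz_algebra_def field
      by (intro CollectI exI[of _ "\<lambda>i j. c (i, j - 1) / of_nat j"])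
  qed
qed

definition gz_gen :: "nat \<Rightarrow> (nat \<times> nat \<Rightarrow> complex) \<Rightarrow> complex mat \<Rightarrow> complex mat" where
  "gz_gen n c x = mat n n (\<lambda>(a, b). \<Sum>m\<in>gz_index n. c m * pad n (corner (fst m) x ^\<^sub>m snd m) $$ (a, b))"

lemma gz_gen_carrier [simp]: "gz_gen n c x \<in> carrier_mat n n"
  and gz_gen_dim [simp]: "dim_row (gz_gen n c x) = n" "dim_col (gz_gen n c x) = n"
  by (simp_all add: gz_gen_def)

lemma gz_comb_commutator:
  assumes x: "x \<in> carrier_mat n n"
  shows "gz_comb n c x = commutator x (gz_gen n c x)"
proof (rule eq_matI)
  fix a b assume "a < dim_row (commutator x (gz_gen n c x))" "b < dim_col (commutator x (gz_gen n c x))"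
  then have ab: "a < n" "b < n" using carrier_matD[of "commutator x (gz_gen n c x)" n n] x by auto
  let ?p = "\<lambda>m. pad n (corner (fst m) x ^\<^sub>m snd m)"
  have v: "gz_vec n m x $$ (a, b) = (\<Sum>k<n. x $$ (a, k) * ?p m $$ (k, b)) - (\<Sum>k<n. ?p m $$ (a, k) * x $$ (k, b))" for m
    using ab x by (simp add: gz_vec_def commutator_def entry_mult[of _ n n _ n] del: index_mult_mat(1))
  have "commutator x (gz_gen n c x) $$ (a, b)
    = (\<Sum>k<n. x $$ (a, k) * (\<Sum>m\<in>gz_index n. c m * ?p m $$ (k, b)))
      - (\<Sum>k<n. x $$ (k, b) * (\<Sum>m\<in>gz_index n. c m * ?p m $$ (a, k)))"
    using ab x by (simp add: gz_gen_def commutator_def entry_mult[of _ n n _ n] mult.commute[of "x $$ _"] del: index_mult_mat(1))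
  also have "\<dots> = (\<Sum>m\<in>gz_index n. c m * gz_vec n m x $$ (a, b))"
    unfolding v right_diff_distrib sum_subtractf by (subst (1 2) sum_swap_scaled) (simp add: mult.commute)
  finally show "gz_comb n c x $$ (a, b) = commutator x (gz_gen n c x) $$ (a, b)"
    using ab by (simp add: gz_comb_def)
qed (use carrier_matD[of "commutator x (gz_gen n c x)" n n] x in \<open>auto simp: gz_comb_def\<close>)

lemma shift_corner_pow:
  fixes N :: "complex mat"
  assumes "N = mat n n (\<lambda>(a, b). of_bool (b = Suc a))" "i \<le> n" "a < i" "b < i"
  shows "(corner i N ^\<^sub>m j) $$ (a, b) = of_bool (b = a + j)"
  using assms(3,4)
proof (induction j arbitrary: a b)
  case (Suc j)
  have N: "N $$ (k, l) = of_bool (l = Suc k)" if "k < i" "l < i" for k l using that assms(1,2) by simp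
  have "(corner i N ^\<^sub>m Suc j) $$ (a, b) = (\<Sum>k<i. (corner i N ^\<^sub>m j) $$ (a, k) * corner i N $$ (k, b))"
    using Suc.prems by (subst pow_mat.simps, intro entry_mult[of _ i i _ i]) auto
  also have "\<dots> = (\<Sum>k<i. if k = b - 1 then of_bool (b = a + Suc j) else 0)"
    using Suc.prems by (intro sum.cong refl) (auto simp: Suc.IH N less_imp_diff_less)
  also have "\<dots> = of_bool (b = a + Suc j)" using Suc.prems by auto
  finally show ?case .
qed (use assms in auto)

text \<open>
  The test point is the nilpotent Jordan block \<open>N\<close>. The combination of powers of corners of \<open>N\<close> has
  zero last row and column. If it commutes with \<open>N\<close>, it is constant along diagonals and therefore
  zero; the entries on the \<open>j\<close>-th superdiagonal are partial sums of the coefficients of the \<open>j\<close>-th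
  powers, so the coefficients vanish one after the other.
\<close>

lemma gz_field_inj:
  assumes "gz_field n c = gz_field n c'" "m \<in> gz_index n"
  shows "c m = c' m"
proof -
  define N :: "complex mat" where "N = mat n n (\<lambda>(a, b). of_bool (b = Suc a))"
  have N: "N \<in> carrier_mat n n" by (simp add: N_def)
  have Ne: "N $$ (a, b) = of_bool (b = Suc a)" if "a < n" "b < n" for a b using that by (simp add: N_def)
  define d where "d m = c m - c' m" for m
  have "gz_comb n c N = gz_comb n c' N" using fun_cong[OF assms(1), of "[N]"] N by simp
  then have eq: "gz_comb n c N $$ (a, b) = gz_comb n c' N $$ (a, b)" for a b by simp
  \<comment> \<open>the entries of the combination of powers of corners of \<open>N\<close>\<close>
  define g where "g a b = (\<Sum>m\<in>gz_index n. d m * of_bool (a < fst m \<and> b < fst m \<and> b = a + snd m))" for a b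
  have gen: "gz_gen n d N $$ (a, b) = g a b" if "a < n" "b < n" for a b
  proof -
    have "pad n (corner (fst m) N ^\<^sub>m snd m) $$ (a, b) = of_bool (a < fst m \<and> b < fst m \<and> b = a + snd m)"
      if m: "m \<in> gz_index n" for m
      using shift_corner_pow[OF N_def, of "fst m" a b "snd m"] gz_index_le[OF m] \<open>a < n\<close> \<open>b < n\<close>
      by (auto simp add: pad_def)
    then show ?thesis using that by (simp add: gz_gen_def g_def)
  qed
  have comm: "commutator N (gz_gen n d N) $$ (a, b) = 0" if "a < n" "b < n" for a b
    using eq[of a b] that N
    by (simp add: gz_comb_commutator[symmetric] gz_comb_def d_def left_diff_distrib sum_subtractf)
  have bdry: "g a b = 0" if "n \<le> Suc a \<or> n \<le> Suc b" for a b
    unfolding g_def using that by (intro sum.neutral) (auto dest!: gz_index_le)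
  have shift: "g a b = g (Suc a) (Suc b)" if ab: "a < n" "Suc b < n" for a b
  proof -
    have "commutator N (gz_gen n d N) $$ (a, Suc b)
      = (\<Sum>k<n. N $$ (a, k) * gz_gen n d N $$ (k, Suc b)) - (\<Sum>k<n. gz_gen n d N $$ (a, k) * N $$ (k, Suc b))"
      using that N carrier_matD[OF N] by (simp add: commutator_def entry_mult[of _ n n _ n] del: index_mult_mat(1))
    also have "(\<Sum>k<n. N $$ (a, k) * gz_gen n d N $$ (k, Suc b)) = (\<Sum>k<n. if k = Suc a then g (Suc a) (Suc b) else 0)"
      using that by (intro sum.cong refl) (auto simp: Ne gen)
    also have "(\<Sum>k<n. gz_gen n d N $$ (a, k) * N $$ (k, Suc b)) = (\<Sum>k<n. if k = b then g a b else 0)"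
      using that by (intro sum.cong refl) (auto simp: Ne gen)
    finally show ?thesis using comm[of a "Suc b"] ab bdry[of "Suc a" "Suc b"] by (auto split: if_splits)
  qed
  have g0: "g a b = 0" if "a < n" "b < n" for a b
    using that
  proof (induction "n - b" arbitrary: a b rule: less_induct)
    case less
    show ?case
    proof (cases "Suc b < n \<and> Suc a < n")
      case True
      then show ?thesis using less(1)[of "Suc b" "Suc a"] less(2-) shift[of a b] by auto
    qed (use bdry in auto)
  qed
  have "d (s, j) = 0" if "j < s" "s < n" for s j
    using that
  proof (induction "n - s" arbitrary: s rule: less_induct)
    case less
    have "0 = g (s - 1 - j) (s - 1)" using g0[of "s - 1 - j" "s - 1"] less(2-) by simp
    also have "\<dots> = (\<Sum>m\<in>gz_index n. if m = (s, j) then d (s, j) else 0)"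
      unfolding g_def
    proof (intro sum.cong refl)
      fix m assume m: "m \<in> gz_index n"
      obtain i l where [simp]: "m = (i, l)" by (cases m)
      show "d m * of_bool (s - 1 - j < fst m \<and> s - 1 < fst m \<and> s - 1 = s - 1 - j + snd m) = (if m = (s, j) then d (s, j) else 0)"
      proof (cases "s \<le> i \<and> l = j")
        case True
        then show ?thesis
          using less(1)[of i] less(2-) m le_neq_implies_less[of s i] diff_less_mono2[of s i n]
          by (cases "i = s") (auto simp: gz_index_def)
      next
        case False
        then show ?thesis using less(2-) by auto
      qed
    qed
    also have "\<dots> = d (s, j)" using less(2-) by (auto simp: gz_index_def)
    finally show ?case by simp
  qed
  then show ?thesis using assms(2) by (cases m) (auto simp: gz_index_def d_def)
qed

text \<open>
  Moving \<open>x\<close> in the direction \<open>[x, y]\<close>, with \<open>y\<close> a power of \<open>x\<^sub>i\<close>, moves a larger corner \<open>x\<^sub>k\<close> in the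
  direction \<open>[x\<^sub>k, y]\<close> and does not move the corners of size at most \<open>i\<close>.
\<close>

lemma gz_vec_deriv:
  assumes x: "x \<in> carrier_mat n n" and ik: "fst m \<le> n" "fst m' \<le> n"
  defines "y \<equiv> pad n (corner (fst m) x ^\<^sub>m snd m)" and "z \<equiv> pad n (corner (fst m') x ^\<^sub>m snd m')"
  shows "has_mat_deriv n (\<lambda>t. gz_vec n m' (x + t \<cdot>\<^sub>m gz_vec n m x))
    (if fst m < fst m' then commutator (commutator x z) y else commutator (commutator x y) z)"
proof -
  obtain i j where m: "m = (i, j)" by (cases m)
  obtain k l where m': "m' = (k, l)" by (cases m')
  define C where "C t = x + t \<cdot>\<^sub>m gz_vec n m x" for t
  have C: "has_mat_deriv n C (commutator x y)"
    using has_mat_deriv_line[OF x, of "gz_vec n m x"] x unfolding C_def by (simp add: gz_vec_def y_def)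
  have C0: "C 0 = x" unfolding C_def using x carrier_matD[of "gz_vec n m x" n n] by (intro eq_matI) auto
  have yz: "y \<in> carrier_mat n n" "z \<in> carrier_mat n n" by (simp_all add: y_def z_def)
  have k: "k \<le> n" "i \<le> n" using ik by (simp_all add: m m')
  let ?xk = "corner k x"
  have Ck: "has_mat_deriv k (\<lambda>t. corner k (C t)) (corner k (commutator x y))"
    using C k(1) by (rule has_mat_deriv_corner)
  have ck: "corner k (A - B) = corner k A - corner k B" if "A \<in> carrier_mat n n" "B \<in> carrier_mat n n" for A B
    using that k by (intro eq_matI) auto
  show ?thesis
  proof (cases "i < k")
    case True
    let ?Y = "pad k (corner i x ^\<^sub>m j)"
    have "corner k (commutator x y) = ?xk * ?Y - ?Y * ?xk"
      unfolding commutator_def y_def m using True x k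
      by (simp add: ck corner_pad_mult[of _ i])
    then have "has_mat_deriv k (\<lambda>t. corner k (C t) ^\<^sub>m l) (?xk ^\<^sub>m l * ?Y - ?Y * ?xk ^\<^sub>m l)"
      using has_mat_deriv_pow_commutator[of k "\<lambda>t. corner k (C t)" ?Y l] Ck C0 by simp
    from has_mat_deriv_pad[OF this k(1)]
    have "has_mat_deriv n (\<lambda>t. pad n (corner k (C t) ^\<^sub>m l)) (pad n (?xk ^\<^sub>m l * ?Y - ?Y * ?xk ^\<^sub>m l))" .
    also have "pad n (?xk ^\<^sub>m l * ?Y - ?Y * ?xk ^\<^sub>m l) = pad n (?xk ^\<^sub>m l * ?Y) - pad n (?Y * ?xk ^\<^sub>m l)"
      by (intro eq_matI) (auto simp: pad_def simp del: index_mult_mat(1))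
    also have "\<dots> = commutator z y"
      using k True by (simp add: commutator_def y_def z_def m m' pad_mult[of _ k] pad_pad[of _ i])
    finally have Z: "has_mat_deriv n (\<lambda>t. pad n (corner k (C t) ^\<^sub>m l)) (commutator z y)" .
    have "has_mat_deriv n (\<lambda>t. gz_vec n m' (C t))
      ((commutator x y * z + x * commutator z y) - (commutator z y * x + z * commutator x y))"
      using has_mat_deriv_diff[OF has_mat_deriv_mult[OF C Z] has_mat_deriv_mult[OF Z C]]
      by (simp add: gz_vec_def commutator_def m' C0 z_def)
    also have "(commutator x y * z + x * commutator z y) - (commutator z y * x + z * commutator x y)
      = commutator (commutator x z) y"
      unfolding commutator_def using x yz
      by (simp add: minus_mult_distrib_mat[of _ n n _ _ n] mult_minus_distrib_mat[of _ n n _ n] assoc_sq[of _ n])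
        (intro eq_matI, auto simp del: index_mult_mat(1))
    finally show ?thesis using True by (simp add: m m' C_def)
  next
    case False
    have "corner k (commutator x y) = corner k (corner i (commutator x y))" using False by simp
    also have "corner i (commutator x y) = corner i x * corner i x ^\<^sub>m j - corner i x ^\<^sub>m j * corner i x"
    proof -
      have "corner i (A - B) = corner i A - corner i B" if "A \<in> carrier_mat n n" "B \<in> carrier_mat n n" for A B
        using that k by (intro eq_matI) auto
      then show ?thesis unfolding commutator_def y_def m using x k
        by (simp add: corner_pad_mult[of _ i])
    qed
    also have "\<dots> = 0\<^sub>m i i" using pow_intertwine[of "corner i x" i "corner i x" "corner i x" j] by simp
    also have "corner k (0\<^sub>m i i) = 0\<^sub>m k k" using False by (intro eq_matI) auto
    finally have c0: "corner k (commutator x y) = 0\<^sub>m k k" .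
    have "has_mat_deriv k (\<lambda>t. corner k (C t) ^\<^sub>m l) (?xk ^\<^sub>m l * 0\<^sub>m k k - 0\<^sub>m k k * ?xk ^\<^sub>m l)"
      using has_mat_deriv_pow_commutator[of k "\<lambda>t. corner k (C t)" "0\<^sub>m k k" l] Ck c0 C0 by simp
    then have "has_mat_deriv k (\<lambda>t. corner k (C t) ^\<^sub>m l) (0\<^sub>m k k)" by (cases l) simp_all
    from has_mat_deriv_pad[OF this k(1)]
    have Z: "has_mat_deriv n (\<lambda>t. pad n (corner k (C t) ^\<^sub>m l)) (0\<^sub>m n n)" by simp
    have "has_mat_deriv n (\<lambda>t. gz_vec n m' (C t))
      ((commutator x y * z + x * 0\<^sub>m n n) - (0\<^sub>m n n * x + z * commutator x y))"
      using has_mat_deriv_diff[OF has_mat_deriv_mult[OF C Z] has_mat_deriv_mult[OF Z C]]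
      by (simp add: gz_vec_def commutator_def m' C0 z_def)
    also have "(commutator x y * z + x * 0\<^sub>m n n) - (0\<^sub>m n n * x + z * commutator x y) = commutator (commutator x y) z"
      using x yz by (simp add: commutator_def[of "commutator x y"])
    finally show ?thesis using False by (simp add: m m' C_def)
  qed
qed

text \<open>
  The bracket of two of the spanning fields vanishes: for corners of different sizes the two
  derivatives are literally equal, and for equal sizes this is the Jacobi identity for commuting
  powers of one corner.
\<close>

lemma gz_vec_diff_swap:
  assumes x: "x \<in> carrier_mat n n" and ik: "fst m \<le> n" "fst m' \<le> n" and ab: "a < n" "b < n"
  shows "diff (\<lambda>p. gz_vec n m' (corner n (p ! 0)) $$ (a, b)) [x] [gz_vec n m x]
       = diff (\<lambda>p. gz_vec n m (corner n (p ! 0)) $$ (a, b)) [x] [gz_vec n m' x]"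
proof -
  define y where "y = pad n (corner (fst m) x ^\<^sub>m snd m)"
  define z where "z = pad n (corner (fst m') x ^\<^sub>m snd m')"
  have yz: "y \<in> carrier_mat n n" "z \<in> carrier_mat n n" by (simp_all add: y_def z_def)
  have cn: "corner n (x + t \<cdot>\<^sub>m v) = x + t \<cdot>\<^sub>m v" if "v \<in> carrier_mat n n" for t v
    using that x by (intro corner_id) auto
  have d1: "diff (\<lambda>p. gz_vec n m' (corner n (p ! 0)) $$ (a, b)) [x] [gz_vec n m x]
    = (if fst m < fst m' then commutator (commutator x z) y else commutator (commutator x y) z) $$ (a, b)"
    by (rule diff_eqI) (use has_mat_derivD(3)[OF gz_vec_deriv[OF x ik, folded y_def z_def] ab] x in \<open>simp add: line_single cn split del: if_split\<close>)
  have d2: "diff (\<lambda>p. gz_vec n m (corner n (p ! 0)) $$ (a, b)) [x] [gz_vec n m' x]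
    = (if fst m' < fst m then commutator (commutator x y) z else commutator (commutator x z) y) $$ (a, b)"
    by (rule diff_eqI) (use has_mat_derivD(3)[OF gz_vec_deriv[OF x ik(2,1), folded y_def z_def] ab] x in \<open>simp add: line_single cn split del: if_split\<close>)
  show ?thesis
  proof (cases "fst m = fst m'")
    case True
    let ?A = "corner (fst m) x"
    have A: "?A \<in> carrier_mat (fst m) (fst m)" by simp
    have "?A ^\<^sub>m snd m * ?A ^\<^sub>m snd m' = ?A ^\<^sub>m snd m' * ?A ^\<^sub>m snd m"
      by (rule pow_intertwine[OF A A pow_carrier_mat[OF A]]) (rule pow_intertwine[OF A A A refl, symmetric])
    then have "y * z = z * y" using True ik by (simp add: y_def z_def pad_mult[of _ "fst m'", symmetric])
    then have "commutator y z = 0\<^sub>m n n" using yz by (simp add: commutator_def)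
    then have "commutator (commutator x y) z = commutator (commutator x z) y"
      using commutator_swap[OF x yz] x yz right_add_zero_mat[of "commutator (commutator x z) y" n n]
      by (simp add: commutator_def[of x "0\<^sub>m n n"])
    then show ?thesis unfolding d1 d2 by simp
  next
    case False
    then show ?thesis unfolding d1 d2 by simp
  qed
qed

lemma gz_comb_poly: "a < n \<Longrightarrow> b < n \<Longrightarrow> (\<lambda>p. gz_comb n c (corner n (p ! 0)) $$ (a, b)) \<in> poly_fun [n]"
  by (rule poly.mat_inD(2)[OF poly.mat_in_gz_comb[OF poly_corner]]) simp_all

lemma diff_gz_comb:
  assumes x: "x \<in> carrier_mat n n" and ab: "a < n" "b < n"
  shows "diff (\<lambda>p. gz_comb n c' (corner n (p ! 0)) $$ (a, b)) [x] [gz_comb n c x]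
    = (\<Sum>m'\<in>gz_index n. \<Sum>m\<in>gz_index n. c' m' * c m * diff (\<lambda>p. gz_vec n m' (corner n (p ! 0)) $$ (a, b)) [x] [gz_vec n m x])"
proof -
  have P: "(\<lambda>p. gz_vec n m (corner n (p ! 0)) $$ (a, b)) \<in> poly_fun [n]" if "m \<in> gz_index n" for m
    using poly.mat_inD(2)[OF poly.mat_in_gz_vec[OF poly_corner], of 0 "[n]" n m] gz_index_le[OF that] ab by simp
  have "diff (\<lambda>p. gz_comb n c' (corner n (p ! 0)) $$ (a, b)) [x] [gz_comb n c x]
    = diff (\<lambda>p. \<Sum>m'\<in>gz_index n. c' m' * gz_vec n m' (corner n (p ! 0)) $$ (a, b)) [x] [gz_comb n c x]"
    using ab by (simp add: gz_comb_def)
  also have "\<dots> = (\<Sum>m'\<in>gz_index n. c' m' * diff (\<lambda>p. gz_vec n m' (corner n (p ! 0)) $$ (a, b)) [x] [gz_comb n c x])"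
    using x P by (subst diff_sum_fun[of _ "[n]"])
      (auto simp: diff_mult_fun[of _ "[n]"] diff_const poly.const intro!: poly.mult poly.const)
  also have "\<dots> = (\<Sum>m'\<in>gz_index n. c' m' * (\<Sum>m\<in>gz_index n. c m * diff (\<lambda>p. gz_vec n m' (corner n (p ! 0)) $$ (a, b)) [x] [gz_vec n m x]))"
    unfolding gz_comb_def using x P by (intro sum.cong refl arg_cong2[of _ _ _ _ "(*)"] diff_sum_vec) auto
  finally show ?thesis by (simp add: sum_distrib_left mult.assoc)
qed

lemma diff_gz_comb_swap:
  assumes x: "x \<in> carrier_mat n n" and ab: "a < n" "b < n"
  shows "diff (\<lambda>p. gz_comb n c' (corner n (p ! 0)) $$ (a, b)) [x] [gz_comb n c x]
    = diff (\<lambda>p. gz_comb n c (corner n (p ! 0)) $$ (a, b)) [x] [gz_comb n c' x]"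
  unfolding diff_gz_comb[OF assms]
  by (subst sum.swap, intro sum.cong refl)
    (use gz_vec_diff_swap[OF x _ _ ab] in \<open>auto simp: mult_ac dest!: gz_index_le\<close>)

section \<open>Strong regularity\<close>

text \<open>
  If each differential at \<open>x\<close> factors through the differential of the same function at \<open>x'\<close>, then a
  linear relation at \<open>x'\<close> gives the same relation at \<open>x\<close>.
\<close>

lemma strongly_regular_transfer:
  assumes "strongly_regular n x" "x' \<in> carrier_mat n n"
    and "\<And>v. v \<in> carrier_mat n n \<Longrightarrow>
      \<exists>v'\<in>carrier_mat n n. \<forall>i\<le>n. \<forall>j. diff (gz i j) [x'] [v'] = diff (gz i j) [x] [v]"
  shows "strongly_regular n x'"
  unfolding strongly_regular_def
proof (intro conjI allI impI assms(2))
  fix c :: "nat \<Rightarrow> nat \<Rightarrow> complex"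
  assume 0: "\<forall>v\<in>aff [n]. (\<Sum>i=1..n. \<Sum>j=1..i. c i j * diff (gz i j) [x'] v) = 0"
  have "(\<Sum>i=1..n. \<Sum>j=1..i. c i j * diff (gz i j) [x] w) = 0" if w: "w \<in> aff [n]" for w
  proof -
    from w obtain v where v: "w = [v]" "v \<in> carrier_mat n n" by (rule aff_singleE)
    obtain v' where v': "v' \<in> carrier_mat n n" "\<forall>i\<le>n. \<forall>j. diff (gz i j) [x'] [v'] = diff (gz i j) [x] [v]"
      using assms(3)[OF v(2)] by blast
    have "(\<Sum>i=1..n. \<Sum>j=1..i. c i j * diff (gz i j) [x] w) = (\<Sum>i=1..n. \<Sum>j=1..i. c i j * diff (gz i j) [x'] [v'])"
      using v' by (intro sum.cong refl) (auto simp: v(1))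
    then show ?thesis using 0 v'(1) by simp
  qed
  then show "\<forall>i\<in>{1..n}. \<forall>j\<in>{1..i}. c i j = 0" using assms(1) by (auto simp: strongly_regular_def)
qed

lemma tr_mat_poly_mult:
  assumes "A \<in> carrier_mat n n" "v \<in> carrier_mat n n"
  shows "tr (mat_poly m c A * v) = (\<Sum>l<m. c l * tr (A ^\<^sub>m l * v))"
proof -
  have "tr (mat_poly m c A * v) = (\<Sum>a<n. \<Sum>b<n. v $$ (b, a) * (\<Sum>l<m. c l * (A ^\<^sub>m l) $$ (a, b)))"
    using assms by (subst tr_mult[of _ n n]) (auto simp: mat_poly_entry[of _ n] mult.commute)
  also have "\<dots> = (\<Sum>a<n. \<Sum>l<m. c l * (\<Sum>b<n. v $$ (b, a) * (A ^\<^sub>m l) $$ (a, b)))"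
    by (subst sum_swap_scaled) simp
  also have "\<dots> = (\<Sum>l<m. c l * tr (A ^\<^sub>m l * v))"
    using assms by (subst sum.swap) (simp add: sum_distrib_left tr_mult[of _ n n] mult.commute)
  finally show ?thesis .
qed

text \<open>
  The gradient of \<open>f\<^sub>i\<^sub>j\<close> is \<open>j x\<^sub>i\<^sup>j\<^sup>-\<^sup>1\<close>, so a matrix that is a polynomial in two successive corners
  gives a linear relation between differentials.
\<close>

lemma strongly_regular_indep:
  assumes sr: "strongly_regular n x" and i: "1 \<le> i" "i < n"
    and eq: "pad n (mat_poly i c (corner i x)) = pad n (mat_poly (Suc i) d (corner (Suc i) x))"
    and j: "j < i"
  shows "c j = 0"
proof -
  have x: "x \<in> carrier_mat n n" using sr by (simp add: strongly_regular_def)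
  \<comment> \<open>division by \<open>l\<close> cancels the factor in the differential of \<open>f\<^sub>k\<^sub>l\<close>\<close>
  define C where "C k l = (if k = i then c (l - 1) / of_nat l else if k = Suc i then - d (l - 1) / of_nat l else 0)"
    for k l :: nat
  have "(\<Sum>k=1..n. \<Sum>l=1..k. C k l * diff (gz k l) [x] w) = 0" if W: "w \<in> aff [n]" for w
  proof -
    from W obtain v where w: "w = [v]" and v: "v \<in> carrier_mat n n" by (rule aff_singleE)
    define T where "T k l = tr (corner k x ^\<^sub>m l * corner k v)" for k l
    have poly: "(\<Sum>l<k. e l * T k l) = tr (pad n (mat_poly k e (corner k x)) * v)" if k: "k \<le> n" for k e
    proof -
      have "tr (pad n (mat_poly k e (corner k x)) * v) = tr (mat_poly k e (corner k x) * corner k v)"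
        using k v by (intro tr_pad_mult) auto
      then show ?thesis by (simp add: tr_mat_poly_mult[of _ k] T_def)
    qed
    have row: "(\<Sum>l=1..k. C k l * diff (gz k l) [x] w) = (\<Sum>l<k. C k (Suc l) * of_nat (Suc l) * T k l)"
      if "k \<le> n" for k
      using that x v unfolding w
      by (intro sum.reindex_bij_witness[of _ Suc "\<lambda>j. j - 1"]) (auto simp: diff_gz T_def)
    have "(\<Sum>k=1..n. \<Sum>l=1..k. C k l * diff (gz k l) [x] w)
      = (\<Sum>k\<in>{i, Suc i}. \<Sum>l=1..k. C k l * diff (gz k l) [x] w)"
      using i by (intro sum.mono_neutral_right) (auto simp: C_def)
    also have "\<dots> = (\<Sum>l<i. c l * T i l) + (\<Sum>l<Suc i. - d l * T (Suc i) l)"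
      using i row[of i] row[of "Suc i"] by (simp add: C_def del: of_nat_Suc sum.lessThan_Suc sum.cl_ivl_Suc)
    also have "\<dots> = (\<Sum>l<i. c l * T i l) - (\<Sum>l<Suc i. d l * T (Suc i) l)"
      by (simp add: sum_negf)
    also have "\<dots> = 0" using poly[of i c] poly[of "Suc i" d] i eq by (simp del: sum.lessThan_Suc)
    finally show ?thesis .
  qed
  then have "\<forall>k\<in>{1..n}. \<forall>l\<in>{1..k}. C k l = 0" using sr by (auto simp: strongly_regular_def)
  then have "C i (Suc j) = 0" using i j by auto
  then show ?thesis by (simp add: C_def del: of_nat_Suc)
qed

section \<open>Levi subalgebras and their centers\<close>

fun block_of :: "nat list \<Rightarrow> nat \<Rightarrow> nat" where
  "block_of [] a = 0"
| "block_of (m # ns) a = (if a < m then 0 else Suc (block_of ns (a - m)))"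

lemma block_of_mono: "a \<le> b \<Longrightarrow> block_of ns a \<le> block_of ns b"
  by (induction ns arbitrary: a b) (auto simp: diff_le_mono)

lemma diag_block_mat_carrier: "As \<in> aff ns \<Longrightarrow> diag_block_mat As \<in> carrier_mat (sum_list ns) (sum_list ns)"
proof (induction ns arbitrary: As)
  case (Cons m ns)
  then obtain A Bs where A: "As = A # Bs" "A \<in> carrier_mat m m" "Bs \<in> aff ns"
    by (cases As) (auto simp: aff_def)
  then show ?case using Cons.IH[of Bs] by (auto simp: Let_def)
qed (auto simp: aff_def)

lemma levi_carrier: "y \<in> levi ns \<Longrightarrow> y \<in> carrier_mat (sum_list ns) (sum_list ns)"
  by (auto simp: levi_def diag_block_mat_carrier)

lemma levi_Cons:
  "levi (m # ns) = {four_block_mat A (0\<^sub>m m (sum_list ns)) (0\<^sub>m (sum_list ns) m) B | A B.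
     A \<in> carrier_mat m m \<and> B \<in> levi ns}" (is "_ = ?R")
proof (intro equalityI subsetI)
  fix y assume "y \<in> levi (m # ns)"
  then obtain As where As: "As \<in> aff (m # ns)" "y = diag_block_mat As" by (auto simp: levi_def)
  then obtain A Bs where A: "As = A # Bs" "A \<in> carrier_mat m m" "Bs \<in> aff ns"
    by (cases As) (auto simp: aff_def)
  show "y \<in> ?R"
    by (rule CollectI, rule exI[of _ A], rule exI[of _ "diag_block_mat Bs"])
      (use A As(2) diag_block_mat_carrier[OF A(3)] in \<open>auto simp: Let_def levi_def\<close>)
next
  fix y assume "y \<in> ?R"
  then obtain A Bs where A: "A \<in> carrier_mat m m" "Bs \<in> aff ns"
    "y = four_block_mat A (0\<^sub>m m (sum_list ns)) (0\<^sub>m (sum_list ns) m) (diag_block_mat Bs)"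
    by (auto simp: levi_def)
  then have "y = diag_block_mat (A # Bs)" "A # Bs \<in> aff (m # ns)"
    using diag_block_mat_carrier[OF A(2)] by (auto simp: Let_def aff_def)
  then show "y \<in> levi (m # ns)" unfolding levi_def by blast
qed

lemma levi_iff:
  "y \<in> levi ns \<longleftrightarrow> y \<in> carrier_mat (sum_list ns) (sum_list ns) \<and>
     (\<forall>a<sum_list ns. \<forall>b<sum_list ns. block_of ns a \<noteq> block_of ns b \<longrightarrow> y $$ (a, b) = 0)"
proof (induction ns arbitrary: y)
  case Nil
  show ?case by (auto simp: levi_def aff_def)
next
  case (Cons m ns)
  let ?N = "sum_list ns"
  show ?case
  proof
    assume "y \<in> levi (m # ns)"
    then obtain A B where y: "y = four_block_mat A (0\<^sub>m m ?N) (0\<^sub>m ?N m) B" "A \<in> carrier_mat m m" "B \<in> levi ns"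
      by (auto simp: levi_Cons)
    note B = Cons.IH[of B, THEN iffD1, OF y(3)]
    have "y \<in> carrier_mat (m + ?N) (m + ?N)" using y B by auto
    moreover have "y $$ (a, b) = 0"
      if ab: "a < m + ?N" "b < m + ?N" "block_of (m # ns) a \<noteq> block_of (m # ns) b" for a b
      using ab y(2) B carrier_matD[OF y(2)] carrier_matD[of B ?N ?N]
      unfolding y(1) by (auto split: if_splits)
    ultimately show "y \<in> carrier_mat (sum_list (m # ns)) (sum_list (m # ns)) \<and>
      (\<forall>a<sum_list (m # ns). \<forall>b<sum_list (m # ns). block_of (m # ns) a \<noteq> block_of (m # ns) b \<longrightarrow> y $$ (a, b) = 0)"
      by simp
  next
    assume r: "y \<in> carrier_mat (sum_list (m # ns)) (sum_list (m # ns)) \<and>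
      (\<forall>a<sum_list (m # ns). \<forall>b<sum_list (m # ns). block_of (m # ns) a \<noteq> block_of (m # ns) b \<longrightarrow> y $$ (a, b) = 0)"
    define A where "A = mat m m (\<lambda>(a, b). y $$ (a, b))"
    define B where "B = mat ?N ?N (\<lambda>(a, b). y $$ (a + m, b + m))"
    have off: "y $$ (a, b) = 0" if "a < m + ?N" "b < m + ?N" "block_of (m # ns) a \<noteq> block_of (m # ns) b" for a b
      using r that by simp
    have B: "B \<in> levi ns" unfolding Cons.IH B_def using off[of "_ + m" "_ + m"] by auto
    have y: "y = four_block_mat A (0\<^sub>m m ?N) (0\<^sub>m ?N m) B"
      using r off by (intro eq_matI) (auto simp: A_def B_def)
    show "y \<in> levi (m # ns)" unfolding levi_Cons
      by (rule CollectI, rule exI[of _ A], rule exI[of _ B]) (use B y in \<open>auto simp: A_def\<close>)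
  qed
qed

lemma principal_nilpotent_carrier [simp]: "principal_nilpotent ns \<in> carrier_mat (sum_list ns) (sum_list ns)"
  by (auto simp: principal_nilpotent_def intro!: carrier_matI) (simp_all add: comp_def)

lemma principal_nilpotent_entry:
  "a < sum_list ns \<Longrightarrow> b < sum_list ns \<Longrightarrow>
    principal_nilpotent ns $$ (a, b) = of_bool (b = Suc a \<and> block_of ns a = block_of ns b)"
proof (induction ns arbitrary: a b)
  case (Cons m ns)
  let ?N = "sum_list ns"
  have P: "dim_row (principal_nilpotent ns) = ?N" "dim_col (principal_nilpotent ns) = ?N"
    using carrier_matD[OF principal_nilpotent_carrier] by auto
  have "principal_nilpotent (m # ns) =
      four_block_mat (jordan_block m 0) (0\<^sub>m m ?N) (0\<^sub>m ?N m) (principal_nilpotent ns)"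
    using P by (simp add: principal_nilpotent_def jordan_matrix_Cons comp_def)
  then show ?case using Cons P by (auto simp: not_less)
qed simp

lemma principal_nilpotent_levi: "principal_nilpotent ns \<in> levi ns"
  by (auto simp: levi_iff principal_nilpotent_entry)

definition unit_mat :: "nat \<Rightarrow> nat \<Rightarrow> nat \<Rightarrow> complex mat" where
  "unit_mat N r s = mat N N (\<lambda>(a, b). of_bool (a = r \<and> b = s))"

lemma unit_mat_carrier [simp]: "unit_mat N r s \<in> carrier_mat N N"
  by (simp add: unit_mat_def)

lemma unit_mat_mult:
  assumes "z \<in> carrier_mat N N" "r < N" "s < N" "c < N" "d < N"
  shows "(z * unit_mat N r s) $$ (c, d) = z $$ (c, r) * of_bool (d = s)"
    and "(unit_mat N r s * z) $$ (c, d) = of_bool (c = r) * z $$ (s, d)"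
proof -
  have "(z * unit_mat N r s) $$ (c, d) = (\<Sum>k<N. z $$ (c, k) * unit_mat N r s $$ (k, d))"
    using assms by (intro entry_mult) auto
  also have "\<dots> = (\<Sum>k<N. if k = r then z $$ (c, r) * of_bool (d = s) else 0)"
    using assms by (intro sum.cong) (auto simp: unit_mat_def)
  finally show "(z * unit_mat N r s) $$ (c, d) = z $$ (c, r) * of_bool (d = s)" using assms by simp
  have "(unit_mat N r s * z) $$ (c, d) = (\<Sum>k<N. unit_mat N r s $$ (c, k) * z $$ (k, d))"
    using assms by (intro entry_mult) auto
  also have "\<dots> = (\<Sum>k<N. if k = s then of_bool (c = r) * z $$ (s, d) else 0)"
    using assms by (intro sum.cong) (auto simp: unit_mat_def)
  finally show "(unit_mat N r s * z) $$ (c, d) = of_bool (c = r) * z $$ (s, d)" using assms by simp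
qed

lemma levi_center_comm: "z \<in> levi_center ns \<Longrightarrow> y \<in> levi ns \<Longrightarrow> z * y = y * z"
  unfolding levi_center_def by blast

lemma levi_center_levi: "z \<in> levi_center ns \<Longrightarrow> z \<in> levi ns"
  by (simp add: levi_center_def)

lemma levi_center_carrier: "z \<in> levi_center ns \<Longrightarrow> z \<in> carrier_mat (sum_list ns) (sum_list ns)"
  by (simp add: levi_center_def levi_carrier)

text \<open>
  Test the commutation with the matrix units in the Levi subalgebra.
\<close>

lemma levi_center_entries:
  assumes z: "z \<in> levi_center ns" and ab: "a < sum_list ns" "b < sum_list ns"
  shows "a \<noteq> b \<Longrightarrow> z $$ (a, b) = 0" "block_of ns a = block_of ns b \<Longrightarrow> z $$ (a, a) = z $$ (b, b)"
proof -
  let ?N = "sum_list ns"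
  have zc: "z \<in> carrier_mat ?N ?N" using z by (rule levi_center_carrier)
  have comm: "z $$ (c, r) * of_bool (d = s) = of_bool (c = r) * z $$ (s, d)"
    if "r < ?N" "s < ?N" "c < ?N" "d < ?N" "block_of ns r = block_of ns s" for r s c d
  proof -
    have "unit_mat ?N r s \<in> levi ns" using that by (auto simp: levi_iff unit_mat_def)
    then have "z * unit_mat ?N r s = unit_mat ?N r s * z" using z by (rule levi_center_comm[rotated])
    then show ?thesis using unit_mat_mult[OF zc that(1-4)] by simp
  qed
  show "z $$ (a, b) = 0" if "a \<noteq> b" using comm[of b b a b] that ab by simp
  show "z $$ (a, a) = z $$ (b, b)" if "block_of ns a = block_of ns b" using comm[of a b a b] that ab by simp
qed

lemma levi_center_gen_center: "z \<in> levi_center_gen ns \<Longrightarrow> z \<in> levi_center ns"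
  by (simp add: levi_center_gen_def)

text \<open>
  If two blocks had the same eigenvalue, a matrix unit joining them would commute with \<open>z\<close>.
\<close>

lemma levi_center_gen_distinct:
  assumes z: "z \<in> levi_center_gen ns" and ab: "a < sum_list ns" "b < sum_list ns"
    and "block_of ns a \<noteq> block_of ns b"
  shows "z $$ (a, a) \<noteq> z $$ (b, b)"
proof
  let ?N = "sum_list ns" and ?U = "unit_mat (sum_list ns) a b"
  assume eq: "z $$ (a, a) = z $$ (b, b)"
  have zc: "z \<in> carrier_mat ?N ?N" using z levi_center_gen_center levi_center_carrier by blast
  note d = levi_center_entries(1)[OF levi_center_gen_center[OF z]]
  have "z * ?U = ?U * z"
  proof (rule eq_matI)
    fix r s assume "r < dim_row (?U * z)" "s < dim_col (?U * z)"
    then have rs: "r < ?N" "s < ?N" using zc by (auto simp: unit_mat_def)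
    show "(z * ?U) $$ (r, s) = (?U * z) $$ (r, s)"
      unfolding unit_mat_mult[OF zc ab rs]
      using d[of r a] d[of b s] ab rs eq by (cases "r = a"; cases "s = b") auto
  qed (use zc in \<open>auto simp: unit_mat_def\<close>)
  then have "?U \<in> {y \<in> carrier_mat ?N ?N. z * y = y * z}" by simp
  moreover have "{y \<in> carrier_mat ?N ?N. z * y = y * z} = levi ns"
    using z unfolding levi_center_gen_def by blast
  ultimately have "?U \<in> levi ns" by blast
  then have "?U $$ (a, b) = 0" using assms(4) ab by (auto simp: levi_iff)
  then show False using ab by (simp add: unit_mat_def)
qed

lemma levi_center_gen_jordan_shape:
  assumes z: "z \<in> levi_center_gen ns"
  shows "z + principal_nilpotent ns =
    jordan_shape (sum_list ns) (\<lambda>a. z $$ (a, a)) (\<lambda>a. block_of ns a = block_of ns (Suc a))"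
  using levi_center_entries(1)[OF levi_center_gen_center[OF z]]
    levi_center_carrier[OF levi_center_gen_center[OF z]]
    carrier_matD[OF principal_nilpotent_carrier[of ns]]
  by (intro eq_matI) (auto simp: jordan_shape_def principal_nilpotent_entry)

lemma levi_cyclic:
  assumes z: "z \<in> levi_center_gen ns"
  shows "cyclic (sum_list ns) (z + principal_nilpotent ns)"
  unfolding levi_center_gen_jordan_shape[OF z]
proof (rule cyclic_jordan_shape)
  fix a assume "Suc a < sum_list ns" "block_of ns a = block_of ns (Suc a)"
  then show "z $$ (a, a) = z $$ (Suc a, Suc a)"
    using levi_center_entries(2)[OF levi_center_gen_center[OF z], of a "Suc a"] by simp
next
  fix a b assume ab: "a < b" "b < sum_list ns" "z $$ (a, a) = z $$ (b, b)"
  then have "block_of ns a = block_of ns b" using levi_center_gen_distinct[OF z, of a b] by auto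
  then show "block_of ns a = block_of ns (Suc a)"
    using block_of_mono[of a "Suc a" ns] block_of_mono[of "Suc a" b ns] ab by simp
qed

lemma levi_center_commutes:
  assumes "w \<in> levi_center ns" "z \<in> levi_center ns"
  shows "w * (z + principal_nilpotent ns) = (z + principal_nilpotent ns) * w"
proof -
  let ?N = "sum_list ns"
  have c: "w \<in> carrier_mat ?N ?N" "z \<in> carrier_mat ?N ?N" using assms levi_center_carrier by auto
  have "w * z = z * w" "w * principal_nilpotent ns = principal_nilpotent ns * w"
    using assms levi_center_comm[OF assms(1)] principal_nilpotent_levi[of ns] levi_center_levi by blast+
  then show ?thesis using c
    by (simp add: mult_add_distrib_mat[of _ ?N ?N _ ?N] add_mult_distrib_mat[of _ ?N ?N _ _ ?N])
qed

lemma invertible_mat_iff: "g \<in> carrier_mat n n \<Longrightarrow> invertible_mat g \<longleftrightarrow> det g \<noteq> (0 :: complex)"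
proof
  assume g: "g \<in> carrier_mat n n" "invertible_mat g"
  then obtain h where h: "g * h = 1\<^sub>m n" "h * g = 1\<^sub>m (dim_row h)" by (auto simp: invertible_mat_def inverts_mat_def)
  then have "h \<in> carrier_mat n n" using g
    by (intro carrier_matI) (metis carrier_matD(2) index_mult_mat(3) index_one_mat(3))+
  then show "det g \<noteq> 0" using mat_inv_unique(1)[OF g(1) _ h(1)] by blast
next
  assume g: "g \<in> carrier_mat n n" "det g \<noteq> 0"
  show "invertible_mat g"
    using mat_inv[OF g] g carrier_matD[OF mat_inv_carrier[OF g(1)]]
    by (auto simp: invertible_mat_def inverts_mat_def intro!: exI[of _ "mat_inv g"])
qed

text \<open>
  A matrix that commutes with the cyclic matrix \<open>z + e\<close> is a polynomial in it, and \<open>z + e\<close> commutes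
  with \<open>w + e\<close> for every \<open>w\<close> in the center. So it is enough to test one generic \<open>z\<close>.
\<close>

lemma levi_centralizer_iff:
  assumes z: "z \<in> levi_center_gen ns"
  shows "g \<in> levi_centralizer ns \<longleftrightarrow> g \<in> carrier_mat (sum_list ns) (sum_list ns) \<and> det g \<noteq> 0 \<and>
    (z + principal_nilpotent ns) * g = g * (z + principal_nilpotent ns)"
proof
  assume "g \<in> levi_centralizer ns"
  then show "g \<in> carrier_mat (sum_list ns) (sum_list ns) \<and> det g \<noteq> 0 \<and>
    (z + principal_nilpotent ns) * g = g * (z + principal_nilpotent ns)"
    using levi_center_gen_center[OF z] by (auto simp: levi_centralizer_def invertible_mat_iff)
next
  let ?N = "sum_list ns" and ?A = "z + principal_nilpotent ns"
  assume g: "g \<in> carrier_mat ?N ?N \<and> det g \<noteq> 0 \<and> ?A * g = g * ?A"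
  have A: "?A \<in> carrier_mat ?N ?N" using cyclic_carrier[OF levi_cyclic[OF z]] .
  have "g * (w + principal_nilpotent ns) = (w + principal_nilpotent ns) * g" if w: "w \<in> levi_center ns" for w
  proof -
    let ?e = "principal_nilpotent ns"
    have c: "w \<in> carrier_mat ?N ?N" "z \<in> carrier_mat ?N ?N"
      using w z levi_center_gen_center levi_center_carrier by auto
    have "z * ?e = ?e * z"
      by (rule levi_center_comm[OF levi_center_gen_center[OF z] principal_nilpotent_levi])
    then have e: "?e * ?A = ?A * ?e" using c
      by (simp add: mult_add_distrib_mat[of _ ?N ?N _ ?N] add_mult_distrib_mat[of _ ?N ?N _ _ ?N])
    have "w * ?A = ?A * w" using levi_center_commutes w z levi_center_gen_center by blast
    then have "(w + ?e) * ?A = ?A * (w + ?e)"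
      using e add_mult_distrib_mat[OF c(1) principal_nilpotent_carrier A]
        mult_add_distrib_mat[OF A c(1) principal_nilpotent_carrier] by simp
    then have "(w + ?e) * mat_poly ?N (coef ?A g) ?A = mat_poly ?N (coef ?A g) ?A * (w + ?e)"
      using c A by (intro mat_poly_intertwine[of _ ?N]) auto
    then show ?thesis using commuting_eq_mat_poly[OF levi_cyclic[OF z], of g] g by simp
  qed
  then show "g \<in> levi_centralizer ns" using g by (auto simp: levi_centralizer_def invertible_mat_iff)
qed

text \<open>
  Nondegeneracy that makes the covering infinitesimally injective. The projection to a block
  commutes with \<open>z + e\<close> and is a polynomial in it, so the traces with powers of \<open>z + e\<close> determine
  the trace of \<open>w\<close> on each block, that is, a nonzero multiple of the scalar by which \<open>w\<close> acts there.
\<close>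

lemma levi_center_trace_form:
  assumes z: "z \<in> levi_center_gen ns" and w: "w \<in> carrier_mat (sum_list ns) (sum_list ns)"
    and diag: "\<And>a b. a < sum_list ns \<Longrightarrow> b < sum_list ns \<Longrightarrow> a \<noteq> b \<Longrightarrow> w $$ (a, b) = 0"
    and const: "\<And>a b. a < sum_list ns \<Longrightarrow> b < sum_list ns \<Longrightarrow> block_of ns a = block_of ns b \<Longrightarrow> w $$ (a, a) = w $$ (b, b)"
    and tr0: "\<And>j. j < sum_list ns \<Longrightarrow> tr ((z + principal_nilpotent ns) ^\<^sub>m j * w) = 0"
  shows "w = 0\<^sub>m (sum_list ns) (sum_list ns)"
proof -
  let ?N = "sum_list ns" and ?A = "z + principal_nilpotent ns"
  note cyc = levi_cyclic[OF z]
  have w0: "w $$ (a, a) = 0" if a: "a < ?N" for a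
  proof -
    \<comment> \<open>the projection to the block of position \<open>a\<close>\<close>
    define B where "B = mat ?N ?N (\<lambda>(r, s). of_bool (r = s \<and> block_of ns r = block_of ns a) :: complex)"
    have B: "B \<in> carrier_mat ?N ?N" by (simp add: B_def)
    have row: "(B * y) $$ (r, s) = of_bool (block_of ns r = block_of ns a) * y $$ (r, s)"
      and col: "(y * B) $$ (r, s) = of_bool (block_of ns s = block_of ns a) * y $$ (r, s)"
      if "y \<in> carrier_mat ?N ?N" "r < ?N" "s < ?N" for y r s
    proof -
      have "(B * y) $$ (r, s) = (\<Sum>k<?N. B $$ (r, k) * y $$ (k, s))" using that B by (intro entry_mult) auto
      also have "\<dots> = (\<Sum>k<?N. if k = r then of_bool (block_of ns r = block_of ns a) * y $$ (r, s) else 0)"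
        using that by (intro sum.cong refl) (auto simp: B_def)
      finally show "(B * y) $$ (r, s) = of_bool (block_of ns r = block_of ns a) * y $$ (r, s)"
        using that by simp
      have "(y * B) $$ (r, s) = (\<Sum>k<?N. y $$ (r, k) * B $$ (k, s))" using that B by (intro entry_mult) auto
      also have "\<dots> = (\<Sum>k<?N. if k = s then of_bool (block_of ns s = block_of ns a) * y $$ (r, s) else 0)"
        using that by (intro sum.cong refl) (auto simp: B_def)
      finally show "(y * B) $$ (r, s) = of_bool (block_of ns s = block_of ns a) * y $$ (r, s)"
        using that by simp
    qed
    have "B * y = y * B" if y: "y \<in> levi ns" for y
    proof (rule eq_matI)
      have yc: "y \<in> carrier_mat ?N ?N" using y by (rule levi_carrier)
      fix r s assume "r < dim_row (y * B)" "s < dim_col (y * B)"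
      then have rs: "r < ?N" "s < ?N" using yc by (auto simp: B_def)
      then show "(B * y) $$ (r, s) = (y * B) $$ (r, s)"
        using row[OF yc rs] col[OF yc rs] y by (cases "block_of ns r = block_of ns s") (auto simp: levi_iff)
    qed (use levi_carrier[OF y] in \<open>auto simp: B_def\<close>)
    moreover have "B \<in> levi ns" unfolding levi_iff by (auto simp: B_def)
    ultimately have "B \<in> levi_center ns" unfolding levi_center_def by blast
    then have "B * ?A = ?A * B" using levi_center_commutes levi_center_gen_center[OF z] by blast
    then have "mat_poly ?N (coef ?A B) ?A = B" using commuting_eq_mat_poly[OF cyc B] by simp
    then have "tr (B * w) = (\<Sum>l<?N. coef ?A B l * tr (?A ^\<^sub>m l * w))"
      using tr_mat_poly_mult[OF cyclic_carrier[OF cyc] w, of ?N "coef ?A B"] by simp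
    then have "0 = tr (B * w)" using tr0 by simp
    also have "\<dots> = (\<Sum>r<?N. of_bool (block_of ns r = block_of ns a) * w $$ (r, r))"
      using row[OF w] B by (simp add: tr_def del: index_mult_mat(1))
    also have "\<dots> = (\<Sum>r\<in>{r. r < ?N \<and> block_of ns r = block_of ns a}. w $$ (a, a))"
      using const[OF _ a] by (intro sum.mono_neutral_cong_right) auto
    also have "\<dots> = of_nat (card {r. r < ?N \<and> block_of ns r = block_of ns a}) * w $$ (a, a)" by simp
    finally show "w $$ (a, a) = 0" using a by auto
  qed
  show ?thesis
  proof (rule eq_matI)
    fix a b assume "a < dim_row (0\<^sub>m ?N ?N :: complex mat)" "b < dim_col (0\<^sub>m ?N ?N :: complex mat)"
    then show "w $$ (a, b) = 0\<^sub>m ?N ?N $$ (a, b)" using w0[of a] diag[of a b] by (cases "a = b") auto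
  qed (use w in auto)
qed

section \<open>Conjugation by a product of invertible matrices of growing size\<close>

primrec gprod :: "nat \<Rightarrow> (nat \<Rightarrow> complex mat) \<Rightarrow> nat \<Rightarrow> complex mat" where
  "gprod n \<gamma> 0 = 1\<^sub>m n"
| "gprod n \<gamma> (Suc r) = gprod n \<gamma> r * extend_by_one n (\<gamma> (Suc r))"

definition inv_family :: "nat \<Rightarrow> (nat \<Rightarrow> complex mat) \<Rightarrow> bool" where
  "inv_family r \<gamma> \<longleftrightarrow> (\<forall>i. 1 \<le> i \<longrightarrow> i \<le> r \<longrightarrow> \<gamma> i \<in> carrier_mat i i \<and> det (\<gamma> i) \<noteq> 0)"

lemma inv_familyD: "inv_family r \<gamma> \<Longrightarrow> 1 \<le> i \<Longrightarrow> i \<le> r \<Longrightarrow> \<gamma> i \<in> carrier_mat i i"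
  "inv_family r \<gamma> \<Longrightarrow> 1 \<le> i \<Longrightarrow> i \<le> r \<Longrightarrow> det (\<gamma> i) \<noteq> 0"
  by (auto simp: inv_family_def)

lemma inv_family_le: "inv_family r \<gamma> \<Longrightarrow> s \<le> r \<Longrightarrow> inv_family s \<gamma>"
  by (auto simp: inv_family_def)

lemma gprod_carrier [simp]: "gprod n \<gamma> r \<in> carrier_mat n n"
  by (induction r) auto

lemma gprod_cong: "(\<And>i. 1 \<le> i \<Longrightarrow> i \<le> r \<Longrightarrow> \<gamma> i = \<delta> i) \<Longrightarrow> gprod n \<gamma> r = gprod n \<delta> r"
  by (induction r) auto

lemma gprod_ones: "(\<And>i. 1 \<le> i \<Longrightarrow> i \<le> r \<Longrightarrow> \<gamma> i = 1\<^sub>m i) \<Longrightarrow> r \<le> n \<Longrightarrow> gprod n \<gamma> r = 1\<^sub>m n"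
  by (induction r) auto

lemma det_gprod: "inv_family r \<gamma> \<Longrightarrow> r \<le> n \<Longrightarrow> det (gprod n \<gamma> r) \<noteq> 0"
proof (induction r)
  case (Suc r)
  then have "det (gprod n \<gamma> r) \<noteq> 0" using inv_family_le[OF Suc.prems(1), of r] by simp
  moreover have "det (extend_by_one n (\<gamma> (Suc r))) \<noteq> 0"
    using inv_familyD[OF Suc.prems(1), of "Suc r"] Suc.prems(2) by (intro det_extend(1)) auto
  ultimately show ?case by (simp add: det_mult[of _ n])
qed simp

lemma extend_gprod:
  "inv_family r \<gamma> \<Longrightarrow> r \<le> k \<Longrightarrow> k \<le> n \<Longrightarrow> extend_by_one n (gprod k \<gamma> r) = gprod n \<gamma> r"
proof (induction r)
  case (Suc r)
  have g: "\<gamma> (Suc r) \<in> carrier_mat (Suc r) (Suc r)" using inv_familyD[OF Suc.prems(1), of "Suc r"] by simp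
  have "inv_family r \<gamma>" using Suc.prems(1) by (rule inv_family_le) simp
  then show ?case using Suc g
    by (simp add: extend_mult[of _ k] extend_extend[of _ "Suc r"])
qed simp

lemma extend_conjugate:
  assumes "P \<in> carrier_mat i i" "det P \<noteq> 0" "A \<in> carrier_mat i i" "i \<le> n"
  shows "extend_by_one n (conj_by P A) = conj_by (extend_by_one n P) (extend_by_one n A)"
  using assms det_extend(2)[OF assms(1,2,4)]
  by (simp add: conj_by_def extend_mult[of _ i])

lemma corner_conjugate_gprod:
  assumes "inv_family r \<gamma>" "r \<le> k" "k \<le> n" "y \<in> carrier_mat n n"
  shows "corner k (conj_by (gprod n \<gamma> r) y) = conj_by (gprod k \<gamma> r) (corner k y)"
proof -
  let ?G = "gprod n \<gamma> r" and ?H = "gprod k \<gamma> r" and ?W = "conj_by (gprod n \<gamma> r) y"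
  have dG: "det ?G \<noteq> 0" "det ?H \<noteq> 0" using det_gprod[OF assms(1)] assms(2,3) by auto
  have "?G * y = ?W * ?G" using conjugate_iff[OF _ dG(1) assms(4), of ?W] assms(4) by auto
  then have "extend_by_one n ?H * y = ?W * extend_by_one n ?H" using assms by (simp add: extend_gprod)
  then have "corner k (extend_by_one n ?H * y) = corner k (?W * extend_by_one n ?H)" by simp
  then have "?H * corner k y = corner k ?W * ?H"
    using corner_extend_mult[of ?H k y n k] corner_extend_mult[of ?H k ?W n k] assms by simp
  then show ?thesis using conjugate_iff[OF gprod_carrier dG(2), of "corner k y" "corner k ?W"] by simp
qed

lemma conjugate_one: "y \<in> carrier_mat n n \<Longrightarrow> conj_by (1\<^sub>m n) y = y"
  using conjugate_iff[of "1\<^sub>m n" n y y] by simp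

lemma conjugate_commuting:
  "M \<in> carrier_mat n n \<Longrightarrow> det M \<noteq> 0 \<Longrightarrow> y \<in> carrier_mat n n \<Longrightarrow> M * y = y * M \<Longrightarrow> conj_by M y = y"
  using conjugate_iff[of M n y y] by simp

text \<open>
  The factor of size \<open>r\<close> fixes the corner of size \<open>r\<close>, hence all smaller corners. In
  the conjugation by the product the larger factors are applied first.
\<close>

lemma corner_conjugate_commuting:
  assumes "inv_family r \<gamma>" "r \<le> n" "y \<in> carrier_mat n n" "k \<le> n"
    and "\<And>i. 1 \<le> i \<Longrightarrow> i \<le> r \<Longrightarrow> \<gamma> i * corner i y = corner i y * \<gamma> i"
  shows "corner k (conj_by (gprod n \<gamma> r) y) = conj_by (gprod k \<gamma> (min r (k - 1))) (corner k y)"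
  using assms(1-3,5)
proof (induction r arbitrary: y)
  case 0
  then show ?case by (simp add: conjugate_one)
next
  case (Suc r)
  have fam: "inv_family r \<gamma>" using Suc.prems(1) by (rule inv_family_le) simp
  let ?g = "\<gamma> (Suc r)" and ?y = "conj_by (extend_by_one n (\<gamma> (Suc r))) y"
  have g: "?g \<in> carrier_mat (Suc r) (Suc r)" "det ?g \<noteq> 0" using inv_familyD[OF Suc.prems(1), of "Suc r"] by auto
  have dg: "det (extend_by_one n ?g) \<noteq> 0" using g Suc.prems by (intro det_extend(1)) auto
  have y: "?y \<in> carrier_mat n n" using Suc.prems by simp
  have "conj_by (gprod n \<gamma> (Suc r)) y = conj_by (gprod n \<gamma> r) ?y"
    using Suc.prems det_gprod[OF fam, of n] dg by (simp add: conjugate_mult[of _ n])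
  moreover have "corner (Suc r) ?y = corner (Suc r) y"
  proof -
    have "extend_by_one n ?g * y = ?y * extend_by_one n ?g" using conjugate_iff[OF _ dg Suc.prems(3), of ?y] y by auto
    then have "corner (Suc r) (extend_by_one n ?g * y) = corner (Suc r) (?y * extend_by_one n ?g)" by simp
    then have "?g * corner (Suc r) y = corner (Suc r) ?y * ?g"
      using corner_extend_mult[OF g(1), of y n "Suc r"] corner_extend_mult[OF g(1), of ?y n "Suc r"]
        Suc.prems y g by simp
    then show ?thesis
      using conjugate_iff[OF g, of "corner (Suc r) y" "corner (Suc r) ?y"]
        conjugate_commuting[OF g, of "corner (Suc r) y"] Suc.prems(4)[of "Suc r"] by simp
  qed
  then have low: "corner i ?y = corner i y" if "i \<le> Suc r" for i
    using that by (metis corner_corner)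
  ultimately show ?case
  proof (cases "k \<le> Suc r")
    case True
    have "corner k (conj_by (gprod n \<gamma> r) ?y) = conj_by (gprod k \<gamma> (min r (k - 1))) (corner k ?y)"
      using Suc.prems fam y low by (intro Suc.IH) auto
    moreover have "min (Suc r) (k - 1) = min r (k - 1)" using True by simp
    ultimately show ?thesis
      using True low[of k] \<open>conj_by (gprod n \<gamma> (Suc r)) y = _\<close> by (simp only:)
  next
    case False
    then have "min (Suc r) (k - 1) = Suc r" by simp
    then show ?thesis
      using corner_conjugate_gprod[OF Suc.prems(1), of k n y] assms(4) Suc.prems(3) False by simp
  qed
qed

text \<open>
  This is what makes the action multiplicative: after \<open>\<gamma>'\<close> has acted, the \<open>i\<close>-th factor of \<open>\<gamma>\<close> has
  been conjugated by the first \<open>i - 1\<close> factors of \<open>\<gamma>'\<close>.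
\<close>

lemma gprod_twisted_mult:
  assumes "inv_family r \<gamma>" "inv_family r \<gamma>'" "r \<le> n"
  shows "gprod n (\<lambda>i. conj_by (gprod i \<gamma>' (i - 1)) (\<gamma> i)) r * gprod n \<gamma>' r = gprod n (\<lambda>i. \<gamma> i * \<gamma>' i) r"
  using assms
proof (induction r)
  case (Suc r)
  let ?\<delta> = "\<lambda>i. conj_by (gprod i \<gamma>' (i - 1)) (\<gamma> i)"
  have fam: "inv_family r \<gamma>" "inv_family r \<gamma>'" using Suc.prems by (auto intro: inv_family_le)
  let ?R = "gprod n \<gamma>' r" and ?g = "extend_by_one n (\<gamma> (Suc r))" and ?g' = "extend_by_one n (\<gamma>' (Suc r))"
  have c: "\<gamma> (Suc r) \<in> carrier_mat (Suc r) (Suc r)" "\<gamma>' (Suc r) \<in> carrier_mat (Suc r) (Suc r)"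
    using inv_familyD[OF Suc.prems(1), of "Suc r"] inv_familyD[OF Suc.prems(2), of "Suc r"] by auto
  have e: "extend_by_one n (?\<delta> (Suc r)) = conj_by ?R ?g"
    using extend_conjugate[of "gprod (Suc r) \<gamma>' r" "Suc r" "\<gamma> (Suc r)" n] det_gprod[OF fam(2), of "Suc r"]
      extend_gprod[OF fam(2), of "Suc r" n] Suc.prems c by simp
  have R: "conj_by ?R ?g * ?R = ?R * ?g"
    using conjugate_iff[of ?R n ?g "conj_by ?R ?g"] det_gprod[OF fam(2), of n] Suc.prems by auto
  have "gprod n ?\<delta> (Suc r) * gprod n \<gamma>' (Suc r) = gprod n ?\<delta> r * ((conj_by ?R ?g * ?R) * ?g')"
    by (simp add: e[simplified] assoc_sq[of _ n])
  also have "\<dots> = (gprod n ?\<delta> r * ?R) * (?g * ?g')"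
    unfolding R by (simp add: assoc_sq[of _ n])
  also have "\<dots> = gprod n (\<lambda>i. \<gamma> i * \<gamma>' i) (Suc r)"
    using Suc.IH[OF fam] Suc.prems c by (simp add: extend_mult[of _ "Suc r"])
  finally show ?case .
qed simp

lemma (in function_algebra) mat_in_gprod:
  assumes "\<And>i. 1 \<le> i \<Longrightarrow> i \<le> r \<Longrightarrow> mat_in i i (\<lambda>q. \<gamma> q i)"
  shows "mat_in n n (\<lambda>q. gprod n (\<gamma> q) r)"
  using assms
  by (induction r) (auto intro!: mat_in_const mat_in_mult[of n n] mat_in_extend)

lemma (in function_algebra_inverse) mat_in_conjugate_gprod:
  assumes "\<And>i. 1 \<le> i \<Longrightarrow> i \<le> r \<Longrightarrow> mat_in i i (\<lambda>q. \<gamma> q i)" "r \<le> n"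
    and "eventually (\<lambda>q. inv_family r (\<gamma> q)) Fl" "mat_in n n X"
  shows "mat_in n n (\<lambda>q. conj_by (gprod n (\<gamma> q) r) (X q))"
proof -
  have "eventually (\<lambda>q. det (gprod n (\<gamma> q) r) \<noteq> 0) Fl"
    using assms(3) by eventually_elim (rule det_gprod[OF _ assms(2)])
  then show ?thesis unfolding conj_by_def
    by (intro mat_in_mult[of n n] mat_in_mat_inv mat_in_gprod assms(1,4))
qed

lemma has_mat_deriv_gprod:
  assumes "\<And>i. 1 \<le> i \<Longrightarrow> i \<le> r \<Longrightarrow> has_mat_deriv i (\<lambda>t. \<gamma> t i) (y i)"
    and "\<And>i. 1 \<le> i \<Longrightarrow> i \<le> r \<Longrightarrow> \<gamma> 0 i = 1\<^sub>m i" and "r \<le> n"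
  shows "has_mat_deriv n (\<lambda>t. gprod n (\<gamma> t) r) (mat n n (\<lambda>(a, b). \<Sum>i=1..r. pad n (y i) $$ (a, b)))"
  using assms
proof (induction r)
  case 0
  have z: "mat n n (\<lambda>(a, b). \<Sum>i=1..0. pad n (y i) $$ (a, b)) = 0\<^sub>m n n" by (intro eq_matI) auto
  show ?case unfolding z gprod.simps(1) by (rule has_mat_deriv_const[OF one_carrier_mat])
next
  case (Suc r)
  let ?D = "\<lambda>r. mat n n (\<lambda>(a, b). \<Sum>i=1..r. pad n (y i) $$ (a, b))"
  have "has_mat_deriv n (\<lambda>t. gprod n (\<gamma> t) r * extend_by_one n (\<gamma> t (Suc r)))
      (?D r * extend_by_one n (\<gamma> 0 (Suc r)) + gprod n (\<gamma> 0) r * pad n (y (Suc r)))"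
    by (intro has_mat_deriv_mult Suc.IH has_mat_deriv_extend[of "Suc r"]) (use Suc.prems in auto)
  also have "gprod n (\<gamma> 0) r = 1\<^sub>m n" using Suc.prems by (intro gprod_ones) auto
  also have "extend_by_one n (\<gamma> 0 (Suc r)) = 1\<^sub>m n" using Suc.prems by simp
  also have "?D r * 1\<^sub>m n + 1\<^sub>m n * pad n (y (Suc r)) = ?D (Suc r)" by (intro eq_matI) auto
  finally show ?case unfolding gprod.simps(2) .
qed

section \<open>Transport of centralizers\<close>

lemma similar_mat_iff:
  fixes x A :: "complex mat"
  assumes "x \<in> carrier_mat n n"
  shows "similar_mat x A \<longleftrightarrow> A \<in> carrier_mat n n \<and> (\<exists>G\<in>carrier_mat n n. det G \<noteq> 0 \<and> G * A = x * G)"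
proof
  assume "similar_mat x A"
  from similar_matD[OF this] obtain m P Q where w: "{x, A, P, Q} \<subseteq> carrier_mat m m"
    "P * Q = 1\<^sub>m m" "Q * P = 1\<^sub>m m" "x = P * A * Q" by (elim exE conjE)
  have mn: "m = n" using assms w(1) by auto
  note w = w[unfolded mn]
  have c: "A \<in> carrier_mat n n" "P \<in> carrier_mat n n" "Q \<in> carrier_mat n n" using w(1) by auto
  have "x * P = P * A * Q * P" using w(4) by simp
  also have "\<dots> = P * A * (Q * P)" by (rule assoc_sq[of _ n]) (use c in auto)
  also have "\<dots> = P * A" using c w(3) by simp
  finally show "A \<in> carrier_mat n n \<and> (\<exists>G\<in>carrier_mat n n. det G \<noteq> 0 \<and> G * A = x * G)"
    using c mat_inv_unique(1)[OF c(2,3) w(2)] by (intro conjI bexI[of _ P]) simp_all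
next
  assume "A \<in> carrier_mat n n \<and> (\<exists>G\<in>carrier_mat n n. det G \<noteq> 0 \<and> G * A = x * G)"
  then obtain G where G: "A \<in> carrier_mat n n" "G \<in> carrier_mat n n" "det G \<noteq> 0" "G * A = x * G" by blast
  then have "conj_by G A = x" using conjugate_iff[of G n A x] assms by simp
  then show "similar_mat x A"
    using G assms mat_inv[OF G(2,3)] by (intro similar_matI[of _ _ G "mat_inv G" n]) (auto simp: conj_by_def)
qed

text \<open>
  For \<open>A = z\<^sub>i + e\<^sup>i\<close> and \<open>x = x\<^sub>i\<close>, the image of \<open>k\<close> under any conjugation that takes \<open>A\<close> to
  \<open>x\<close>. The formula by a polynomial needs no choice of the conjugating element and is regular.
\<close>

definition transport :: "complex mat \<Rightarrow> complex mat \<Rightarrow> complex mat \<Rightarrow> complex mat" where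
  "transport A k x = mat_poly (dim_row A) (coef A k) x"

lemma transport_carrier [simp]: "x \<in> carrier_mat n n \<Longrightarrow> transport A k x \<in> carrier_mat n n"
  by (simp add: transport_def)

lemma transport_commute: "x \<in> carrier_mat n n \<Longrightarrow> transport A k x * x = x * transport A k x"
  by (simp add: transport_def mat_poly_commute)

lemma transport_intertwine:
  assumes "cyclic n A" "k \<in> carrier_mat n n" "A * k = k * A"
    and "x \<in> carrier_mat n n" "G \<in> carrier_mat n n" "G * A = x * G"
  shows "transport A k x * G = G * k"
proof -
  have A: "A \<in> carrier_mat n n" using assms(1) by (rule cyclic_carrier)
  have "G * mat_poly n (coef A k) A = mat_poly n (coef A k) x * G"
    using A assms by (intro mat_poly_intertwine[of _ n]) auto
  then show ?thesis using A by (simp add: transport_def commuting_eq_mat_poly[OF assms(1-3)])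
qed

lemma transport_conjugate:
  assumes "x \<in> carrier_mat n n" "P \<in> carrier_mat n n" "det P \<noteq> 0"
  shows "transport A k (conj_by P x) = conj_by P (transport A k x)"
proof -
  have "P * x = conj_by P x * P" using conjugate_iff[of P n x "conj_by P x"] assms by auto
  then have "P * transport A k x = transport A k (conj_by P x) * P"
    unfolding transport_def using assms by (intro mat_poly_intertwine[of _ n]) auto
  then show ?thesis
    using conjugate_iff[of P n "transport A k x" "transport A k (conj_by P x)"] assms by simp
qed

lemma transport_eq_conjugate:
  assumes "cyclic n A" "k \<in> carrier_mat n n" "A * k = k * A"
    and "x \<in> carrier_mat n n" "G \<in> carrier_mat n n" "det G \<noteq> 0" "G * A = x * G"
  shows "transport A k x = conj_by G k"
  using transport_intertwine[OF assms(1-5,7)] conjugate_iff[of G n k "transport A k x"] assms by simp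

lemma commute_mult:
  assumes "A \<in> carrier_mat n n" "k \<in> carrier_mat n n" "l \<in> carrier_mat n n" "A * k = k * A" "A * l = l * (A :: complex mat)"
  shows "A * (k * l) = (k * l) * A"
proof -
  have "A * (k * l) = (A * k) * l" using assms(1-3) by (simp add: assoc_sq[of _ n])
  also have "\<dots> = k * (A * l)" unfolding assms(4) using assms(1-3) by (simp add: assoc_sq[of _ n])
  also have "\<dots> = (k * l) * A" unfolding assms(5) using assms(1-3) by (simp add: assoc_sq[of _ n])
  finally show ?thesis .
qed

lemma transport_mult:
  assumes "cyclic n A" "x \<in> carrier_mat n n" "similar_mat x A"
    and "k \<in> carrier_mat n n" "A * k = k * A" "l \<in> carrier_mat n n" "A * l = l * A"
  shows "transport A (k * l) x = transport A k x * transport A l x"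
proof -
  have A: "A \<in> carrier_mat n n" using assms(1) by (rule cyclic_carrier)
  obtain G where G: "G \<in> carrier_mat n n" "det G \<noteq> 0" "G * A = x * G"
    using assms(3) similar_mat_iff[OF assms(2)] by blast
  note c = transport_carrier[OF assms(2), of A] G(1) assms(4,6)
  have "(transport A k x * transport A l x) * G = transport A k x * (transport A l x * G)"
    using c by (simp add: assoc_sq[of _ n])
  also have "\<dots> = (transport A k x * G) * l"
    unfolding transport_intertwine[OF assms(1,6,7,2) G(1,3)] using c by (simp add: assoc_sq[of _ n])
  also have "\<dots> = G * (k * l)"
    unfolding transport_intertwine[OF assms(1,4,5,2) G(1,3)] using c by (simp add: assoc_sq[of _ n])
  finally have "conj_by G (k * l) = transport A k x * transport A l x"
    using conjugate_iff[of G n "k * l"] c G(2) by simp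
  moreover have "transport A (k * l) x = conj_by G (k * l)"
    by (rule transport_eq_conjugate[OF assms(1) _ commute_mult[OF A assms(4,6,5,7)] assms(2) G]) (use c in simp)
  ultimately show ?thesis by simp
qed

lemma transport_eq_one_iff:
  assumes "cyclic n A" "x \<in> carrier_mat n n" "similar_mat x A" "k \<in> carrier_mat n n" "A * k = k * A"
  shows "transport A k x = 1\<^sub>m n \<longleftrightarrow> k = 1\<^sub>m n"
proof -
  obtain G where G: "G \<in> carrier_mat n n" "det G \<noteq> 0" "G * A = x * G"
    using assms(3) similar_mat_iff[OF assms(2)] by blast
  have t: "transport A k x * G = G * k" by (rule transport_intertwine[OF assms(1,4,5,2) G(1,3)])
  have "mat_inv G * (transport A k x * G) = k" unfolding t by (rule mat_cancel_left(1)[OF G(1,2) assms(4)])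
  moreover have "transport A k x = conj_by G k" by (rule transport_eq_conjugate[OF assms(1,4,5,2) G])
  moreover have "conj_by G (1\<^sub>m n) = 1\<^sub>m n" using conjugate_iff[of G n "1\<^sub>m n" "1\<^sub>m n"] G by simp
  ultimately show ?thesis using mat_inv[OF G(1,2)] G(1) by auto
qed

lemma det_transport:
  assumes "cyclic n A" "x \<in> carrier_mat n n" "similar_mat x A" "k \<in> carrier_mat n n" "A * k = k * A" "det k \<noteq> 0"
  shows "det (transport A k x) \<noteq> 0"
proof -
  obtain G where G: "G \<in> carrier_mat n n" "det G \<noteq> 0" "G * A = x * G"
    using assms(3) similar_mat_iff[OF assms(2)] by blast
  have t: "transport A k x * G = G * k" by (rule transport_intertwine[OF assms(1,4,5,2) G(1,3)])
  then have "det (transport A k x * G) = det (G * k)" by simp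
  then have "det (transport A k x) * det G = det G * det k"
    unfolding det_mult[OF transport_carrier[OF assms(2)] G(1)] det_mult[OF G(1) assms(4)] .
  then show ?thesis using G assms(6) by auto
qed

lemma transport_line:
  assumes "cyclic n A" "x \<in> carrier_mat n n" "similar_mat x A" "Y \<in> carrier_mat n n"
  shows "transport A (1\<^sub>m n + t \<cdot>\<^sub>m Y) x = 1\<^sub>m n + t \<cdot>\<^sub>m transport A Y x"
proof -
  have A: "A \<in> carrier_mat n n" using assms(1) by (rule cyclic_carrier)
  have one: "transport A (1\<^sub>m n) x = 1\<^sub>m n" using transport_eq_one_iff[OF assms(1-3), of "1\<^sub>m n"] A by simp
  have c: "coef A (1\<^sub>m n + t \<cdot>\<^sub>m Y) j = coef A (1\<^sub>m n) j + t * coef A Y j" for j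
    using A assms(4) by (simp add: coef_add[of _ n] coef_smult[of _ n])
  have "transport A (1\<^sub>m n + t \<cdot>\<^sub>m Y) x = transport A (1\<^sub>m n) x + t \<cdot>\<^sub>m transport A Y x"
    using A assms(2) by (intro eq_matI)
      (auto simp: transport_def mat_poly_def c sum.distrib distrib_right sum_distrib_left mult.assoc)
  then show ?thesis by (simp only: one)
qed

text \<open>
  Pull \<open>B\<close> back to a matrix that commutes with \<open>A\<close>, and transport it.
\<close>

lemma commuting_eq_transport:
  assumes "cyclic n A" "x \<in> carrier_mat n n" "similar_mat x A" "B \<in> carrier_mat n n" "x * B = B * x"
  obtains c where "B = mat_poly n c x"
proof -
  have A: "A \<in> carrier_mat n n" using assms(1) by (rule cyclic_carrier)
  obtain G where G: "G \<in> carrier_mat n n" "det G \<noteq> 0" "G * A = x * G"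
    using assms(3) similar_mat_iff[OF assms(2)] by blast
  let ?H = "mat_inv G"
  define k where "k = ?H * B * G"
  have H: "?H \<in> carrier_mat n n" using G by auto
  have k: "k \<in> carrier_mat n n" using G H assms by (simp add: k_def)
  have Gk: "G * k = B * G"
    using mat_cancel_left(2)[OF G(1,2), of "B * G"] assms G H by (simp add: k_def assoc_sq[of _ n])
  have "G * (A * k) = (G * A) * k" using G(1) A k by (simp add: assoc_sq[of _ n])
  also have "\<dots> = x * (G * k)" unfolding G(3) using G(1) assms(2) k by (simp add: assoc_sq[of _ n])
  also have "\<dots> = (x * B) * G" unfolding Gk using G(1) assms(2,4) by (simp add: assoc_sq[of _ n])
  also have "\<dots> = B * (x * G)" unfolding assms(5) using G(1) assms(2,4) by (simp add: assoc_sq[of _ n])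
  also have "\<dots> = (B * G) * A" unfolding G(3)[symmetric] using G(1) A assms(4) by (simp add: assoc_sq[of _ n])
  also have "\<dots> = G * (k * A)" unfolding Gk[symmetric] using G(1) A k by (simp add: assoc_sq[of _ n])
  finally have "?H * (G * (A * k)) = ?H * (G * (k * A))" by simp
  then have comm: "A * k = k * A"
    using mat_cancel_left(1)[OF G(1,2), of "A * k"] mat_cancel_left(1)[OF G(1,2), of "k * A"] A k by simp
  have "transport A k x = conj_by G k" by (rule transport_eq_conjugate[OF assms(1) k comm assms(2) G])
  also have "\<dots> = B" using conjugate_iff[OF G(1,2) k assms(4)] Gk by simp
  finally show ?thesis using that A unfolding transport_def by auto
qed

section \<open>Invariance of strong regularity, and freeness\<close>

lemma tr_pow_conjugate:
  assumes "M \<in> carrier_mat n n" "det M \<noteq> 0" "y \<in> carrier_mat n n"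
  shows "tr (conj_by M y ^\<^sub>m j) = tr (y ^\<^sub>m j)"
proof -
  let ?w = "conj_by M y"
  have w: "?w \<in> carrier_mat n n" using assms by simp
  have "M * y = ?w * M" using conjugate_iff[OF assms, of ?w] w by simp
  then have "M * y ^\<^sub>m j = ?w ^\<^sub>m j * M" using assms w by (intro pow_intertwine[of _ n])
  then have "conj_by M (y ^\<^sub>m j) = ?w ^\<^sub>m j" using conjugate_iff[of M n "y ^\<^sub>m j" "?w ^\<^sub>m j"] assms w by simp
  then have "tr (?w ^\<^sub>m j) = tr ((M * y ^\<^sub>m j) * mat_inv M)" by (simp add: conj_by_def)
  also have "\<dots> = tr (mat_inv M * (M * y ^\<^sub>m j))" using assms by (intro tr_comm[of _ n n]) auto
  also have "\<dots> = tr (y ^\<^sub>m j)" using mat_cancel_left(1)[OF assms(1,2), of "y ^\<^sub>m j"] assms by simp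
  finally show ?thesis .
qed

lemma field_differentiable_eventually_nz:
  fixes f :: "complex \<Rightarrow> complex"
  assumes "f field_differentiable at 0" "f 0 \<noteq> 0"
  shows "eventually (\<lambda>t. f t \<noteq> 0) (nhds 0)"
proof -
  have "isCont f 0" using assms(1) by (rule field_differentiable_imp_continuous_at)
  then have "(f \<longlongrightarrow> f 0) (nhds 0)" using tendsto_at_iff_tendsto_nhds[of f 0] by (simp add: isCont_def)
  then show ?thesis using assms(2) by (rule tendsto_imp_eventually_ne)
qed

lemma dif_line:
  assumes "x \<in> carrier_mat n n" "v \<in> carrier_mat n n"
  shows "dif.mat_in n n (\<lambda>t. x + t \<cdot>\<^sub>m v)"
  using has_mat_derivD[OF has_mat_deriv_line[OF assms]]
  by (intro dif.mat_inI) (auto simp: field_differentiable_def)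

lemma dif_inv_family:
  assumes "\<And>i. 1 \<le> i \<Longrightarrow> i \<le> r \<Longrightarrow> dif.mat_in i i (\<lambda>t. \<gamma> t i)" "inv_family r (\<gamma> 0)"
    and "\<And>t i. 1 \<le> i \<Longrightarrow> i \<le> r \<Longrightarrow> \<gamma> t i \<in> carrier_mat i i"
  shows "eventually (\<lambda>t. inv_family r (\<gamma> t)) (nhds 0)"
proof -
  have "eventually (\<lambda>t. \<forall>i\<in>{1..r}. det (\<gamma> t i) \<noteq> 0) (nhds 0)"
    using assms(2) dif.in_det[OF assms(1)]
    by (intro eventually_ball_finite ballI field_differentiable_eventually_nz) (auto simp: inv_family_def)
  then show ?thesis by eventually_elim (use assms(3) in \<open>auto simp: inv_family_def\<close>)
qed

lemma dif_mat_deriv: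
  assumes "dif.mat_in n n W" "\<And>t. W t \<in> carrier_mat n n"
  obtains W' where "has_mat_deriv n W W'"
proof
  show "has_mat_deriv n W (mat n n (\<lambda>(a, b). deriv (\<lambda>t. W t $$ (a, b)) 0))"
    using dif.mat_inD(2)[OF assms(1)] assms(2)
    by (auto simp: has_mat_deriv_def intro: field_differentiable_derivI)
qed

text \<open>
  With the coefficients of the polynomials held fixed, the conjugation becomes a map defined near
  \<open>x\<close> that preserves all functions \<open>f\<^sub>i\<^sub>j\<close>. Its differential relates the differentials of \<open>f\<^sub>i\<^sub>j\<close> at
  \<open>x\<close> to those at the image.
\<close>

lemma strongly_regular_conjugate:
  assumes sr: "strongly_regular n x"
    and fam: "inv_family (n - 1) (\<lambda>i. mat_poly i (c i) (corner i x))"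
  shows "strongly_regular n (conj_by (gprod n (\<lambda>i. mat_poly i (c i) (corner i x)) (n - 1)) x)"
proof -
  have x: "x \<in> carrier_mat n n" using sr by (simp add: strongly_regular_def)
  define \<gamma> where "\<gamma> y i = mat_poly i (c i) (corner i y)" for y and i :: nat
  define \<Phi> where "\<Phi> y = conj_by (gprod n (\<gamma> y) (n - 1)) y" for y
  have "strongly_regular n (\<Phi> x)"
  proof (rule strongly_regular_transfer[OF sr])
    show \<Phi>x: "\<Phi> x \<in> carrier_mat n n" using x by (simp add: \<Phi>_def)
    fix v :: "complex mat" assume v: "v \<in> carrier_mat n n"
    let ?y = "\<lambda>t. x + t \<cdot>\<^sub>m v"
    have y: "?y t \<in> carrier_mat n n" for t using x v by simp
    have y0: "?y 0 = x" using x v by (intro eq_matI) auto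
    have gd: "dif.mat_in i i (\<lambda>t. \<gamma> (?y t) i)" if "1 \<le> i" "i \<le> n - 1" for i
      unfolding \<gamma>_def using that
      by (intro dif.mat_in_mat_poly dif.mat_in_corner[of n] dif_line x v dif.const) auto
    have ev: "eventually (\<lambda>t. inv_family (n - 1) (\<gamma> (?y t))) (nhds 0)"
      using gd by (rule dif_inv_family) (use fam y0 in \<open>auto simp: \<gamma>_def\<close>)
    have "dif.mat_in n n (\<lambda>t. \<Phi> (?y t))"
      unfolding \<Phi>_def using gd ev by (intro dif.mat_in_conjugate_gprod dif_line x v) auto
    then obtain v' where v': "has_mat_deriv n (\<lambda>t. \<Phi> (?y t)) v'"
      by (rule dif_mat_deriv) (use y in \<open>auto simp: \<Phi>_def\<close>)
    have tr_inv: "gz i j [\<Phi> y] = gz i j [y]"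
      if "y \<in> carrier_mat n n" "inv_family (n - 1) (\<gamma> y)" "i \<le> n" for y i j
    proof -
      let ?P = "gprod i (\<gamma> y) (min (n - 1) (i - 1))"
      have "corner i (\<Phi> y) = conj_by ?P (corner i y)"
        unfolding \<Phi>_def using that mat_poly_commute[OF corner_carrier]
        by (intro corner_conjugate_commuting) (auto simp: \<gamma>_def)
      moreover have "det ?P \<noteq> 0" using that by (intro det_gprod inv_family_le[OF that(2)]) auto
      ultimately show ?thesis by (simp add: gz_def tr_pow_conjugate[of _ i])
    qed
    have "diff (gz i j) [\<Phi> x] [v'] = diff (gz i j) [x] [v]" if i: "i \<le> n" for i j
    proof (rule DERIV_unique)
      have "has_tangent [n] (\<lambda>t. [\<Phi> (?y t)]) [v']"
        using has_mat_derivD(3)[OF v'] by (auto simp: has_tangent_def)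
      then show "((\<lambda>t. gz i j [\<Phi> (?y t)]) has_field_derivative diff (gz i j) [\<Phi> x] [v']) (at 0)"
        using poly_fun_chain[OF gz_poly[OF i], of "\<lambda>t. [\<Phi> (?y t)]" "[v']" j] \<Phi>x has_mat_derivD(2)[OF v']
        by (simp add: y0)
      have "eventually (\<lambda>t. gz i j [\<Phi> (?y t)] = gz i j [?y t]) (nhds 0)"
        using ev by eventually_elim (rule tr_inv[OF y _ i])
      from DERIV_cong_ev[OF refl this refl]
      show "((\<lambda>t. gz i j [\<Phi> (?y t)]) has_field_derivative diff (gz i j) [x] [v]) (at 0)"
        using poly_fun_line[OF gz_poly[OF i], of "[x]" "[v]" j] x v by (simp add: line_single)
    qed
    then show "\<exists>v'\<in>carrier_mat n n. \<forall>i\<le>n. \<forall>j. diff (gz i j) [\<Phi> x] [v'] = diff (gz i j) [x] [v]"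
      using has_mat_derivD(2)[OF v'] by blast
  qed
  then show ?thesis unfolding \<Phi>_def \<gamma>_def[abs_def] .
qed

text \<open>
  By induction the first \<open>i - 1\<close> factors are trivial, so the \<open>i\<close>-th factor commutes with the corner
  of size \<open>i + 1\<close> as well as with that of size \<open>i\<close>. Subtracting \<open>1\<close> from it gives a matrix that
  is a polynomial in both corners.
\<close>

lemma conjugate_gprod_free:
  assumes sr: "strongly_regular n x"
    and cyc: "\<And>i. 1 \<le> i \<Longrightarrow> i \<le> n \<Longrightarrow> cyclic i (A i) \<and> similar_mat (corner i x) (A i)"
    and fam: "inv_family (n - 1) \<gamma>"
    and comm: "\<And>i. 1 \<le> i \<Longrightarrow> i \<le> n - 1 \<Longrightarrow> \<gamma> i * corner i x = corner i x * \<gamma> i"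
    and fixed: "conj_by (gprod n \<gamma> (n - 1)) x = x"
  shows "1 \<le> i \<Longrightarrow> i < n \<Longrightarrow> \<gamma> i = 1\<^sub>m i"
proof (induction i rule: less_induct)
  case (less i)
  have x: "x \<in> carrier_mat n n" using sr by (simp add: strongly_regular_def)
  let ?y = "corner (Suc i) x" and ?g = "extend_by_one (Suc i) (\<gamma> i)"
  have g: "\<gamma> i \<in> carrier_mat i i" "det (\<gamma> i) \<noteq> 0" using inv_familyD[OF fam, of i] less.prems by auto
  obtain r where r: "i = Suc r" using less.prems by (cases i) auto
  have "gprod (Suc i) \<gamma> i = ?g"
    using gprod_ones[of r \<gamma> "Suc i"] less by (simp add: r)
  moreover have "min (n - 1) (Suc i - 1) = i" using less.prems by simp
  ultimately have "corner (Suc i) (conj_by (gprod n \<gamma> (n - 1)) x) = conj_by ?g ?y"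
    using corner_conjugate_commuting[OF fam _ x _ comm, of "Suc i"] less.prems by simp
  then have "conj_by ?g ?y = ?y" using fixed by simp
  then have gy: "?g * ?y = ?y * ?g"
    using conjugate_iff[of ?g "Suc i" ?y ?y] det_extend(1)[OF g, of "Suc i"] by simp
  have "\<gamma> i - 1\<^sub>m i \<in> carrier_mat i i" by simp
  moreover have "corner i x * (\<gamma> i - 1\<^sub>m i) = (\<gamma> i - 1\<^sub>m i) * corner i x"
    using comm[of i] less.prems g
    by (simp add: mult_minus_distrib_mat[of _ i i _ i] minus_mult_distrib_mat[of _ i i _ _ i])
  ultimately obtain c where c: "\<gamma> i - 1\<^sub>m i = mat_poly i c (corner i x)"
    using commuting_eq_transport[of i "A i" "corner i x" "\<gamma> i - 1\<^sub>m i"] cyc[of i] less.prems by auto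
  have "?y * (?g - 1\<^sub>m (Suc i)) = (?g - 1\<^sub>m (Suc i)) * ?y"
    using gy by (simp add: mult_minus_distrib_mat[of _ "Suc i" "Suc i" _ "Suc i"]
      minus_mult_distrib_mat[of _ "Suc i" "Suc i" _ _ "Suc i"])
  then obtain d where d: "?g - 1\<^sub>m (Suc i) = mat_poly (Suc i) d ?y"
    using commuting_eq_transport[of "Suc i" "A (Suc i)" ?y "?g - 1\<^sub>m (Suc i)"] cyc[of "Suc i"] less.prems by auto
  have "pad (Suc i) (mat_poly i c (corner i x)) = mat_poly (Suc i) d ?y"
    using pad_extend[OF g(1), of "Suc i"] by (simp add: c[symmetric] d[symmetric])
  then have "pad n (mat_poly i c (corner i x)) = pad n (mat_poly (Suc i) d ?y)"
    using pad_pad[of "mat_poly i c (corner i x)" i "Suc i" n] less.prems by simp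
  then have "c j = 0" if "j < i" for j
    using strongly_regular_indep[OF sr] less.prems that by blast
  then have z: "\<gamma> i - 1\<^sub>m i = 0\<^sub>m i i" unfolding c by (auto simp: mat_poly_def)
  show ?case
  proof (rule eq_matI)
    fix a b assume ab: "a < dim_row (1\<^sub>m i :: complex mat)" "b < dim_col (1\<^sub>m i :: complex mat)"
    then have "(\<gamma> i - 1\<^sub>m i) $$ (a, b) = 0" using z by simp
    then show "\<gamma> i $$ (a, b) = 1\<^sub>m i $$ (a, b)" using ab by simp
  qed (use g in auto)
qed

section \<open>The action on the covering\<close>

text \<open>
  A point of the covering is the list \<open>[x, z\<^sub>1, \<dots>, z\<^sub>n]\<close> and an element of the group the list
  \<open>[k\<^sub>1, \<dots>, k\<^sub>n\<^sub>-\<^sub>1]\<close>; this is the reason for the different offsets.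
\<close>

definition act_factor :: "(nat \<Rightarrow> nat list) \<Rightarrow> point \<Rightarrow> point \<Rightarrow> nat \<Rightarrow> complex mat" where
  "act_factor D k p i = transport (p ! i + principal_nilpotent (D i)) (k ! (i - 1)) (corner i (p ! 0))"

definition moved :: "nat \<Rightarrow> (nat \<Rightarrow> nat list) \<Rightarrow> point \<Rightarrow> point \<Rightarrow> complex mat" where
  "moved n D k p = conj_by (gprod n (act_factor D k p) (n - 1)) (p ! 0)"

definition act :: "nat \<Rightarrow> (nat \<Rightarrow> nat list) \<Rightarrow> point \<Rightarrow> point \<Rightarrow> point" where
  "act n D k = (\<lambda>p\<in>cover n D. moved n D k p # tl p)"

lemma list_all2_upt:
  "list_all2 P [1..<Suc m] zs \<longleftrightarrow> length zs = m \<and> (\<forall>i. 1 \<le> i \<longrightarrow> i \<le> m \<longrightarrow> P i (zs ! (i - 1)))"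
proof -
  have "list_all2 P [1..<Suc m] zs \<longleftrightarrow> length zs = m \<and> (\<forall>j<m. P (Suc j) (zs ! j))"
    by (auto simp: list_all2_conv_all_nth simp del: upt_Suc)
  also have "(\<forall>j<m. P (Suc j) (zs ! j)) \<longleftrightarrow> (\<forall>i. 1 \<le> i \<longrightarrow> i \<le> m \<longrightarrow> P i (zs ! (i - 1)))"
  proof
    assume h: "\<forall>j<m. P (Suc j) (zs ! j)"
    show "\<forall>i. 1 \<le> i \<longrightarrow> i \<le> m \<longrightarrow> P i (zs ! (i - 1))"
    proof (intro allI impI)
      fix i assume "1 \<le> i" "i \<le> m"
      then show "P i (zs ! (i - 1))" using h[rule_format, of "i - 1"] by simp
    qed
  next
    assume h: "\<forall>i. 1 \<le> i \<longrightarrow> i \<le> m \<longrightarrow> P i (zs ! (i - 1))"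
    show "\<forall>j<m. P (Suc j) (zs ! j)" using h[rule_format, of "Suc _"] by auto
  qed
  finally show ?thesis .
qed

lemma center_tuples_iff:
  "zs \<in> center_tuples n D \<longleftrightarrow> length zs = n \<and> (\<forall>i. 1 \<le> i \<longrightarrow> i \<le> n \<longrightarrow> zs ! (i - 1) \<in> levi_center_gen (D i))"
  unfolding center_tuples_def mem_Collect_eq by (rule list_all2_upt)

locale decomposition_data =
  fixes n :: nat and D :: "nat \<Rightarrow> nat list"
  assumes n_pos: "n \<ge> 1" and data: "regular_decomposition_data n D"
begin

abbreviation e :: "nat \<Rightarrow> complex mat" where "e i \<equiv> principal_nilpotent (D i)"

abbreviation Z :: "point set" where "Z \<equiv> carrier (Z_group n D)"

lemma sum_blocks: "1 \<le> i \<Longrightarrow> i \<le> n \<Longrightarrow> sum_list (D i) = i"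
  using data by (simp add: regular_decomposition_data_def block_sizes_def)

lemma cover_iff:
  "p \<in> cover n D \<longleftrightarrow> length p = Suc n \<and> strongly_regular n (p ! 0) \<and>
     (\<forall>i. 1 \<le> i \<longrightarrow> i \<le> n \<longrightarrow> p ! i \<in> levi_center_gen (D i) \<and> similar_mat (corner i (p ! 0)) (p ! i + e i))"
proof -
  have nth: "(x # zs) ! i = zs ! (i - 1)" if "1 \<le> i" for i and x :: "complex mat" and zs
    using that by (cases i) auto
  show ?thesis
  proof
    assume "p \<in> cover n D"
    then obtain x zs where p: "p = x # zs" "x \<in> X_set n D" "zs \<in> center_tuples n D"
      "list_all2 (\<lambda>i z. similar_mat (corner i x) (z + e i)) [1..<Suc n] zs"
      unfolding cover_def by blast
    then show "length p = Suc n \<and> strongly_regular n (p ! 0) \<and>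
     (\<forall>i. 1 \<le> i \<longrightarrow> i \<le> n \<longrightarrow> p ! i \<in> levi_center_gen (D i) \<and> similar_mat (corner i (p ! 0)) (p ! i + e i))"
      unfolding list_all2_upt center_tuples_iff by (simp add: nth X_set_def)
  next
    assume r: "length p = Suc n \<and> strongly_regular n (p ! 0) \<and>
     (\<forall>i. 1 \<le> i \<longrightarrow> i \<le> n \<longrightarrow> p ! i \<in> levi_center_gen (D i) \<and> similar_mat (corner i (p ! 0)) (p ! i + e i))"
    then obtain x zs where p: "p = x # zs" by (cases p) auto
    have "x \<in> X_set n D" using r unfolding X_set_def decomposition_class_def
      by (auto simp: p nth strongly_regular_def)
    moreover have "zs \<in> center_tuples n D" using r by (simp add: p nth center_tuples_iff)
    moreover have "list_all2 (\<lambda>i z. similar_mat (corner i x) (z + e i)) [1..<Suc n] zs"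
      unfolding list_all2_upt using r by (simp add: p nth)
    ultimately show "p \<in> cover n D" unfolding cover_def p by blast
  qed
qed

lemma coverD:
  assumes "p \<in> cover n D"
  shows "length p = Suc n" "strongly_regular n (p ! 0)" "p ! 0 \<in> carrier_mat n n"
    "1 \<le> i \<Longrightarrow> i \<le> n \<Longrightarrow> p ! i \<in> levi_center_gen (D i)"
    "1 \<le> i \<Longrightarrow> i \<le> n \<Longrightarrow> p ! i \<in> carrier_mat i i"
    "1 \<le> i \<Longrightarrow> i \<le> n \<Longrightarrow> similar_mat (corner i (p ! 0)) (p ! i + e i)"
    "1 \<le> i \<Longrightarrow> i \<le> n \<Longrightarrow> cyclic i (p ! i + e i)"
proof -
  note h = assms[unfolded cover_iff]
  show "length p = Suc n" "strongly_regular n (p ! 0)" "p ! 0 \<in> carrier_mat n n"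
    using h by (auto simp: strongly_regular_def)
  assume i: "1 \<le> i" "i \<le> n"
  show z: "p ! i \<in> levi_center_gen (D i)" and "similar_mat (corner i (p ! 0)) (p ! i + e i)" using h i by auto
  show "p ! i \<in> carrier_mat i i" using levi_center_carrier[OF levi_center_gen_center[OF z]] sum_blocks[OF i] by simp
  show "cyclic i (p ! i + e i)" using levi_cyclic[OF z] sum_blocks[OF i] by simp
qed

lemma cover_aff: "cover n D \<subseteq> aff (cover_shape n)"
proof
  fix p assume p: "p \<in> cover n D"
  have "p ! k \<in> carrier_mat ((n # [1..<Suc n]) ! k) ((n # [1..<Suc n]) ! k)" if "k < Suc n" for k
    using coverD(3)[OF p] coverD(5)[OF p, of k] that by (cases k) (auto simp del: upt_Suc)
  then show "p \<in> aff (cover_shape n)"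
    using coverD(1)[OF p] by (auto simp: aff_iff cover_shape_def simp del: upt_Suc)
qed

lemma cover_shape_nth: "1 \<le> i \<Longrightarrow> i \<le> n \<Longrightarrow> cover_shape n ! i = i" "cover_shape n ! 0 = n"
  "length (cover_shape n) = Suc n"
  by (auto simp: cover_shape_def nth_Cons' simp del: upt_Suc)

lemma Z_shape_nth: "1 \<le> i \<Longrightarrow> i < n \<Longrightarrow> Z_shape n ! (i - 1) = i" "length (Z_shape n) = n - 1"
  by (auto simp: Z_shape_def)

lemma Z_iff:
  "k \<in> Z \<longleftrightarrow> length k = n - 1 \<and> (\<forall>i. 1 \<le> i \<longrightarrow> i < n \<longrightarrow> k ! (i - 1) \<in> levi_centralizer (D i))"
proof -
  have "[1..<n] = [1..<Suc (n - 1)]" using n_pos by simp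
  then have "k \<in> Z \<longleftrightarrow> length k = n - 1 \<and> (\<forall>i. 1 \<le> i \<longrightarrow> i \<le> n - 1 \<longrightarrow> k ! (i - 1) \<in> levi_centralizer (D i))"
    unfolding Z_group_def by (simp only: partial_object.simps mem_Collect_eq list_all2_upt)
  then show ?thesis using n_pos by (auto simp: le_diff_conv2)
qed

lemma ZD:
  assumes "k \<in> Z"
  shows "length k = n - 1" "1 \<le> i \<Longrightarrow> i < n \<Longrightarrow> k ! (i - 1) \<in> carrier_mat i i"
    "1 \<le> i \<Longrightarrow> i < n \<Longrightarrow> det (k ! (i - 1)) \<noteq> 0"
    "1 \<le> i \<Longrightarrow> i < n \<Longrightarrow> z \<in> levi_center (D i) \<Longrightarrow> (z + e i) * k ! (i - 1) = k ! (i - 1) * (z + e i)"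
proof -
  show "length k = n - 1" using assms by (simp add: Z_iff)
  assume i: "1 \<le> i" "i < n"
  then have k: "k ! (i - 1) \<in> levi_centralizer (D i)" using assms by (simp add: Z_iff)
  then show c: "k ! (i - 1) \<in> carrier_mat i i" using sum_blocks[of i] i by (auto simp: levi_centralizer_def)
  show "det (k ! (i - 1)) \<noteq> 0" using k c by (simp add: levi_centralizer_def invertible_mat_iff)
  show "(z + e i) * k ! (i - 1) = k ! (i - 1) * (z + e i)" if "z \<in> levi_center (D i)"
    using k that by (auto simp: levi_centralizer_def)
qed

lemma ZI:
  assumes "length k = n - 1" "\<And>i. 1 \<le> i \<Longrightarrow> i < n \<Longrightarrow> k ! (i - 1) \<in> carrier_mat i i"
    "\<And>i. 1 \<le> i \<Longrightarrow> i < n \<Longrightarrow> det (k ! (i - 1)) \<noteq> 0"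
    "\<And>i z. 1 \<le> i \<Longrightarrow> i < n \<Longrightarrow> z \<in> levi_center (D i) \<Longrightarrow> (z + e i) * k ! (i - 1) = k ! (i - 1) * (z + e i)"
  shows "k \<in> Z"
  unfolding Z_iff
proof (intro conjI allI impI assms(1))
  fix i assume i: "1 \<le> i" "i < n"
  then have "sum_list (D i) = i" using sum_blocks by simp
  then show "k ! (i - 1) \<in> levi_centralizer (D i)"
    unfolding levi_centralizer_def using assms(2-4)[OF i] invertible_mat_iff[OF assms(2)[OF i]] by simp
qed

lemma Z_one: "length \<one>\<^bsub>Z_group n D\<^esub> = n - 1" "1 \<le> i \<Longrightarrow> i < n \<Longrightarrow> \<one>\<^bsub>Z_group n D\<^esub> ! (i - 1) = 1\<^sub>m i"
  by (auto simp: Z_group_def)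

lemma Z_mult:
  "length k = n - 1 \<Longrightarrow> length l = n - 1 \<Longrightarrow> length (k \<otimes>\<^bsub>Z_group n D\<^esub> l) = n - 1"
  "length k = n - 1 \<Longrightarrow> length l = n - 1 \<Longrightarrow> 1 \<le> i \<Longrightarrow> i < n \<Longrightarrow>
    (k \<otimes>\<^bsub>Z_group n D\<^esub> l) ! (i - 1) = k ! (i - 1) * l ! (i - 1)"
  by (auto simp: Z_group_def)

lemma center_shift_carrier: "1 \<le> i \<Longrightarrow> i \<le> n \<Longrightarrow> z \<in> levi_center (D i) \<Longrightarrow> z + e i \<in> carrier_mat i i"
  using levi_center_carrier[of z "D i"] principal_nilpotent_carrier[of "D i"] sum_blocks[of i] by simp

lemma point_eqI:
  assumes "length k = n - 1" "length l = n - 1" "\<And>i. 1 \<le> i \<Longrightarrow> i < n \<Longrightarrow> k ! (i - 1) = l ! (i - 1)"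
  shows "k = (l :: point)"
proof (rule nth_equalityI)
  fix j assume "j < length k"
  then show "k ! j = l ! j" using assms(1) assms(3)[of "Suc j"] by simp
qed (use assms in simp)

lemma Z_one_closed: "\<one>\<^bsub>Z_group n D\<^esub> \<in> Z"
proof (rule ZI)
  fix i z assume i: "1 \<le> i" "i < n"
  show "\<one>\<^bsub>Z_group n D\<^esub> ! (i - 1) \<in> carrier_mat i i" "det (\<one>\<^bsub>Z_group n D\<^esub> ! (i - 1)) \<noteq> 0"
    unfolding Z_one(2)[OF i] by simp_all
  assume "z \<in> levi_center (D i)"
  then have "z + e i \<in> carrier_mat i i" using i by (intro center_shift_carrier) auto
  then show "(z + e i) * \<one>\<^bsub>Z_group n D\<^esub> ! (i - 1) = \<one>\<^bsub>Z_group n D\<^esub> ! (i - 1) * (z + e i)"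
    unfolding Z_one(2)[OF i] by (simp only: left_mult_one_mat right_mult_one_mat)
qed (simp add: Z_one)

lemma Z_mult_closed: "k \<in> Z \<Longrightarrow> l \<in> Z \<Longrightarrow> k \<otimes>\<^bsub>Z_group n D\<^esub> l \<in> Z"
proof (rule ZI)
  assume kl: "k \<in> Z" "l \<in> Z"
  show "length (k \<otimes>\<^bsub>Z_group n D\<^esub> l) = n - 1" using ZD(1)[OF kl(1)] ZD(1)[OF kl(2)] by (rule Z_mult(1))
  fix i z assume i: "1 \<le> i" "i < n"
  note m = Z_mult(2)[OF ZD(1)[OF kl(1)] ZD(1)[OF kl(2)] i]
  note c = ZD(2)[OF kl(1) i] ZD(2)[OF kl(2) i]
  show "(k \<otimes>\<^bsub>Z_group n D\<^esub> l) ! (i - 1) \<in> carrier_mat i i" unfolding m using c by simp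
  show "det ((k \<otimes>\<^bsub>Z_group n D\<^esub> l) ! (i - 1)) \<noteq> 0" unfolding m det_mult[OF c]
    using ZD(3)[OF kl(1) i] ZD(3)[OF kl(2) i] by simp
  assume z: "z \<in> levi_center (D i)"
  then have "z + e i \<in> carrier_mat i i" using i by (intro center_shift_carrier) auto
  then show "(z + e i) * (k \<otimes>\<^bsub>Z_group n D\<^esub> l) ! (i - 1) = (k \<otimes>\<^bsub>Z_group n D\<^esub> l) ! (i - 1) * (z + e i)"
    unfolding m using c ZD(4)[OF kl(1) i z] ZD(4)[OF kl(2) i z] by (rule commute_mult)
qed

lemma Z_group: "group (Z_group n D)"
proof (rule groupI)
  show "x \<otimes>\<^bsub>Z_group n D\<^esub> y \<in> Z" if "x \<in> Z" "y \<in> Z" for x y using that by (rule Z_mult_closed)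
  show "\<one>\<^bsub>Z_group n D\<^esub> \<in> Z" by (rule Z_one_closed)
  show "x \<otimes>\<^bsub>Z_group n D\<^esub> y \<otimes>\<^bsub>Z_group n D\<^esub> z = x \<otimes>\<^bsub>Z_group n D\<^esub> (y \<otimes>\<^bsub>Z_group n D\<^esub> z)"
    if "x \<in> Z" "y \<in> Z" "z \<in> Z" for x y z
  proof (rule point_eqI)
    note l = ZD(1)[OF that(1)] ZD(1)[OF that(2)] ZD(1)[OF that(3)]
    fix i assume i: "1 \<le> i" "i < n"
    show "(x \<otimes>\<^bsub>Z_group n D\<^esub> y \<otimes>\<^bsub>Z_group n D\<^esub> z) ! (i - 1) = (x \<otimes>\<^bsub>Z_group n D\<^esub> (y \<otimes>\<^bsub>Z_group n D\<^esub> z)) ! (i - 1)"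
      unfolding Z_mult(2)[OF l(1,2) i] Z_mult(2)[OF l(2,3) i]
        Z_mult(2)[OF Z_mult(1)[OF l(1,2)] l(3) i] Z_mult(2)[OF l(1) Z_mult(1)[OF l(2,3)] i]
      using ZD(2)[OF that(1) i] ZD(2)[OF that(2) i] ZD(2)[OF that(3) i] by (rule assoc_sq)
  qed (simp_all add: ZD(1)[OF that(1)] ZD(1)[OF that(2)] ZD(1)[OF that(3)] Z_mult(1))
  show "\<one>\<^bsub>Z_group n D\<^esub> \<otimes>\<^bsub>Z_group n D\<^esub> x = x" if "x \<in> Z" for x
  proof (rule point_eqI)
    fix i assume i: "1 \<le> i" "i < n"
    show "(\<one>\<^bsub>Z_group n D\<^esub> \<otimes>\<^bsub>Z_group n D\<^esub> x) ! (i - 1) = x ! (i - 1)"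
      unfolding Z_mult(2)[OF Z_one(1) ZD(1)[OF that] i] Z_one(2)[OF i] using ZD(2)[OF that i] by simp
  qed (simp_all add: ZD(1)[OF that] Z_mult(1) Z_one(1))
  fix x assume x: "x \<in> Z"
  define y where "y = map mat_inv x"
  have len: "length x = n - 1" "length y = n - 1" using ZD(1)[OF x] by (auto simp: y_def)
  have y: "y ! (i - 1) = mat_inv (x ! (i - 1))" if "1 \<le> i" "i < n" for i
    using that len by (simp add: y_def)
  have "y \<in> Z"
  proof (rule ZI)
    fix i z assume i: "1 \<le> i" "i < n"
    let ?g = "x ! (i - 1)" and ?h = "mat_inv (x ! (i - 1))"
    note g = ZD(2)[OF x i] ZD(3)[OF x i]
    have h: "?h \<in> carrier_mat i i" using g(1) by (rule mat_inv_carrier)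
    show "y ! (i - 1) \<in> carrier_mat i i" unfolding y[OF i] by (rule h)
    show "det (y ! (i - 1)) \<noteq> 0" unfolding y[OF i] using mat_inv_unique(1)[OF h g(1) mat_inv(2)[OF g]] .
    assume z: "z \<in> levi_center (D i)"
    let ?A = "z + e i"
    have A: "?A \<in> carrier_mat i i" using i z by (intro center_shift_carrier) auto
    have "?A * ?h = ?h * (?g * (?A * ?h))"
      using mat_cancel_left(1)[OF g, of "?A * ?h"] A h by simp
    also have "\<dots> = ?h * ((?g * ?A) * ?h)" using A h g(1) by (simp add: assoc_sq[of _ i])
    also have "\<dots> = ?h * (?A * (?g * ?h))" unfolding ZD(4)[OF x i z, symmetric] using A h g(1) by (simp add: assoc_sq[of _ i])
    also have "\<dots> = ?h * ?A" unfolding mat_inv(1)[OF g] right_mult_one_mat[OF A] ..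
    finally show "?A * y ! (i - 1) = y ! (i - 1) * ?A" unfolding y[OF i] .
  qed (rule len)
  moreover have "y \<otimes>\<^bsub>Z_group n D\<^esub> x = \<one>\<^bsub>Z_group n D\<^esub>"
  proof (rule point_eqI)
    fix i assume i: "1 \<le> i" "i < n"
    show "(y \<otimes>\<^bsub>Z_group n D\<^esub> x) ! (i - 1) = \<one>\<^bsub>Z_group n D\<^esub> ! (i - 1)"
      unfolding Z_mult(2)[OF len(2,1) i] Z_one(2)[OF i] y[OF i] by (rule mat_inv(2)[OF ZD(2,3)[OF x i]])
  qed (simp_all add: Z_mult(1) len Z_one(1))
  ultimately show "\<exists>y\<in>Z. y \<otimes>\<^bsub>Z_group n D\<^esub> x = \<one>\<^bsub>Z_group n D\<^esub>" by blast
qed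

subsection \<open>The factors of the conjugating element\<close>

lemma Z_commute:
  assumes "k \<in> Z" "p \<in> cover n D" "1 \<le> i" "i < n"
  shows "(p ! i + e i) * k ! (i - 1) = k ! (i - 1) * (p ! i + e i)"
  using ZD(4)[OF assms(1,3,4)] levi_center_gen_center[OF coverD(4)[OF assms(2,3)]] assms(4) by simp

lemma act_factor_carrier [simp]: "act_factor D k p i \<in> carrier_mat i i"
  by (simp add: act_factor_def)

lemma act_factor_family:
  assumes "k \<in> Z" "p \<in> cover n D"
  shows "inv_family (n - 1) (act_factor D k p)"
  unfolding inv_family_def
proof (intro allI impI conjI)
  fix i assume "1 \<le> i" "i \<le> n - 1"
  then have i: "1 \<le> i" "i < n" "i \<le> n" using n_pos by auto
  show "det (act_factor D k p i) \<noteq> 0" unfolding act_factor_def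
    by (rule det_transport[OF coverD(7)[OF assms(2) i(1,3)] corner_carrier coverD(6)[OF assms(2) i(1,3)]
        ZD(2)[OF assms(1) i(1,2)] Z_commute[OF assms i(1,2)] ZD(3)[OF assms(1) i(1,2)]])
qed simp

lemma act_factor_commute: "act_factor D k p i * corner i (p ! 0) = corner i (p ! 0) * act_factor D k p i"
  unfolding act_factor_def by (rule transport_commute[OF corner_carrier])

lemma moved_carrier [simp]: "p \<in> cover n D \<Longrightarrow> moved n D k p \<in> carrier_mat n n"
  using coverD(3) by (simp add: moved_def)

lemma corner_moved:
  assumes "k \<in> Z" "p \<in> cover n D" "1 \<le> i" "i \<le> n"
  shows "corner i (moved n D k p) = conj_by (gprod i (act_factor D k p) (i - 1)) (corner i (p ! 0))"
    and "det (gprod i (act_factor D k p) (i - 1)) \<noteq> 0"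
proof -
  have "min (n - 1) (i - 1) = i - 1" using assms by simp
  then show "corner i (moved n D k p) = conj_by (gprod i (act_factor D k p) (i - 1)) (corner i (p ! 0))"
    unfolding moved_def
    using corner_conjugate_commuting[OF act_factor_family[OF assms(1,2)] _ coverD(3)[OF assms(2)] assms(4) act_factor_commute]
    by simp
  show "det (gprod i (act_factor D k p) (i - 1)) \<noteq> 0"
    using assms by (intro det_gprod inv_family_le[OF act_factor_family[OF assms(1,2)]]) auto
qed

lemma similar_conjugate:
  assumes "M \<in> carrier_mat m m" "det M \<noteq> 0" "y \<in> carrier_mat m m" "similar_mat y A"
  shows "similar_mat (conj_by M y) A"
proof -
  have "M * y = conj_by M y * M" using conjugate_iff[of M m y "conj_by M y"] assms by auto
  then have "similar_mat (conj_by M y) y" using assms by (subst similar_mat_iff[of _ m]) auto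
  then show ?thesis using assms(4) by (rule similar_mat_trans)
qed

lemma moved_strongly_regular:
  assumes "k \<in> Z" "p \<in> cover n D"
  shows "strongly_regular n (moved n D k p)"
proof -
  define c where "c i = coef (p ! i + e i) (k ! (i - 1))" for i
  have f: "act_factor D k p i = mat_poly i (c i) (corner i (p ! 0))" if "1 \<le> i" "i \<le> n - 1" for i
  proof -
    have "dim_row (p ! i + e i) = i" using that carrier_matD(1)[OF cyclic_carrier[OF coverD(7)[OF assms(2), of i]]] by linarith
    then show ?thesis unfolding act_factor_def transport_def c_def by (simp only:)
  qed
  have "inv_family (n - 1) (\<lambda>i. mat_poly i (c i) (corner i (p ! 0)))"
    using act_factor_family[OF assms] f by (simp add: inv_family_def)
  from strongly_regular_conjugate[OF coverD(2)[OF assms(2)] this] show ?thesis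
    unfolding moved_def using gprod_cong[of "n - 1" "act_factor D k p" _ n, OF f] by simp
qed

lemma act_nth:
  assumes "p \<in> cover n D"
  shows "act n D k p ! 0 = moved n D k p" "1 \<le> i \<Longrightarrow> i \<le> n \<Longrightarrow> act n D k p ! i = p ! i" "length (act n D k p) = Suc n"
  using assms coverD(1)[OF assms] by (auto simp: act_def nth_Cons' nth_tl)

lemma act_cover:
  assumes "k \<in> Z" "p \<in> cover n D"
  shows "act n D k p \<in> cover n D"
  unfolding cover_iff
proof (intro conjI allI impI)
  show "length (act n D k p) = Suc n" using act_nth[OF assms(2)] by simp
  show "strongly_regular n (act n D k p ! 0)" using moved_strongly_regular[OF assms] act_nth[OF assms(2)] by simp
  fix i assume i: "1 \<le> i" "i \<le> n"
  show "act n D k p ! i \<in> levi_center_gen (D i)" using coverD(4)[OF assms(2) i] act_nth(2)[OF assms(2) i] by simp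
  show "similar_mat (corner i (act n D k p ! 0)) (act n D k p ! i + e i)"
    unfolding act_nth(1)[OF assms(2)] act_nth(2)[OF assms(2) i] corner_moved(1)[OF assms i]
    using corner_moved(2)[OF assms i] coverD(6)[OF assms(2) i] by (intro similar_conjugate[of _ i]) auto
qed

lemma act_one:
  assumes "p \<in> cover n D"
  shows "act n D \<one>\<^bsub>Z_group n D\<^esub> p = p"
proof -
  have "act_factor D \<one>\<^bsub>Z_group n D\<^esub> p i = 1\<^sub>m i" if "1 \<le> i" "i \<le> n - 1" for i
  proof -
    have i: "1 \<le> i" "i < n" "i \<le> n" using that n_pos by auto
    show ?thesis
      using transport_eq_one_iff[OF coverD(7)[OF assms i(1,3)] corner_carrier coverD(6)[OF assms i(1,3)]
        ZD(2)[OF Z_one_closed i(1,2)] Z_commute[OF Z_one_closed assms i(1,2)]] Z_one(2)[OF i(1,2)]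
      by (simp add: act_factor_def)
  qed
  then have "gprod n (act_factor D \<one>\<^bsub>Z_group n D\<^esub> p) (n - 1) = 1\<^sub>m n" by (rule gprod_ones) simp_all
  then have "moved n D \<one>\<^bsub>Z_group n D\<^esub> p = p ! 0" using coverD(3)[OF assms] by (simp add: moved_def conjugate_one)
  then show ?thesis using assms coverD(1)[OF assms] by (cases p) (auto simp: act_def)
qed

text \<open>
  The first action conjugates the \<open>i\<close>-th corner, so the factors for the second one are conjugated in
  the same way.
\<close>

lemma act_mult:
  assumes "k \<in> Z" "l \<in> Z" "p \<in> cover n D"
  shows "act n D (k \<otimes>\<^bsub>Z_group n D\<^esub> l) p = act n D k (act n D l p)"
proof -
  let ?q = "act n D l p" and ?f = "act_factor D k p" and ?g = "act_factor D l p"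
  have q: "?q \<in> cover n D" by (rule act_cover[OF assms(2,3)])
  note fam = act_factor_family[OF assms(1,3)] act_factor_family[OF assms(2,3)]
  have twisted: "act_factor D k ?q i = conj_by (gprod i ?g (i - 1)) (?f i)" if "1 \<le> i" "i \<le> n - 1" for i
  proof -
    have i: "1 \<le> i" "i \<le> n" using that by auto
    show ?thesis unfolding act_factor_def[of D k] act_nth(2)[OF assms(3) i] act_nth(1)[OF assms(3)]
      corner_moved(1)[OF assms(2,3) i]
      by (rule transport_conjugate[of _ i]) (use corner_moved(2)[OF assms(2,3) i] in auto)
  qed
  have product: "act_factor D (k \<otimes>\<^bsub>Z_group n D\<^esub> l) p i = ?f i * ?g i" if "1 \<le> i" "i \<le> n - 1" for i
  proof -
    have i: "1 \<le> i" "i < n" "i \<le> n" using that n_pos by auto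
    show ?thesis unfolding act_factor_def Z_mult(2)[OF ZD(1)[OF assms(1)] ZD(1)[OF assms(2)] i(1,2)]
      by (rule transport_mult[OF coverD(7)[OF assms(3) i(1,3)] corner_carrier coverD(6)[OF assms(3) i(1,3)]
        ZD(2)[OF assms(1) i(1,2)] Z_commute[OF assms(1,3) i(1,2)] ZD(2)[OF assms(2) i(1,2)] Z_commute[OF assms(2,3) i(1,2)]])
  qed
  have "moved n D k ?q = conj_by (gprod n (act_factor D k ?q) (n - 1)) (conj_by (gprod n ?g (n - 1)) (p ! 0))"
    unfolding moved_def[of n D k] act_nth(1)[OF assms(3)] moved_def[of n D l] ..
  also have "\<dots> = conj_by (gprod n (act_factor D k ?q) (n - 1) * gprod n ?g (n - 1)) (p ! 0)"
    using det_gprod[OF act_factor_family[OF assms(1) q]] det_gprod[OF fam(2)] coverD(3)[OF assms(3)]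
    by (intro conjugate_mult[symmetric, of _ n]) auto
  also have "gprod n (act_factor D k ?q) (n - 1) = gprod n (\<lambda>i. conj_by (gprod i ?g (i - 1)) (?f i)) (n - 1)"
    using twisted by (rule gprod_cong)
  also have "\<dots> * gprod n ?g (n - 1) = gprod n (\<lambda>i. ?f i * ?g i) (n - 1)"
    using fam by (rule gprod_twisted_mult) simp
  also have "\<dots> = gprod n (act_factor D (k \<otimes>\<^bsub>Z_group n D\<^esub> l) p) (n - 1)"
    using product by (intro gprod_cong) simp
  finally have "moved n D k ?q = moved n D (k \<otimes>\<^bsub>Z_group n D\<^esub> l) p" by (simp add: moved_def)
  then show ?thesis using q assms(3) by (simp add: act_def)
qed

lemma act_group_action: "group_action (Z_group n D) (cover n D) (act n D)"
proof -
  interpret Zg: group "Z_group n D" by (rule Z_group)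
  have bij: "bij_betw (act n D k) (cover n D) (cover n D)" if k: "k \<in> Z" for k
  proof (rule bij_betw_byWitness[where f' = "act n D (inv\<^bsub>Z_group n D\<^esub> k)"])
    note k' = Zg.inv_closed[OF k]
    show "\<forall>p\<in>cover n D. act n D (inv\<^bsub>Z_group n D\<^esub> k) (act n D k p) = p"
      using act_mult[OF k' k] act_one Zg.l_inv[OF k] by simp
    show "\<forall>p\<in>cover n D. act n D k (act n D (inv\<^bsub>Z_group n D\<^esub> k) p) = p"
      using act_mult[OF k k'] act_one Zg.r_inv[OF k] by simp
    show "act n D k ` cover n D \<subseteq> cover n D" using act_cover[OF k] by blast
    show "act n D (inv\<^bsub>Z_group n D\<^esub> k) ` cover n D \<subseteq> cover n D" using act_cover[OF k'] by blast
  qed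
  have Bij: "act n D k \<in> Bij (cover n D)" if "k \<in> Z" for k
    using bij[OF that] by (auto simp: Bij_def act_def)
  show ?thesis
    unfolding group_action_def group_hom_def group_hom_axioms_def
  proof (intro conjI Z_group group_BijGroup)
    show "act n D \<in> hom (Z_group n D) (BijGroup (cover n D))"
    proof (rule homI)
      fix k l assume kl: "k \<in> Z" "l \<in> Z"
      show "act n D (k \<otimes>\<^bsub>Z_group n D\<^esub> l) = act n D k \<otimes>\<^bsub>BijGroup (cover n D)\<^esub> act n D l"
        using Bij kl by (simp add: BijGroup_def compose_def, subst act_def, intro restrict_ext)
          (simp add: act_mult[symmetric], simp add: act_def)
    qed (use Bij in \<open>simp add: BijGroup_def\<close>)
  qed
qed

lemma act_free: "free_action n D (act n D)"
  unfolding free_action_def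
proof
  fix p assume p: "p \<in> cover n D"
  have "k = \<one>\<^bsub>Z_group n D\<^esub>" if k: "k \<in> Z" and fixed: "act n D k p = p" for k
  proof (rule point_eqI)
    have "moved n D k p = p ! 0" using act_nth(1)[OF p, of k] fixed by simp
    then have fx: "conj_by (gprod n (act_factor D k p) (n - 1)) (p ! 0) = p ! 0" by (simp add: moved_def)
    fix i assume i: "1 \<le> i" "i < n"
    have "act_factor D k p i = 1\<^sub>m i"
      by (rule conjugate_gprod_free[OF coverD(2)[OF p] _ act_factor_family[OF k p] act_factor_commute fx i,
          of "\<lambda>i. p ! i + e i"]) (use coverD(6,7)[OF p] in auto)
    then show "k ! (i - 1) = \<one>\<^bsub>Z_group n D\<^esub> ! (i - 1)"
      using transport_eq_one_iff[OF coverD(7)[OF p] corner_carrier coverD(6)[OF p] ZD(2)[OF k i] Z_commute[OF k p i]] i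
        Z_one(2)[OF i]
      by (simp add: act_factor_def)
  qed (simp_all add: ZD(1)[OF k] Z_one)
  then show "stabilizer (Z_group n D) (act n D) p = {\<one>\<^bsub>Z_group n D\<^esub>}"
    unfolding stabilizer_def using Z_one_closed act_one[OF p] by blast
qed

end

subsection \<open>The action is algebraic\<close>

context function_algebra_inverse
begin

lemma mat_in_transport:
  assumes "mat_in N N A" "mat_in N N k" "mat_in N N x" "eventually (\<lambda>q. cyclic N (A q)) Fl"
  shows "mat_in N N (\<lambda>q. transport (A q) (k q) (x q))"
proof (rule mat_in_cong)
  show "mat_in N N (\<lambda>q. mat_poly N (coef (A q) (k q)) (x q))"
    by (intro mat_in_mat_poly assms(3) in_coef[OF assms(1,2,4)])
  show "eventually (\<lambda>q. transport (A q) (k q) (x q) = mat_poly N (coef (A q) (k q)) (x q)) Fl"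
    using assms(4) by eventually_elim (auto simp: transport_def dest!: cyclic_carrier)
qed

text \<open>
  Applied to regular functions this gives algebraicity; applied to functions of one variable it
  gives differentiability of the orbit curves.
\<close>

lemma mat_in_moved:
  assumes "decomposition_data n D"
    and "eventually (\<lambda>q. K q \<in> carrier (Z_group n D)) Fl" "eventually (\<lambda>q. P q \<in> cover n D) Fl"
    and "\<And>i. 1 \<le> i \<Longrightarrow> i < n \<Longrightarrow> mat_in i i (\<lambda>q. K q ! (i - 1))"
    and "\<And>i. 1 \<le> i \<Longrightarrow> i < n \<Longrightarrow> mat_in i i (\<lambda>q. P q ! i)"
    and "mat_in n n (\<lambda>q. P q ! 0)"
  shows "mat_in n n (\<lambda>q. moved n D (K q) (P q))"
proof -
  interpret decomposition_data n D by (rule assms)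
  have cyc: "eventually (\<lambda>q. cyclic i (P q ! i + principal_nilpotent (D i))) Fl" if "1 \<le> i" "i < n" for i
    using assms(3) by eventually_elim (use coverD(7) that in auto)
  have factor: "mat_in i i (\<lambda>q. act_factor D (K q) (P q) i)" if i: "1 \<le> i" "i \<le> n - 1" for i
  proof -
    have i: "1 \<le> i" "i < n" "i \<le> n" using that n_pos by auto
    have "principal_nilpotent (D i) \<in> carrier_mat i i" using principal_nilpotent_carrier[of "D i"] sum_blocks[OF i(1,3)] by simp
    then show ?thesis unfolding act_factor_def
      by (intro mat_in_transport mat_in_add mat_in_const mat_in_corner[of n] cyc assms(4-6) i)
  qed
  have "eventually (\<lambda>q. inv_family (n - 1) (act_factor D (K q) (P q))) Fl"
    using assms(2,3) by eventually_elim (rule act_factor_family)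
  then show ?thesis unfolding moved_def
    by (intro mat_in_conjugate_gprod factor assms(6)) auto
qed

end

lemma reg_coord:
  assumes "V \<subseteq> aff ds" "k < length ds"
  shows "reg.mat_in ds V (ds ! k) (ds ! k) (\<lambda>p. p ! k)"
  using assms by (intro reg.mat_inI) (auto simp: eventually_principal aff_iff intro!: regular_poly poly_fun.coord)

context decomposition_data
begin

lemma Z_aff: "Z \<subseteq> aff (Z_shape n)"
proof
  fix k assume k: "k \<in> Z"
  have "k ! j \<in> carrier_mat (Z_shape n ! j) (Z_shape n ! j)" if "j < n - 1" for j
    using ZD(2)[OF k, of "Suc j"] Z_shape_nth(1)[of "Suc j"] that by simp
  then show "k \<in> aff (Z_shape n)" using ZD(1)[OF k] Z_shape_nth(2) by (simp add: aff_iff)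
qed

lemma act_morphism:
  "morphism (Z_shape n @ cover_shape n) (cover_shape n) {k @ p | k p. k \<in> Z \<and> p \<in> cover n D} (cover n D)
     (\<lambda>m. act n D (take (n - 1) m) (drop (n - 1) m))"
  (is "morphism ?ds ?es ?V _ ?f")
  unfolding morphism_def
proof (intro conjI)
  have V: "take (n - 1) m \<in> Z" "drop (n - 1) m \<in> cover n D" if "m \<in> ?V" for m
    using that ZD(1) by auto
  show "?f \<in> ?V \<rightarrow> cover n D" using V act_cover by blast
  have aff: "?V \<subseteq> aff ?ds"
    using Z_aff cover_aff by (auto simp: aff_def intro!: list_all2_appendI)
  have len: "length ?ds = n - 1 + Suc n" using Z_shape_nth(2) cover_shape_nth(3) by simp
  have P: "reg.mat_in ?ds ?V (?es ! i) (?es ! i) (\<lambda>m. drop (n - 1) m ! i)" if "i \<le> n" for i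
  proof (rule reg.mat_in_cong)
    show "reg.mat_in ?ds ?V (?es ! i) (?es ! i) (\<lambda>m. m ! (n - 1 + i))"
      using reg_coord[OF aff, of "n - 1 + i"] that len Z_shape_nth(2) by (simp add: nth_append)
    show "eventually (\<lambda>m. drop (n - 1) m ! i = m ! (n - 1 + i)) (principal ?V)"
      using aff len by (auto simp: eventually_principal aff_iff subset_iff)
  qed
  have K: "reg.mat_in ?ds ?V i i (\<lambda>m. take (n - 1) m ! (i - 1))" if i: "1 \<le> i" "i < n" for i
  proof (rule reg.mat_in_cong)
    have "i - 1 < length (Z_shape n)" using i by (simp add: Z_shape_nth(2))
    then have "?ds ! (i - 1) = i" by (simp only: nth_append if_True Z_shape_nth(1)[OF i])
    then show "reg.mat_in ?ds ?V i i (\<lambda>m. m ! (i - 1))"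
      using reg_coord[OF aff, of "i - 1"] i len by simp
    show "eventually (\<lambda>m. take (n - 1) m ! (i - 1) = m ! (i - 1)) (principal ?V)"
      using i by (auto simp: eventually_principal)
  qed
  have X: "reg.mat_in ?ds ?V n n (\<lambda>m. moved n D (take (n - 1) m) (drop (n - 1) m))"
  proof (rule reg.mat_in_moved[OF decomposition_data_axioms])
    show "reg.mat_in ?ds ?V n n (\<lambda>m. drop (n - 1) m ! 0)" using P[of 0] cover_shape_nth(2) by simp
    show "reg.mat_in ?ds ?V i i (\<lambda>m. drop (n - 1) m ! i)" if "1 \<le> i" "i < n" for i
      using P[of i] cover_shape_nth(1)[of i] that by simp
  qed (use V K in \<open>auto simp: eventually_principal\<close>)
  have F: "reg.mat_in ?ds ?V (?es ! j) (?es ! j) (\<lambda>m. ?f m ! j)" if "j \<le> n" for j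
  proof (cases j)
    case 0
    show ?thesis
      by (rule reg.mat_in_cong) (use X V 0 act_nth(1) cover_shape_nth(2) in \<open>auto simp: eventually_principal\<close>)
  next
    case (Suc i)
    show ?thesis
      by (rule reg.mat_in_cong[OF P[OF that]]) (use V Suc act_nth(2) that in \<open>auto simp: eventually_principal\<close>)
  qed
  show "\<forall>j<length ?es. \<forall>a<?es ! j. \<forall>b<?es ! j. regular_fun ?ds ?V (\<lambda>m. ?f m ! j $$ (a, b))"
  proof (intro allI impI)
    fix j a b assume "j < length ?es" and ab: "a < ?es ! j" "b < ?es ! j"
    then have "j \<le> n" by (simp add: cover_shape_nth(3))
    then show "regular_fun ?ds ?V (\<lambda>m. ?f m ! j $$ (a, b))" using reg.mat_inD(2)[OF F ab] by simp
  qed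
qed

lemma act_algebraic: "algebraic_action n D (act n D)"
  unfolding algebraic_action_def using act_group_action act_morphism by blast

end

section \<open>The Lie algebra of the group\<close>

context decomposition_data
begin

abbreviation shifted :: "point \<Rightarrow> nat \<Rightarrow> complex mat" where "shifted zs i \<equiv> zs ! (i - 1) + e i"

abbreviation one :: point where "one \<equiv> \<one>\<^bsub>Z_group n D\<^esub>"

lemma one_aff: "one \<in> aff (Z_shape n)"
  using Z_one_closed Z_aff by blast

lemma Z_line_nth:
  assumes "Y \<in> aff (Z_shape n)" "1 \<le> i" "i < n"
  shows "pt_add one (pt_scale t Y) ! (i - 1) = 1\<^sub>m i + t \<cdot>\<^sub>m Y ! (i - 1)"
  using assms Z_one(2)[OF assms(2,3)] Z_one(1) Z_shape_nth(2)
  by (subst pt_add_nth) (auto simp: pt_scale_nth aff_iff)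

lemma aff_Z_nth:
  assumes "Y \<in> aff (Z_shape n)" "1 \<le> i" "i < n"
  shows "Y ! (i - 1) \<in> carrier_mat i i"
proof -
  have "i - 1 < length (Z_shape n)" using assms by (simp add: Z_shape_nth(2))
  then have "Y ! (i - 1) \<in> carrier_mat (Z_shape n ! (i - 1)) (Z_shape n ! (i - 1))" using assms(1) by (simp add: aff_iff)
  then show ?thesis unfolding Z_shape_nth(1)[OF assms(2,3)] .
qed

lemma tuplesD:
  assumes "zs \<in> center_tuples n D" "1 \<le> i" "i \<le> n"
  shows "zs ! (i - 1) \<in> levi_center_gen (D i)" "cyclic i (shifted zs i)" "shifted zs i \<in> carrier_mat i i"
proof -
  show z: "zs ! (i - 1) \<in> levi_center_gen (D i)" using assms by (simp add: center_tuples_iff)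
  show "cyclic i (shifted zs i)" using levi_cyclic[OF z] sum_blocks[OF assms(2,3)] by simp
  then show "shifted zs i \<in> carrier_mat i i" by (rule cyclic_carrier)
qed

lemma Z_curve:
  assumes zs: "zs \<in> center_tuples n D" and Y: "Y \<in> aff (Z_shape n)"
    and comm: "\<And>i. 1 \<le> i \<Longrightarrow> i < n \<Longrightarrow> shifted zs i * Y ! (i - 1) = Y ! (i - 1) * shifted zs i"
  shows "eventually (\<lambda>t. pt_add one (pt_scale t Y) \<in> Z) (nhds 0)"
proof -
  have "eventually (\<lambda>t. \<forall>i\<in>{1..<n}. det (1\<^sub>m i + t \<cdot>\<^sub>m Y ! (i - 1)) \<noteq> 0) (nhds 0)"
  proof (intro eventually_ball_finite ballI field_differentiable_eventually_nz)
    fix i assume i: "i \<in> {1..<n}"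
    then have Yi: "Y ! (i - 1) \<in> carrier_mat i i" using aff_Z_nth[OF Y] by simp
    show "(\<lambda>t. det (1\<^sub>m i + t \<cdot>\<^sub>m Y ! (i - 1))) field_differentiable at 0"
      using dif.in_det[OF dif_line[OF one_carrier_mat Yi]] by simp
    have "1\<^sub>m i + 0 \<cdot>\<^sub>m Y ! (i - 1) = 1\<^sub>m i" using Yi by (intro eq_matI) auto
    then show "det (1\<^sub>m i + 0 \<cdot>\<^sub>m Y ! (i - 1)) \<noteq> 0" by simp
  qed simp
  then show ?thesis
  proof eventually_elim
    case (elim t)
    show ?case unfolding Z_iff
    proof (intro conjI allI impI)
      show "length (pt_add one (pt_scale t Y)) = n - 1"
        using Y Z_one(1) Z_shape_nth(2) by (simp add: aff_iff)
      fix i assume i: "1 \<le> i" "i < n"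
      then have i': "i \<le> n" by simp
      let ?A = "shifted zs i" and ?Y = "Y ! (i - 1)"
      note A = tuplesD(3)[OF zs i(1) i'] and Yi = aff_Z_nth[OF Y i]
      have "?A * (1\<^sub>m i + t \<cdot>\<^sub>m ?Y) = ?A + t \<cdot>\<^sub>m (?A * ?Y)"
        using mult_add_distrib_mat[OF A one_carrier_mat, of "t \<cdot>\<^sub>m ?Y"] mult_smult_distrib[OF A Yi] Yi
          right_mult_one_mat[OF A] by simp
      also have "\<dots> = (1\<^sub>m i + t \<cdot>\<^sub>m ?Y) * ?A"
        using add_mult_distrib_mat[OF one_carrier_mat _ A, of "t \<cdot>\<^sub>m ?Y"] mult_smult_assoc_mat[OF Yi A] Yi
          left_mult_one_mat[OF A] comm[OF i] by simp
      finally show "pt_add one (pt_scale t Y) ! (i - 1) \<in> levi_centralizer (D i)"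
        unfolding levi_centralizer_iff[OF tuplesD(1)[OF zs i(1) i']] sum_blocks[OF i(1) i'] Z_line_nth[OF Y i]
        using elim i Yi by auto
    qed
  qed
qed

lemma Z_line_0: "Y \<in> aff (Z_shape n) \<Longrightarrow> pt_add one (pt_scale 0 Y) = one"
  using one_aff by (rule line_at_0)

text \<open>
  The equations of the centralizer are linear, so they hold for tangent vectors; conversely
  \<open>1 + t Y\<close> lies in the group for small \<open>t\<close>.
\<close>

lemma Z_lie_iff:
  assumes zs: "zs \<in> center_tuples n D"
  shows "Y \<in> Z_lie n D \<longleftrightarrow> Y \<in> aff (Z_shape n) \<and>
    (\<forall>i. 1 \<le> i \<longrightarrow> i < n \<longrightarrow> shifted zs i * Y ! (i - 1) = Y ! (i - 1) * shifted zs i)"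
proof
  assume "Y \<in> aff (Z_shape n) \<and>
    (\<forall>i. 1 \<le> i \<longrightarrow> i < n \<longrightarrow> shifted zs i * Y ! (i - 1) = Y ! (i - 1) * shifted zs i)"
  then show "Y \<in> Z_lie n D"
    using tangent_curve[of "\<lambda>t. pt_add one (pt_scale t Y)" "Z_shape n" Y Z] Z_curve[OF zs, of Y]
      line_has_tangent[OF one_aff, of Y] Z_line_0[of Y] one_aff
    by (simp add: Z_lie_def)
next
  assume Y: "Y \<in> Z_lie n D"
  then have Ya: "Y \<in> aff (Z_shape n)" unfolding Z_lie_def by (rule tangent_aff)
  have "shifted zs i * Y ! (i - 1) = Y ! (i - 1) * shifted zs i" if i: "1 \<le> i" "i < n" for i
  proof -
    have i': "i \<le> n" using i by simp
    let ?A = "shifted zs i" and ?Y = "Y ! (i - 1)"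
    note A = tuplesD(3)[OF zs i(1) i'] and Yi = aff_Z_nth[OF Ya i]
    let ?F = "\<lambda>k. ?A * corner i (k ! (i - 1)) - corner i (k ! (i - 1)) * ?A"
    have "?A * ?Y - ?Y * ?A = 0\<^sub>m i i"
    proof (rule eq_matI)
      fix a b assume "a < dim_row (0\<^sub>m i i :: complex mat)" "b < dim_col (0\<^sub>m i i :: complex mat)"
      then have ab: "a < i" "b < i" by auto
      have "poly.mat_in (Z_shape n) i i (\<lambda>k. corner i (k ! (i - 1)))"
        using i Z_shape_nth(2) Z_shape_nth(1)[OF i] by (intro poly_corner) simp_all
      then have "poly.mat_in (Z_shape n) i i ?F"
        by (intro poly.mat_in_diff poly.mat_in_mult[of _ i i] poly.mat_in_const A)
      then have "(\<lambda>k. ?F k $$ (a, b)) \<in> poly_fun (Z_shape n)" using ab by (rule poly.mat_inD(2))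
      from tangentD[OF Y[unfolded Z_lie_def] this]
      have "diff (\<lambda>k. ?F k $$ (a, b)) one Y = 0" if "\<And>k. k \<in> Z \<Longrightarrow> ?F k $$ (a, b) = 0" using that .
      moreover have "?F k $$ (a, b) = 0" if k: "k \<in> Z" for k
      proof -
        note h = k[unfolded Z_iff, THEN conjunct2, rule_format, OF i,
          unfolded levi_centralizer_iff[OF tuplesD(1)[OF zs i(1) i']] sum_blocks[OF i(1) i']]
        note g = h[THEN conjunct1] and comm = h[THEN conjunct2, THEN conjunct2]
        have "?F k = 0\<^sub>m i i"
          unfolding corner_id[OF g] comm by (rule minus_r_inv_mat[OF mult_carrier_sq[OF g A]])
        then show ?thesis by (simp only: index_zero_mat(1)[OF ab])
      qed
      ultimately have "diff (\<lambda>k. ?F k $$ (a, b)) one Y = 0" .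
      moreover have "diff (\<lambda>k. ?F k $$ (a, b)) one Y = (?A * ?Y - ?Y * ?A) $$ (a, b)"
      proof (rule diff_eqI)
        have l: "has_mat_deriv i (\<lambda>t. 1\<^sub>m i + t \<cdot>\<^sub>m ?Y) ?Y" using Yi by (intro has_mat_deriv_line) auto
        have one0: "1\<^sub>m i + 0 \<cdot>\<^sub>m ?Y = 1\<^sub>m i" using Yi by (intro eq_matI) auto
        have "has_mat_deriv i (\<lambda>t. ?A * (1\<^sub>m i + t \<cdot>\<^sub>m ?Y) - (1\<^sub>m i + t \<cdot>\<^sub>m ?Y) * ?A)
            ((0\<^sub>m i i * (1\<^sub>m i + 0 \<cdot>\<^sub>m ?Y) + ?A * ?Y) - (?Y * ?A + (1\<^sub>m i + 0 \<cdot>\<^sub>m ?Y) * 0\<^sub>m i i))"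
          by (intro has_mat_deriv_diff has_mat_deriv_mult l has_mat_deriv_const A)
        moreover have "(0\<^sub>m i i * (1\<^sub>m i + 0 \<cdot>\<^sub>m ?Y) + ?A * ?Y) - (?Y * ?A + (1\<^sub>m i + 0 \<cdot>\<^sub>m ?Y) * 0\<^sub>m i i) = ?A * ?Y - ?Y * ?A"
          unfolding one0 using A Yi left_add_zero_mat[of "?A * ?Y" i i] right_add_zero_mat[of "?Y * ?A" i i] by simp
        ultimately have d: "has_mat_deriv i (\<lambda>t. ?A * (1\<^sub>m i + t \<cdot>\<^sub>m ?Y) - (1\<^sub>m i + t \<cdot>\<^sub>m ?Y) * ?A) (?A * ?Y - ?Y * ?A)"
          by simp
        have "corner i (1\<^sub>m i + t \<cdot>\<^sub>m ?Y) = 1\<^sub>m i + t \<cdot>\<^sub>m ?Y" for t using Yi by (intro corner_id) auto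
        then show "((\<lambda>t. ?F (pt_add one (pt_scale t Y)) $$ (a, b)) has_field_derivative (?A * ?Y - ?Y * ?A) $$ (a, b)) (at 0)"
          using has_mat_derivD(3)[OF d ab] by (simp only: Z_line_nth[OF Ya i])
      qed
      ultimately show "(?A * ?Y - ?Y * ?A) $$ (a, b) = 0\<^sub>m i i $$ (a, b)" using ab by simp
    qed (use A Yi in auto)
    note z = this
    show ?thesis
    proof (rule eq_matI)
      fix a b assume "a < dim_row (?Y * ?A)" "b < dim_col (?Y * ?A)"
      then have ab: "a < i" "b < i" "a < dim_row (?Y * ?A)" "b < dim_col (?Y * ?A)" 
        using carrier_matD[OF Yi] carrier_matD[OF A] by auto
      have "(?A * ?Y - ?Y * ?A) $$ (a, b) = 0" unfolding z using ab(1,2) by simp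
      then show "(?A * ?Y) $$ (a, b) = (?Y * ?A) $$ (a, b)" unfolding index_minus_mat(1)[OF ab(3,4)] by simp
    qed (use carrier_matD[OF Yi] carrier_matD[OF A] in auto)
  qed
  then show "Y \<in> aff (Z_shape n) \<and>
    (\<forall>i. 1 \<le> i \<longrightarrow> i < n \<longrightarrow> shifted zs i * Y ! (i - 1) = Y ! (i - 1) * shifted zs i)" using Ya by blast
qed

section \<open>The infinitesimal action\<close>

text \<open>
  The sign comes from \<open>Ad(1 + t y) x = x + t [y, x] + \<dots>\<close>, while the fields are of the form \<open>[x, y]\<close>.
\<close>

definition lie_coef :: "point \<Rightarrow> point \<Rightarrow> nat \<times> nat \<Rightarrow> complex" where
  "lie_coef zs Y m = - coef (shifted zs (fst m)) (Y ! (fst m - 1)) (snd m)"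

lemma cover_tuples: "p \<in> cover n D \<Longrightarrow> tl p \<in> center_tuples n D"
  and cover_shifted: "p \<in> cover n D \<Longrightarrow> 1 \<le> i \<Longrightarrow> i \<le> n \<Longrightarrow> shifted (tl p) i = p ! i + e i"
proof -
  have "tl p ! (i - 1) = p ! i" if "p \<in> cover n D" "1 \<le> i" "i \<le> n" for i
    using coverD(1)[OF that(1)] that by (subst nth_tl) auto
  then show "p \<in> cover n D \<Longrightarrow> tl p \<in> center_tuples n D"
    and "p \<in> cover n D \<Longrightarrow> 1 \<le> i \<Longrightarrow> i \<le> n \<Longrightarrow> shifted (tl p) i = p ! i + e i"
    using coverD(1,4) by (auto simp: center_tuples_iff)
qed

lemma moved_deriv:
  assumes p: "p \<in> cover n D" and Y: "Y \<in> Z_lie n D"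
  shows "has_mat_deriv n (\<lambda>t. moved n D (pt_add one (pt_scale t Y)) p) (gz_comb n (lie_coef (tl p) Y) (p ! 0))"
proof -
  let ?x = "p ! 0" and ?k = "\<lambda>t. pt_add one (pt_scale t Y)"
  note zs = cover_tuples[OF p]
  have x: "?x \<in> carrier_mat n n" by (rule coverD(3)[OF p])
  have Ya: "Y \<in> aff (Z_shape n)" and comm: "\<And>i. 1 \<le> i \<Longrightarrow> i < n \<Longrightarrow> shifted (tl p) i * Y ! (i - 1) = Y ! (i - 1) * shifted (tl p) i"
    using Y unfolding Z_lie_iff[OF zs] by blast+
  have ev: "eventually (\<lambda>t. ?k t \<in> Z) (nhds 0)" using zs Ya comm by (rule Z_curve)
  define y where "y i = transport (p ! i + e i) (Y ! (i - 1)) (corner i ?x)" for i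
  have factor: "act_factor D (?k t) p i = 1\<^sub>m i + t \<cdot>\<^sub>m y i" if i: "1 \<le> i" "i \<le> n - 1" for i t
  proof -
    have i: "1 \<le> i" "i < n" "i \<le> n" using i n_pos by auto
    show ?thesis unfolding act_factor_def Z_line_nth[OF Ya i(1,2)] y_def
      by (rule transport_line[OF coverD(7)[OF p i(1,3)] corner_carrier coverD(6)[OF p i(1,3)] aff_Z_nth[OF Ya i(1,2)]])
  qed
  have yc: "y i \<in> carrier_mat i i" for i by (simp add: y_def)
  define M where "M t = gprod n (act_factor D (?k t) p) (n - 1)" for t
  define G where "G = mat n n (\<lambda>(a, b). \<Sum>i=1..n - 1. pad n (y i) $$ (a, b))"
  have G: "G \<in> carrier_mat n n" by (simp add: G_def)
  have M: "has_mat_deriv n M G" unfolding M_def G_def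
  proof (rule has_mat_deriv_gprod)
    fix i assume i: "1 \<le> i" "i \<le> n - 1"
    show "has_mat_deriv i (\<lambda>t. act_factor D (?k t) p i) (y i)"
      unfolding factor[OF i] by (rule has_mat_deriv_line) (auto simp: yc)
    show "act_factor D (?k 0) p i = 1\<^sub>m i"
      unfolding factor[OF i] using carrier_matD[OF yc[of i]] by (intro eq_matI) auto
  qed simp
  have M0: "M 0 = 1\<^sub>m n" unfolding M_def
    by (rule gprod_ones) (use factor carrier_matD[OF yc] in \<open>auto intro!: eq_matI\<close>)
  let ?W = "\<lambda>t. moved n D (?k t) p"
  have W0: "?W 0 = ?x" using M0 conjugate_one[OF x] by (simp add: moved_def M_def)
  have "dif.mat_in n n ?W"
  proof (rule dif.mat_in_moved[OF decomposition_data_axioms ev])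
    fix i assume i: "1 \<le> i" "i < n"
    have "dif.mat_in i i (\<lambda>t. 1\<^sub>m i + t \<cdot>\<^sub>m Y ! (i - 1))" using aff_Z_nth[OF Ya i] by (intro dif_line) auto
    then show "dif.mat_in i i (\<lambda>t. ?k t ! (i - 1))" unfolding Z_line_nth[OF Ya i] .
    show "dif.mat_in i i (\<lambda>t. p ! i)" using coverD(5)[OF p, of i] i by (intro dif.mat_in_const) simp
  qed (use p x in \<open>auto intro: dif.mat_in_const\<close>)
  then obtain W' where W': "has_mat_deriv n ?W W'" by (rule dif_mat_deriv) (simp add: p)
  have W'c: "W' \<in> carrier_mat n n" using has_mat_derivD(2)[OF W'] .
  \<comment> \<open>differentiating this relation avoids the derivative of an inverse matrix\<close>
  have "eventually (\<lambda>t. ?W t * M t = M t * ?x) (nhds 0)"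
    using ev
  proof eventually_elim
    case (elim t)
    have "det (M t) \<noteq> 0" unfolding M_def by (intro det_gprod act_factor_family elim p) simp
    then show ?case using conjugate_iff[of "M t" n ?x "?W t"] x p by (simp add: moved_def M_def)
  qed
  from has_mat_deriv_cong_unique[OF has_mat_deriv_mult[OF W' M] has_mat_deriv_mult[OF M has_mat_deriv_const[OF x]] this]
  have "W' * M 0 + ?W 0 * G = G * ?x + M 0 * 0\<^sub>m n n" .
  then have e: "W' + ?x * G = G * ?x"
    unfolding M0 W0 right_mult_one_mat[OF W'c] using G x right_add_zero_mat[of "G * ?x" n n] by simp
  have gen: "G = gz_gen n (\<lambda>m. - lie_coef (tl p) Y m) ?x"
  proof (rule eq_matI)
    fix a b assume "a < dim_row (gz_gen n (\<lambda>m. - lie_coef (tl p) Y m) ?x)" "b < dim_col (gz_gen n (\<lambda>m. - lie_coef (tl p) Y m) ?x)"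
    then have ab: "a < n" "b < n" by auto
    let ?c = "\<lambda>i j. coef (p ! i + e i) (Y ! (i - 1)) j"
    have pad_y: "pad n (y i) $$ (a, b) = (\<Sum>j<i. ?c i j * pad n (corner i ?x ^\<^sub>m j) $$ (a, b))"
      if i: "1 \<le> i" "i < n" for i
    proof -
      have "dim_row (p ! i + e i) = i" using carrier_matD(1)[OF cyclic_carrier[OF coverD(7)[OF p, of i]]] i by linarith
      then have "y i = mat_poly i (?c i) (corner i ?x)" unfolding y_def transport_def by (simp only:)
      then show ?thesis using ab by (auto simp: pad_def mat_poly_def)
    qed
    have "G $$ (a, b) = (\<Sum>i\<in>{1..<n}. pad n (y i) $$ (a, b))"
      using ab n_pos by (auto simp: G_def intro!: sum.cong)
    also have "\<dots> = (\<Sum>i\<in>{1..<n}. \<Sum>j<i. ?c i j * pad n (corner i ?x ^\<^sub>m j) $$ (a, b))"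
      by (intro sum.cong refl) (simp add: pad_y)
    also have "\<dots> = (\<Sum>m\<in>gz_index n. - lie_coef (tl p) Y m * pad n (corner (fst m) ?x ^\<^sub>m snd m) $$ (a, b))"
      unfolding gz_index_def using cover_shifted[OF p]
      by (subst sum.Sigma) (auto simp: lie_coef_def intro!: sum.cong)
    finally show "G $$ (a, b) = gz_gen n (\<lambda>m. - lie_coef (tl p) Y m) ?x $$ (a, b)" using ab by (simp add: gz_gen_def)
  qed (use G in auto)
  have "W' = gz_comb n (lie_coef (tl p) Y) ?x"
  proof (rule eq_matI)
    fix a b assume "a < dim_row (gz_comb n (lie_coef (tl p) Y) ?x)" "b < dim_col (gz_comb n (lie_coef (tl p) Y) ?x)"
    then have ab: "a < n" "b < n" by (auto simp: gz_comb_def)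
    have "(W' + ?x * G) $$ (a, b) = (G * ?x) $$ (a, b)" using e by simp
    then have "W' $$ (a, b) + (?x * G) $$ (a, b) = (G * ?x) $$ (a, b)"
      using ab G x by (simp del: index_mult_mat(1))
    moreover have "gz_comb n (\<lambda>m. - lie_coef (tl p) Y m) ?x $$ (a, b) = (?x * G) $$ (a, b) - (G * ?x) $$ (a, b)"
      unfolding gz_comb_commutator[OF x] gen[symmetric] commutator_def using ab G x by (simp del: index_mult_mat(1))
    ultimately show "W' $$ (a, b) = gz_comb n (lie_coef (tl p) Y) ?x $$ (a, b)"
      using ab by (simp add: gz_comb_def sum_negf algebra_simps)
  qed (use W'c in \<open>auto simp: gz_comb_def\<close>)
  then show ?thesis using W' by simp
qed

text \<open>
  Every polynomial in the cyclic matrix \<open>z\<^sub>i + e\<^sup>i\<close> lies in the Lie algebra.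
\<close>

lemma lie_coef_surj:
  assumes zs: "zs \<in> center_tuples n D"
  obtains Y where "Y \<in> Z_lie n D" "\<And>m. m \<in> gz_index n \<Longrightarrow> lie_coef zs Y m = c m"
proof -
  define Y where "Y = map (\<lambda>i. mat_poly i (\<lambda>j. - c (i, j)) (shifted zs i)) [1..<n]"
  have nth: "Y ! (i - 1) = mat_poly i (\<lambda>j. - c (i, j)) (shifted zs i)" if "1 \<le> i" "i < n" for i
  proof -
    have "[1..<n] ! (i - 1) = i" "i - 1 < length [1..<n]" using that by (auto simp: nth_upt)
    then show ?thesis unfolding Y_def by (simp only: nth_map)
  qed
  have "Y ! j \<in> carrier_mat (Z_shape n ! j) (Z_shape n ! j)" if "j < n - 1" for j
    using nth[of "Suc j"] tuplesD(3)[OF zs, of "Suc j"] Z_shape_nth(1)[of "Suc j"] that by simp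
  then have Ya: "Y \<in> aff (Z_shape n)" by (simp add: aff_iff Z_shape_nth(2)) (simp add: Y_def)
  have "Y \<in> Z_lie n D" unfolding Z_lie_iff[OF zs]
  proof (intro conjI Ya allI impI)
    fix i assume i: "1 \<le> i" "i < n"
    then have "i \<le> n" by simp
    show "shifted zs i * Y ! (i - 1) = Y ! (i - 1) * shifted zs i"
      unfolding nth[OF i] by (rule mat_poly_commute[OF tuplesD(3)[OF zs i(1) \<open>i \<le> n\<close>]])
  qed
  moreover have "lie_coef zs Y m = c m" if mi: "m \<in> gz_index n" for m
  proof -
    obtain i j where m: "m = (i, j)" "1 \<le> i" "i < n" "j < i" using mi by (cases m) (auto simp: gz_index_def)
    then show ?thesis using coef_mat_poly[OF tuplesD(2)[OF zs, of i], of j "\<lambda>j. - c (i, j)"]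
      unfolding lie_coef_def m(1) fst_conv snd_conv nth[OF m(2,3)] by simp
  qed
  ultimately show ?thesis using that by blast
qed

section \<open>The lift\<close>

definition lifted :: "(nat \<times> nat \<Rightarrow> complex) \<Rightarrow> point \<Rightarrow> point" where
  "lifted c = (\<lambda>p\<in>cover n D. gz_comb n c (p ! 0) # map (\<lambda>i. 0\<^sub>m i i) [1..<Suc n])"

lemma lifted_nth:
  assumes "p \<in> cover n D"
  shows "lifted c p ! 0 = gz_comb n c (p ! 0)" "1 \<le> i \<Longrightarrow> i \<le> n \<Longrightarrow> lifted c p ! i = 0\<^sub>m i i"
    "length (lifted c p) = Suc n"
  using assms by (auto simp: lifted_def nth_Cons' simp del: upt_Suc)

lemma cover_point_eqI:
  assumes "length v = Suc n" "length w = Suc n" "v ! 0 = w ! 0"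
    and "\<And>i. 1 \<le> i \<Longrightarrow> i \<le> n \<Longrightarrow> v ! i = w ! i"
  shows "v = (w :: point)"
proof (rule nth_equalityI)
  fix i assume "i < length v"
  then show "v ! i = w ! i" using assms by (cases i) auto
qed (use assms in simp)

lemma aff_cover_iff:
  "v \<in> aff (cover_shape n) \<longleftrightarrow> length v = Suc n \<and> v ! 0 \<in> carrier_mat n n \<and>
     (\<forall>i. 1 \<le> i \<longrightarrow> i \<le> n \<longrightarrow> v ! i \<in> carrier_mat i i)"
proof -
  have "(\<forall>k<Suc n. v ! k \<in> carrier_mat (cover_shape n ! k) (cover_shape n ! k)) \<longleftrightarrow>
    v ! 0 \<in> carrier_mat n n \<and> (\<forall>i. 1 \<le> i \<longrightarrow> i \<le> n \<longrightarrow> v ! i \<in> carrier_mat i i)" (is "?L = ?R")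
  proof
    assume L: ?L
    show ?R
    proof (intro conjI allI impI)
      show "v ! 0 \<in> carrier_mat n n" using L[rule_format, of 0] cover_shape_nth(2) by simp
      fix i assume "1 \<le> i" "i \<le> n"
      then show "v ! i \<in> carrier_mat i i" using L[rule_format, of i] cover_shape_nth(1)[of i] by simp
    qed
  next
    assume R: ?R
    show ?L
    proof (intro allI impI)
      fix k assume "k < Suc n"
      then show "v ! k \<in> carrier_mat (cover_shape n ! k) (cover_shape n ! k)"
        using R cover_shape_nth(1)[of k] cover_shape_nth(2) by (cases "k = 0") auto
    qed
  qed
  then show ?thesis by (simp add: aff_iff cover_shape_nth(3))
qed

lemma lifted_aff: "p \<in> cover n D \<Longrightarrow> lifted c p \<in> aff (cover_shape n)"
  using lifted_nth by (auto simp: aff_cover_iff)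

text \<open>
  It is the velocity of an orbit curve, for a suitable element of the Lie algebra.
\<close>

lemma lifted_tangent:
  assumes p: "p \<in> cover n D"
  shows "lifted c p \<in> tangent (cover_shape n) (cover n D) p"
proof -
  obtain Y where Y: "Y \<in> Z_lie n D" and c: "\<And>m. m \<in> gz_index n \<Longrightarrow> lie_coef (tl p) Y m = c m"
    using lie_coef_surj[OF cover_tuples[OF p], of c] by blast
  let ?k = "\<lambda>t. pt_add one (pt_scale t Y)"
  have Ya: "Y \<in> aff (Z_shape n)" using Y unfolding Z_lie_def by (rule tangent_aff)
  have act0: "act n D (?k 0) p = p" unfolding Z_line_0[OF Ya] by (rule act_one[OF p])
  have "has_mat_deriv n (\<lambda>t. moved n D (?k t) p) (gz_comb n c (p ! 0))"
    using moved_deriv[OF p Y] gz_comb_cong[of n "lie_coef (tl p) Y" c] c by simp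
  note d = has_mat_derivD(3)[OF this]
  have tan: "has_tangent (cover_shape n) (\<lambda>t. act n D (?k t) p) (lifted c p)"
    unfolding has_tangent_def
  proof (intro allI impI)
    fix j a b assume j: "j < length (cover_shape n)" and ab: "a < cover_shape n ! j" "b < cover_shape n ! j"
    show "((\<lambda>t. act n D (?k t) p ! j $$ (a, b)) has_field_derivative lifted c p ! j $$ (a, b)) (at 0)"
    proof (cases "j = 0")
      case True
      then show ?thesis using d[of a b] ab cover_shape_nth(2) by (simp add: act_nth(1)[OF p] lifted_nth(1)[OF p])
    next
      case False
      then have "1 \<le> j" "j \<le> n" using j cover_shape_nth(3) by auto
      then show ?thesis using ab cover_shape_nth(1)[of j] act_nth(2)[OF p, of j] lifted_nth(2)[OF p, of j c] by simp
    qed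
  qed
  have "eventually (\<lambda>t. ?k t \<in> Z) (nhds 0)"
    using Y unfolding Z_lie_iff[OF cover_tuples[OF p]] by (intro Z_curve[OF cover_tuples[OF p]]) auto
  then have "eventually (\<lambda>t. act n D (?k t) p \<in> cover n D) (nhds 0)"
    by eventually_elim (rule act_cover[OF _ p])
  from tangent_curve[OF _ lifted_aff[OF p] tan this] show ?thesis
    unfolding act0 using cover_aff p by blast
qed

lemma tangent_map_proj:
  assumes p: "p \<in> cover n D" and v: "v \<in> tangent (cover_shape n) (cover n D) p"
  shows "tangent_map (cover_shape n) [n] (cover n D) cover_proj p v = [v ! 0]"
proof -
  have pa: "p \<in> aff (cover_shape n)" and va: "v \<in> aff (cover_shape n)" using cover_aff p tangent_aff[OF v] by auto
  have "diff_on (cover_shape n) (cover n D) (\<lambda>q. cover_proj q ! 0 $$ (a, b)) p v = v ! 0 $$ (a, b)"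
    if ab: "a < n" "b < n" for a b
  proof -
    have "diff_on (cover_shape n) (cover n D) (\<lambda>q. cover_proj q ! 0 $$ (a, b)) p v = diff (\<lambda>q. q ! 0 $$ (a, b)) p v"
      by (rule diff_on_poly[OF p cover_aff v])
        (use ab cover_shape_nth(2,3) in \<open>auto simp: cover_proj_def intro!: poly_fun.coord\<close>)
    also have "\<dots> = v ! 0 $$ (a, b)" by (rule diff_coord[OF pa va]) (use ab cover_shape_nth(2,3) in auto)
    finally show ?thesis .
  qed
  then have "mat n n (\<lambda>(a, b). diff_on (cover_shape n) (cover n D) (\<lambda>q. cover_proj q ! 0 $$ (a, b)) p v) = v ! 0"
    using va by (intro eq_matI) (auto simp: aff_cover_iff)
  then show ?thesis by (simp add: tangent_map_def)
qed

text \<open>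
  The functions used are the linear equations of the center and the differences of the traces of
  powers of \<open>x\<^sub>i\<close> and of \<open>z\<^sub>i + e\<^sup>i\<close>, which vanish on the covering as these matrices are similar.
\<close>

lemma tangent_vertical:
  assumes p: "p \<in> cover n D" and v: "v \<in> tangent (cover_shape n) (cover n D) p"
    and v0: "v ! 0 = 0\<^sub>m n n" and i: "1 \<le> i" "i \<le> n"
  shows "v ! i = 0\<^sub>m i i"
proof -
  let ?ds = "cover_shape n"
  have pa: "p \<in> aff ?ds" and va: "v \<in> aff ?ds" using cover_aff p tangent_aff[OF v] by auto
  have vc: "v ! i \<in> carrier_mat i i" using va i by (simp add: aff_cover_iff)
  have pc: "p ! i \<in> carrier_mat i i" "p ! 0 \<in> carrier_mat n n" using coverD(5)[OF p i] coverD(3)[OF p] by auto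
  have il: "i < length ?ds" "?ds ! i = i" "0 < length ?ds" "?ds ! 0 = n"
    using i cover_shape_nth by auto
  have sz: "sum_list (D i) = i" by (rule sum_blocks[OF i])
  have van: "diff F p v = 0" if "F \<in> poly_fun ?ds" "\<And>q. q \<in> cover n D \<Longrightarrow> F q = 0" for F
    using v that by (rule tangentD)
  have coord: "(\<lambda>q. q ! i $$ (a, b)) \<in> poly_fun ?ds" "diff (\<lambda>q. q ! i $$ (a, b)) p v = v ! i $$ (a, b)"
    if "a < i" "b < i" for a b
    using that il by (auto intro!: poly_fun.coord diff_coord[OF pa va])
  note center = levi_center_entries[OF levi_center_gen_center[OF coverD(4)[OF _ i]], unfolded sz]
  have "v ! i = 0\<^sub>m (sum_list (D i)) (sum_list (D i))"
  proof (rule levi_center_trace_form[OF coverD(4)[OF p i]], unfold sz)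
    show "v ! i \<in> carrier_mat i i" by (rule vc)
  next
    fix a b assume ab: "a < i" "b < i" "a \<noteq> b"
    show "v ! i $$ (a, b) = 0" unfolding coord(2)[OF ab(1,2), symmetric]
      by (rule van[OF coord(1)[OF ab(1,2)] center(1)[OF _ ab]])
  next
    fix a b assume ab: "a < i" "b < i" "block_of (D i) a = block_of (D i) b"
    have "diff (\<lambda>q. q ! i $$ (a, a) - q ! i $$ (b, b)) p v = 0"
    proof (rule van)
      show "(\<lambda>q. q ! i $$ (a, a) - q ! i $$ (b, b)) \<in> poly_fun ?ds"
        using coord(1) ab by (intro poly_fun_minus) auto
      show "q ! i $$ (a, a) - q ! i $$ (b, b) = 0" if "q \<in> cover n D" for q
        using center(2)[OF that ab] by simp
    qed
    then show "v ! i $$ (a, a) = v ! i $$ (b, b)"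
      using diff_minus_fun[OF pa va coord(1) coord(1), of a a b b] coord(2) ab by simp
  next
    fix j
    let ?F = "\<lambda>q. tr (corner i (q ! 0) ^\<^sub>m Suc j) - tr ((corner i (q ! i) + e i) ^\<^sub>m Suc j)"
    have ec: "e i \<in> carrier_mat i i" using principal_nilpotent_carrier[of "D i"] sz by simp
    have "diff ?F p v = 0"
    proof (rule van)
      show "?F \<in> poly_fun ?ds"
        by (intro poly_fun_minus poly.in_tr[of _ i] poly.mat_in_pow poly.mat_in_add poly.mat_in_const ec poly_corner)
          (use il i in auto)
      fix q assume q: "q \<in> cover n D"
      obtain G where G: "G \<in> carrier_mat i i" "det G \<noteq> 0" "G * (q ! i + e i) = corner i (q ! 0) * G"
        using coverD(6)[OF q i] similar_mat_iff[of "corner i (q ! 0)" i] by auto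
      have A: "q ! i + e i \<in> carrier_mat i i" by (rule cyclic_carrier[OF coverD(7)[OF q i]])
      have "conj_by G (q ! i + e i) = corner i (q ! 0)" using conjugate_iff[OF G(1,2) A] G(3) by simp
      then have "tr (corner i (q ! 0) ^\<^sub>m Suc j) = tr ((q ! i + e i) ^\<^sub>m Suc j)"
        using tr_pow_conjugate[OF G(1,2) A, of "Suc j"] by simp
      then show "?F q = 0" using coverD(5)[OF q i] by simp
    qed
    moreover have "diff ?F p v = - of_nat (Suc j) * tr ((p ! i + e i) ^\<^sub>m j * v ! i)"
    proof (rule diff_eqI)
      have li: "pt_add p (pt_scale t v) ! i = p ! i + t \<cdot>\<^sub>m v ! i" "pt_add p (pt_scale t v) ! 0 = p ! 0 + t \<cdot>\<^sub>m v ! 0" for t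
        using pa va il by (auto simp: pt_add_nth pt_scale_nth aff_iff)
      have l0: "p ! 0 + t \<cdot>\<^sub>m v ! 0 = p ! 0" for t using pc v0 by (intro eq_matI) auto
      have ci: "corner i (p ! i + t \<cdot>\<^sub>m v ! i) = p ! i + t \<cdot>\<^sub>m v ! i" for t using pc vc by (intro corner_id) auto
      have "has_mat_deriv i (\<lambda>t. (p ! i + t \<cdot>\<^sub>m v ! i) + e i) (v ! i + 0\<^sub>m i i)"
        by (intro has_mat_deriv_add has_mat_deriv_line has_mat_deriv_const ec pc vc)
      from deriv_tr_pow[OF this, of "Suc j"]
      have "((\<lambda>t. tr ((p ! i + t \<cdot>\<^sub>m v ! i + e i) ^\<^sub>m Suc j)) has_field_derivative
          of_nat (Suc j) * tr ((p ! i + 0 \<cdot>\<^sub>m v ! i + e i) ^\<^sub>m j * (v ! i + 0\<^sub>m i i))) (at 0)"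
        by (simp only: diff_Suc_1)
      moreover have "p ! i + 0 \<cdot>\<^sub>m v ! i = p ! i" using pc vc by (intro eq_matI) auto
      moreover have "v ! i + 0\<^sub>m i i = v ! i" by (rule right_add_zero_mat[OF vc])
      ultimately have "((\<lambda>t. tr ((p ! i + t \<cdot>\<^sub>m v ! i + e i) ^\<^sub>m Suc j)) has_field_derivative
          of_nat (Suc j) * tr ((p ! i + e i) ^\<^sub>m j * v ! i)) (at 0)" by (simp only:)
      from DERIV_diff[OF DERIV_const this, of "tr (corner i (p ! 0) ^\<^sub>m Suc j)"]
      show "((\<lambda>t. ?F (pt_add p (pt_scale t v))) has_field_derivative - of_nat (Suc j) * tr ((p ! i + e i) ^\<^sub>m j * v ! i)) (at 0)"
        unfolding li l0 ci by (simp only: diff_0 minus_mult_left)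
    qed
    ultimately show "tr ((p ! i + e i) ^\<^sub>m j * v ! i) = 0" by (simp del: of_nat_Suc)
  qed
  then show ?thesis by (simp only: sz)
qed

lemma lifted_regular:
  assumes "j \<le> n"
  shows "reg.mat_in (cover_shape n) (cover n D) (cover_shape n ! j) (cover_shape n ! j) (\<lambda>p. lifted c p ! j)"
proof (cases "j = 0")
  case True
  have "reg.mat_in (cover_shape n) (cover n D) n n (\<lambda>p. gz_comb n c (p ! 0))"
    using reg_coord[OF cover_aff, of 0] cover_shape_nth(2,3) by (intro reg.mat_in_gz_comb) simp
  then show ?thesis unfolding True cover_shape_nth(2)
    by (rule reg.mat_in_cong) (simp add: eventually_principal lifted_nth(1))
next
  case False
  have "reg.mat_in (cover_shape n) (cover n D) j j (\<lambda>p. 0\<^sub>m j j)" by (rule reg.mat_in_const) simp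
  then have "reg.mat_in (cover_shape n) (cover n D) j j (\<lambda>p. lifted c p ! j)"
    by (rule reg.mat_in_cong) (use False assms lifted_nth(2) in \<open>simp add: eventually_principal\<close>)
  then show ?thesis using False assms cover_shape_nth(1)[of j] by simp
qed

lemma is_lift_lifted: "is_lift n D (gz_field n c) (lifted c)"
  unfolding is_lift_def vector_fields_def mem_Collect_eq morphism_def
proof (intro conjI ballI allI impI)
  show "lifted c \<in> extensional (cover n D)" by (simp add: lifted_def)
  show "lifted c \<in> cover n D \<rightarrow> aff (cover_shape n)" using lifted_aff by blast
  show "lifted c p \<in> tangent (cover_shape n) (cover n D) p" if "p \<in> cover n D" for p
    using that by (rule lifted_tangent)
  show "tangent_map (cover_shape n) [n] (cover n D) cover_proj p (lifted c p) = gz_field n c (cover_proj p)"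
    if p: "p \<in> cover n D" for p
    using tangent_map_proj[OF p lifted_tangent[OF p]] coverD(3)[OF p] by (simp add: lifted_nth(1)[OF p] cover_proj_def)
  fix j a b assume "j < length (cover_shape n)" and ab: "a < cover_shape n ! j" "b < cover_shape n ! j"
  then have "j \<le> n" by (simp add: cover_shape_nth(3))
  then show "regular_fun (cover_shape n) (cover n D) (\<lambda>q. lifted c q ! j $$ (a, b))"
    using reg.mat_inD(2)[OF lifted_regular ab] by simp
qed

text \<open>
  The difference of two lifts is vertical and hence zero.
\<close>

lemma is_lift_iff: "is_lift n D (gz_field n c) \<eta> \<longleftrightarrow> \<eta> = lifted c"
proof
  assume l: "is_lift n D (gz_field n c) \<eta>"
  show "\<eta> = lifted c"
  proof (rule extensionalityI[of _ "cover n D"])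
    show "\<eta> \<in> extensional (cover n D)" using l by (simp add: is_lift_def vector_fields_def)
    show "lifted c \<in> extensional (cover n D)" by (simp add: lifted_def)
    fix p assume p: "p \<in> cover n D"
    have tan: "\<eta> p \<in> tangent (cover_shape n) (cover n D) p"
      using l p unfolding is_lift_def vector_fields_def by blast
    have pa: "p \<in> aff (cover_shape n)" using cover_aff p by blast
    note ea = tangent_aff[OF tan, unfolded aff_cover_iff]
    note la = lifted_aff[OF p, of c, unfolded aff_cover_iff]
    have "[\<eta> p ! 0] = gz_field n c (cover_proj p)"
      using l p tangent_map_proj[OF p tan] unfolding is_lift_def by simp
    then have e0: "\<eta> p ! 0 = lifted c p ! 0"
      using coverD(3)[OF p] by (simp add: cover_proj_def lifted_nth(1)[OF p])
    \<comment> \<open>the difference is a vertical tangent vector\<close>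
    have dt: "pt_diff (\<eta> p) (lifted c p) \<in> tangent (cover_shape n) (cover n D) p"
      by (rule tangent_diff[OF pa tan lifted_tangent[OF p]])
    have d: "pt_diff (\<eta> p) (lifted c p) ! i = \<eta> p ! i - lifted c p ! i" if "i \<le> n" for i
      using that ea la by (subst pt_diff_nth) auto
    have "pt_diff (\<eta> p) (lifted c p) ! 0 = 0\<^sub>m n n"
      unfolding d[OF le0] e0 using la by (intro eq_matI) auto
    note vert = tangent_vertical[OF p dt this]
    show "\<eta> p = lifted c p"
    proof (rule cover_point_eqI[OF _ _ e0])
      fix i assume i: "1 \<le> i" "i \<le> n"
      have z: "\<eta> p ! i - 0\<^sub>m i i = 0\<^sub>m i i" using vert[OF i] d[OF i(2)] lifted_nth(2)[OF p i, of c] by simp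
      have "\<eta> p ! i $$ (a, b) = 0" if "a < i" "b < i" for a b
      proof -
        have "(\<eta> p ! i - 0\<^sub>m i i) $$ (a, b) = 0" unfolding z using that by simp
        then show ?thesis using that by simp
      qed
      then show "\<eta> p ! i = lifted c p ! i"
        unfolding lifted_nth(2)[OF p i] using ea i by (intro eq_matI) auto
    qed (use ea la in auto)
  qed
qed (simp add: is_lift_lifted)

lemma lifted_add: "vf_add (cover n D) (lifted c) (lifted d) = lifted (\<lambda>m. c m + d m)"
proof (rule extensionalityI[of _ "cover n D"])
  fix p assume p: "p \<in> cover n D"
  have "pt_add (lifted c p) (lifted d p) = lifted (\<lambda>m. c m + d m) p"
  proof (rule cover_point_eqI)
    fix i assume i: "1 \<le> i" "i \<le> n"
    show "pt_add (lifted c p) (lifted d p) ! i = lifted (\<lambda>m. c m + d m) p ! i"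
      using i lifted_nth(3)[OF p] by (simp add: pt_add_nth lifted_nth(2)[OF p i])
  qed (simp_all add: pt_add_nth lifted_nth(1,3)[OF p] gz_comb_add)
  then show "vf_add (cover n D) (lifted c) (lifted d) p = lifted (\<lambda>m. c m + d m) p" using p by (simp add: vf_add_def)
qed (simp_all add: vf_add_def lifted_def)

lemma lifted_scale: "vf_scale (cover n D) s (lifted c) = lifted (\<lambda>m. s * c m)"
proof (rule extensionalityI[of _ "cover n D"])
  fix p assume p: "p \<in> cover n D"
  have "pt_scale s (lifted c p) = lifted (\<lambda>m. s * c m) p"
  proof (rule cover_point_eqI)
    fix i assume i: "1 \<le> i" "i \<le> n"
    show "pt_scale s (lifted c p) ! i = lifted (\<lambda>m. s * c m) p ! i"
      using i lifted_nth(3)[OF p] by (simp add: pt_scale_nth lifted_nth(2)[OF p i])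
  qed (simp_all add: pt_scale_nth lifted_nth(1,3)[OF p] gz_comb_scale)
  then show "vf_scale (cover n D) s (lifted c) p = lifted (\<lambda>m. s * c m) p" using p by (simp add: vf_scale_def)
qed (simp_all add: vf_scale_def lifted_def)

lemma gz_field_bracket: "vf_bracket [n] (aff [n]) (gz_field n c) (gz_field n d) = gz_field n (\<lambda>m. 0)"
proof (rule extensionalityI[of _ "aff [n]"])
  fix p assume "p \<in> aff [n]"
  then obtain x where p: "p = [x]" and x: "x \<in> carrier_mat n n" by (rule aff_singleE)
  have t: "tangent_map [n] [n] (aff [n]) (gz_field n d) [x] [gz_comb n c x]
    = [mat n n (\<lambda>(a, b). diff (\<lambda>q. gz_comb n d (corner n (q ! 0)) $$ (a, b)) [x] [gz_comb n c x])]" for c d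
  proof -
    have "diff_on [n] (aff [n]) (\<lambda>q. gz_field n d q ! 0 $$ (a, b)) [x] [gz_comb n c x]
      = diff (\<lambda>q. gz_comb n d (corner n (q ! 0)) $$ (a, b)) [x] [gz_comb n c x]" if "a < n" "b < n" for a b
      by (rule diff_on_poly) (use x that gz_comb_poly in \<open>auto simp: tangent_aff_space elim!: aff_singleE\<close>)
    then show ?thesis by (auto simp: tangent_map_def intro!: eq_matI)
  qed
  have swap: "mat n n (\<lambda>(a, b). diff (\<lambda>q. gz_comb n d (corner n (q ! 0)) $$ (a, b)) [x] [gz_comb n c x])
    = mat n n (\<lambda>(a, b). diff (\<lambda>q. gz_comb n c (corner n (q ! 0)) $$ (a, b)) [x] [gz_comb n d x])"
    by (intro eq_matI) (simp_all add: diff_gz_comb_swap[OF x])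
  show "vf_bracket [n] (aff [n]) (gz_field n c) (gz_field n d) p = gz_field n (\<lambda>m. 0) p"
    using x by (simp add: p vf_bracket_def t swap pt_diff_def gz_comb_zero)
qed (simp_all add: vf_bracket_def gz_field_def)

lemma lifted_bracket: "vf_bracket (cover_shape n) (cover n D) (lifted c) (lifted d) = lifted (\<lambda>m. 0)"
proof (rule extensionalityI[of _ "cover n D"])
  let ?ds = "cover_shape n" and ?V = "cover n D"
  fix p assume p: "p \<in> cover n D"
  have x: "p ! 0 \<in> carrier_mat n n" by (rule coverD(3)[OF p])
  define T where "T c d = tangent_map ?ds ?ds ?V (lifted d) p (lifted c p)" for c d
  have len: "length (T c d) = Suc n" for c d by (simp add: T_def tangent_map_def cover_shape_nth(3))
  have T_nth: "T c d ! j = mat (?ds ! j) (?ds ! j) (\<lambda>(a, b). diff_on ?ds ?V (\<lambda>q. lifted d q ! j $$ (a, b)) p (lifted c p))"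
    if "j \<le> n" for j c d using that by (simp add: T_def tangent_map_def cover_shape_nth(3) del: upt_Suc)
  have T0: "T c d ! 0 = mat n n (\<lambda>(a, b). diff (\<lambda>q. gz_comb n d (corner n (q ! 0)) $$ (a, b)) [p ! 0] [gz_comb n c (p ! 0)])" for c d
  proof -
    have "diff_on ?ds ?V (\<lambda>q. lifted d q ! 0 $$ (a, b)) p (lifted c p)
      = diff (\<lambda>q. gz_comb n d (corner n (q ! 0)) $$ (a, b)) [p ! 0] [gz_comb n c (p ! 0)]" if ab: "a < n" "b < n" for a b
    proof -
      have "diff_on ?ds ?V (\<lambda>q. lifted d q ! 0 $$ (a, b)) p (lifted c p)
        = diff (\<lambda>q. gz_comb n d (corner n (q ! 0)) $$ (a, b)) p (lifted c p)"
      proof (rule diff_on_poly[OF p cover_aff lifted_tangent[OF p]])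
        have "poly.mat_in ?ds n n (\<lambda>q. gz_comb n d (corner n (q ! 0)))"
          by (intro poly.mat_in_gz_comb poly_corner) (simp_all add: cover_shape_nth(2,3))
        then show "(\<lambda>q. gz_comb n d (corner n (q ! 0)) $$ (a, b)) \<in> poly_fun ?ds" using ab by (rule poly.mat_inD(2))
        show "lifted d q ! 0 $$ (a, b) = gz_comb n d (corner n (q ! 0)) $$ (a, b)" if "q \<in> ?V" for q
          using coverD(3)[OF that] by (simp add: lifted_nth(1)[OF that])
      qed
      also have "\<dots> = diff (\<lambda>q. gz_comb n d (corner n (q ! 0)) $$ (a, b)) [p ! 0] [lifted c p ! 0]"
        by (rule diff_first[of p "lifted c p" "\<lambda>x. gz_comb n d (corner n x) $$ (a, b)"])
          (use coverD(1)[OF p] lifted_nth(3)[OF p, of c] in auto)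
      finally show ?thesis by (simp only: lifted_nth(1)[OF p])
    qed
    then show ?thesis unfolding T_nth[OF le0] cover_shape_nth(2) by (intro eq_matI) auto
  qed
  have Ti: "T c d ! i = 0\<^sub>m i i" if i: "1 \<le> i" "i \<le> n" for i c d
  proof -
    have "diff_on ?ds ?V (\<lambda>q. lifted d q ! i $$ (a, b)) p (lifted c p) = 0" if ab: "a < i" "b < i" for a b
    proof -
      have "diff_on ?ds ?V (\<lambda>q. lifted d q ! i $$ (a, b)) p (lifted c p) = diff (\<lambda>q. 0) p (lifted c p)"
        by (rule diff_on_poly[OF p cover_aff lifted_tangent[OF p] poly_fun.const]) (use ab i lifted_nth(2) in simp)
      then show ?thesis by (simp add: diff_const)
    qed
    then show ?thesis unfolding T_nth[OF i(2)] cover_shape_nth(1)[OF i] by (intro eq_matI) auto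
  qed
  have swap: "T c d ! 0 = T d c ! 0"
    unfolding T0 by (intro eq_matI) (simp_all add: diff_gz_comb_swap[OF x])
  have Tc: "T d c ! 0 \<in> carrier_mat n n" unfolding T0 by simp
  have "pt_diff (T c d) (T d c) = lifted (\<lambda>m. 0) p"
  proof (rule cover_point_eqI)
    show "pt_diff (T c d) (T d c) ! 0 = lifted (\<lambda>m. 0) p ! 0"
      using Tc by (simp add: pt_diff_nth len swap lifted_nth(1)[OF p] gz_comb_zero)
    fix i assume i: "1 \<le> i" "i \<le> n"
    show "pt_diff (T c d) (T d c) ! i = lifted (\<lambda>m. 0) p ! i"
      using i by (simp add: pt_diff_nth len Ti[OF i] lifted_nth(2)[OF p i])
  qed (simp_all add: len lifted_nth(3)[OF p])
  then show "vf_bracket ?ds ?V (lifted c) (lifted d) p = lifted (\<lambda>m. 0) p"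
    using p by (simp add: vf_bracket_def T_def)
qed (simp_all add: vf_bracket_def lifted_def)

lemma algebra_lifts: "gz_algebra_lifts n D"
  unfolding gz_algebra_lifts_def gz_algebra_eq
proof (intro conjI ballI allI impI)
  fix \<xi> assume "\<xi> \<in> range (gz_field n)"
  then show "\<exists>!\<eta>. is_lift n D \<xi> \<eta>" using is_lift_iff by auto
next
  fix \<xi> \<xi>' \<eta> \<eta>' s assume "\<xi> \<in> range (gz_field n)" "\<xi>' \<in> range (gz_field n)"
    and l: "is_lift n D \<xi> \<eta>" "is_lift n D \<xi>' \<eta>'"
  then obtain c c' where c: "\<xi> = gz_field n c" "\<xi>' = gz_field n c'" by auto
  have \<eta>: "\<eta> = lifted c" "\<eta>' = lifted c'" using l unfolding c is_lift_iff by auto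
  show "is_lift n D (vf_add (aff [n]) \<xi> \<xi>') (vf_add (cover n D) \<eta> \<eta>')"
    unfolding c \<eta> gz_field_add lifted_add by (rule is_lift_lifted)
  show "is_lift n D (vf_scale (aff [n]) s \<xi>) (vf_scale (cover n D) s \<eta>)"
    unfolding c \<eta> gz_field_scale lifted_scale by (rule is_lift_lifted)
  show "is_lift n D (vf_bracket [n] (aff [n]) \<xi> \<xi>') (vf_bracket (cover_shape n) (cover n D) \<eta> \<eta>')"
    unfolding c \<eta> gz_field_bracket lifted_bracket by (rule is_lift_lifted)
qed

lemma lift_eq: "lift n D (gz_field n c) = lifted c"
  unfolding lift_def is_lift_iff by (rule the_eq_trivial)

section \<open>The action integrates the lift\<close>

lemma fundamental_field_eq:
  assumes p: "p \<in> cover n D" and Y: "Y \<in> Z_lie n D"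
  shows "fundamental_field n D (act n D) Y p = lifted (lie_coef (tl p) Y) p"
proof -
  let ?k = "\<lambda>t. pt_add one (pt_scale t Y)" and ?ds = "Z_shape n"
  note zs = cover_tuples[OF p]
  have Ya: "Y \<in> aff ?ds" using Y unfolding Z_lie_def by (rule tangent_aff)
  have ev: "eventually (\<lambda>t. ?k t \<in> Z) (nhds 0)"
    using Y unfolding Z_lie_iff[OF zs] by (intro Z_curve[OF zs]) auto
  note k0 = Z_line_0[OF Ya]
  have diff_val: "diff_on ?ds Z f one Y = d"
    if "regular_fun ?ds Z f" "((\<lambda>t. f (?k t)) has_field_derivative d) (at 0)" for f d
    using diff_on_curve[of ?k Z ?ds Y f] that Z_aff Ya line_has_tangent[OF one_aff Ya] ev Z_one_closed k0 DERIV_unique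
    by simp
  have moved_reg: "reg.mat_in ?ds Z n n (\<lambda>k. moved n D k p)"
  proof (rule reg.mat_in_moved[OF decomposition_data_axioms])
    fix i assume i: "1 \<le> i" "i < n"
    show "reg.mat_in ?ds Z i i (\<lambda>k. k ! (i - 1))"
      using reg_coord[OF Z_aff, of "i - 1"] i Z_shape_nth(2) Z_shape_nth(1)[OF i] by simp
    show "reg.mat_in ?ds Z i i (\<lambda>k. p ! i)" using coverD(5)[OF p, of i] i by (intro reg.mat_in_const) simp
  qed (use p coverD(3)[OF p] in \<open>auto simp: eventually_principal intro: reg.mat_in_const\<close>)
  let ?T = "fundamental_field n D (act n D) Y p"
  have len: "length ?T = Suc n" by (simp add: fundamental_field_def tangent_map_def cover_shape_nth(3))
  have nth: "?T ! j = mat (cover_shape n ! j) (cover_shape n ! j) (\<lambda>(a, b). diff_on ?ds Z (\<lambda>k. act n D k p ! j $$ (a, b)) one Y)"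
    if "j \<le> n" for j
    using that by (simp add: fundamental_field_def tangent_map_def cover_shape_nth(3) del: upt_Suc)
  show ?thesis
  proof (rule cover_point_eqI[OF len lifted_nth(3)[OF p]])
    have "diff_on ?ds Z (\<lambda>k. act n D k p ! 0 $$ (a, b)) one Y = gz_comb n (lie_coef (tl p) Y) (p ! 0) $$ (a, b)"
      if ab: "a < n" "b < n" for a b
      unfolding act_nth(1)[OF p]
      using reg.mat_inD(2)[OF moved_reg ab] has_mat_derivD(3)[OF moved_deriv[OF p Y] ab] by (intro diff_val) auto
    then show "?T ! 0 = lifted (lie_coef (tl p) Y) p ! 0"
      unfolding nth[OF le0] cover_shape_nth(2) lifted_nth(1)[OF p] by (intro eq_matI) (auto simp: gz_comb_def)
    fix i assume i: "1 \<le> i" "i \<le> n"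
    have "diff_on ?ds Z (\<lambda>k. act n D k p ! i $$ (a, b)) one Y = 0" if ab: "a < i" "b < i" for a b
      unfolding act_nth(2)[OF p i] using reg.const[of "p ! i $$ (a, b)" ?ds Z] by (intro diff_val) auto
    then show "?T ! i = lifted (lie_coef (tl p) Y) p ! i"
      unfolding nth[OF i(2)] cover_shape_nth(1)[OF i] lifted_nth(2)[OF p i] by (intro eq_matI) auto
  qed
qed

text \<open>
  The isomorphism takes \<open>Y\<close> to the field whose coefficients are, up to sign, those of the polynomials in
  \<open>z\<^sub>i + e\<^sup>i\<close> that represent the components of \<open>Y\<close>.
\<close>

lemma act_integrates: "integrates_lift n D (act n D)"
  unfolding integrates_lift_def
proof
  fix zs assume zs: "zs \<in> center_tuples n D"
  let ?\<phi> = "\<lambda>Y. gz_field n (lie_coef zs Y)"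
  have Ya: "Y \<in> aff (Z_shape n)" if "Y \<in> Z_lie n D" for Y using that unfolding Z_lie_def by (rule tangent_aff)
  have idx: "1 \<le> fst m" "fst m < n" "fst m \<le> n" if "m \<in> gz_index n" for m using that by (auto simp: gz_index_def)
  have len: "length Y = n - 1" if "Y \<in> Z_lie n D" for Y using Ya[OF that] Z_shape_nth(2) by (simp add: aff_iff)
  have nth_less: "fst m - 1 < n - 1" if "m \<in> gz_index n" for m using idx[OF that] by linarith
  have add: "lie_coef zs (pt_add Y Y') m = lie_coef zs Y m + lie_coef zs Y' m"
    if "Y \<in> Z_lie n D" "Y' \<in> Z_lie n D" "m \<in> gz_index n" for Y Y' m
    using coef_add[OF tuplesD(3)[OF zs idx(1,3)[OF that(3)]] aff_Z_nth[OF Ya[OF that(1)] idx(1,2)[OF that(3)]]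
        aff_Z_nth[OF Ya[OF that(2)] idx(1,2)[OF that(3)]]] nth_less[OF that(3)] len[OF that(1)] len[OF that(2)]
    by (simp add: lie_coef_def pt_add_nth)
  have scale: "lie_coef zs (pt_scale s Y) m = s * lie_coef zs Y m"
    if "Y \<in> Z_lie n D" "m \<in> gz_index n" for Y s m
    using coef_smult[OF tuplesD(3)[OF zs idx(1,3)[OF that(2)]] aff_Z_nth[OF Ya[OF that(1)] idx(1,2)[OF that(2)]]]
      nth_less[OF that(2)] len[OF that(1)]
    by (simp add: lie_coef_def pt_scale_nth)
  show "\<exists>\<phi>. bij_betw \<phi> (Z_lie n D) (gz_algebra n) \<and>
     (\<forall>Y\<in>Z_lie n D. \<forall>Y'\<in>Z_lie n D. \<phi> (pt_add Y Y') = vf_add (aff [n]) (\<phi> Y) (\<phi> Y')) \<and>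
     (\<forall>Y\<in>Z_lie n D. \<forall>c. \<phi> (pt_scale c Y) = vf_scale (aff [n]) c (\<phi> Y)) \<and>
     (\<forall>Y\<in>Z_lie n D. \<forall>x. x # zs \<in> cover n D \<longrightarrow>
        fundamental_field n D (act n D) Y (x # zs) = lift n D (\<phi> Y) (x # zs))"
  proof (intro exI[of _ ?\<phi>] conjI ballI allI impI)
    show "bij_betw ?\<phi> (Z_lie n D) (gz_algebra n)"
      unfolding bij_betw_def gz_algebra_eq
    proof
      show "inj_on ?\<phi> (Z_lie n D)"
      proof (rule inj_onI)
        fix Y Y' assume Y: "Y \<in> Z_lie n D" "Y' \<in> Z_lie n D" and eq: "?\<phi> Y = ?\<phi> Y'"
        show "Y = Y'"
        proof (rule point_eqI[OF len[OF Y(1)] len[OF Y(2)]])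
          fix i assume i: "1 \<le> i" "i < n"
          then have i': "i \<le> n" by simp
          let ?A = "shifted zs i"
          have poly: "mat_poly i (coef ?A (Y ! (i - 1))) ?A = Y ! (i - 1)" if "Y \<in> Z_lie n D" for Y
            using that i unfolding Z_lie_iff[OF zs]
            by (intro commuting_eq_mat_poly[OF tuplesD(2)[OF zs i(1) i'] aff_Z_nth[OF Ya[OF that] i]]) auto
          have "coef ?A (Y ! (i - 1)) j = coef ?A (Y' ! (i - 1)) j" if "j < i" for j
            using gz_field_inj[OF eq, of "(i, j)"] i that by (simp add: gz_index_def lie_coef_def)
          then show "Y ! (i - 1) = Y' ! (i - 1)"
            using poly[OF Y(1)] poly[OF Y(2)] mat_poly_cong[of i "coef ?A (Y ! (i - 1))" "coef ?A (Y' ! (i - 1))" ?A] by simp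
        qed
      qed
      show "?\<phi> ` Z_lie n D = range (gz_field n)"
      proof (intro equalityI subsetI)
        fix \<xi> assume "\<xi> \<in> range (gz_field n)"
        then obtain c where c: "\<xi> = gz_field n c" by auto
        obtain Y where "Y \<in> Z_lie n D" "\<And>m. m \<in> gz_index n \<Longrightarrow> lie_coef zs Y m = c m"
          using lie_coef_surj[OF zs, of c] by blast
        then show "\<xi> \<in> ?\<phi> ` Z_lie n D" unfolding c using gz_field_cong[of n "lie_coef zs Y" c] by force
      qed auto
    qed
    show "?\<phi> (pt_add Y Y') = vf_add (aff [n]) (?\<phi> Y) (?\<phi> Y')" if "Y \<in> Z_lie n D" "Y' \<in> Z_lie n D" for Y Y'
      unfolding gz_field_add using add[OF that] by (rule gz_field_cong)
    show "?\<phi> (pt_scale s Y) = vf_scale (aff [n]) s (?\<phi> Y)" if "Y \<in> Z_lie n D" for Y s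
      unfolding gz_field_scale using scale[OF that] by (rule gz_field_cong)
    show "fundamental_field n D (act n D) Y (x # zs) = lift n D (?\<phi> Y) (x # zs)"
      if "Y \<in> Z_lie n D" "x # zs \<in> cover n D" for Y x
      using fundamental_field_eq[OF that(2,1)] by (simp add: lift_eq)
  qed
qed

end

theorem theorem1p2:
  fixes n :: nat and D :: "nat \<Rightarrow> nat list"
  assumes "n \<ge> 1"
    and "regular_decomposition_data n D"
  shows "gz_algebra_lifts n D \<and>
    (\<exists>\<alpha>. algebraic_action n D \<alpha> \<and> free_action n D \<alpha> \<and> integrates_lift n D \<alpha>)"
proof -
  interpret decomposition_data n D by unfold_locales (rule assms)+
  show ?thesis using algebra_lifts act_algebraic act_free act_integrates by blast
qed

end
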